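(* Let $0<q<1$, let $\widetilde a,\widetilde b,\widetilde c$ be real with $0<q\widetilde a<1$, $0<q\widetilde b<1$, $\widetilde c<0$, and let $A,B\in\mathbb R$ be such that the big $q$-Jacobi-Krall-type polynomials $P_n^{A,B}(z)=P_n^{A,B}(z;\widetilde a,\widetilde b,\widetilde c;q)$ exist for all $n\ge 0$, i.e. $\kappa_m(\widetilde cq,\widetilde aq)\ne0$ for all $m\ge0$. For each integer $N\ge1$ choose $\alpha,\beta\in\mathbb R$, $a,b\in\mathbb C$ with $$q^\alpha=\widetilde a,\qquad q^\beta=\widetilde b,\qquad b-a=N+1,\qquad q^{a+b}=\frac{\widetilde c}{\widetilde a},$$ and put $C_n=(q^{N})^{n/2}(q\widetilde a)^n(\widetilde c/\widetilde a)^{n/2}\kappa_q^{2n}$ with $(\widetilde c/\widetilde a)^{1/2}:=q^{(a+b)/2}$. Let $u_n^{\alpha,\beta,A,B}(s)_q$ be the non-standard $q$-Racah-Krall-type polynomials (defined for $N$ large, $n$ fixed). Then: (1) For all fixed $n,s\ge0$, $$\lim_{N\to\infty}C_nu_n^{\alpha,\beta,A,B}(s+a)_q=P_n^{A,B}(\widetilde cq^{s+1}),\qquad \lim_{N\to\infty}C_nu_n^{\alpha,\beta,A,B}(N-s+a)_q=P_n^{A,B}(\widetilde aq^{s+1}).$$ (2) The orthogonality relation of the $q$-Racah-Krall-type polynomials $$\sum_{s=0}^{N}u_n^{\alpha,\beta,A,B}(s+a)_qu_m^{\alpha,\beta,A,B}(s+a)_q\,\rho(s+a)[2s+2a+1]_q+Au_n^{\alpha,\beta,A,B}(a)_qu_m^{\alpha,\beta,A,B}(a)_q+Bu_n^{\alpha,\beta,A,B}(b-1)_qu_m^{\alpha,\beta,A,B}(b-1)_q=\delta_{n,m}(d_n^{A,B})^2,$$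 multiplied by $C_nC_m$, becomes as $N\to\infty$ the orthogonality relation of the big $q$-Jacobi-Krall-type polynomials $$(1-q)(-\widetilde c)\sum_{s=0}^\infty P_n^{A,B}(\widetilde cq^{s+1})P_m^{A,B}(\widetilde cq^{s+1})\widetilde\rho(\widetilde cq^{s+1})q^{s+1}+(1-q)\widetilde a\sum_{s=0}^\infty P_n^{A,B}(\widetilde aq^{s+1})P_m^{A,B}(\widetilde aq^{s+1})\widetilde\rho(\widetilde aq^{s+1})q^{s+1}$$ $$+AP_n^{A,B}(\widetilde cq)P_m^{A,B}(\widetilde cq)+BP_n^{A,B}(\widetilde aq)P_m^{A,B}(\widetilde aq)=(\widetilde d_n^{A,B})^2\,\delta_{n,m};$$ that is, $C_nC_m$ times the sum over $s$ (resp. the $A$-term, the $B$-term) of the first relation converges to the sum of the two infinite series (resp. the $A$-term, the $B$-term) of the second, and $\lim_{N\to\infty}C_n^2(d_n^{A,B})^2=(\widetilde d_n^{A,B})^2$. (3) The three-term recurrence relation $\mu(s)u_n^{\alpha,\beta,A,B}(s)_q=u_{n+1}^{\alpha,\beta,A,B}(s)_q+\beta_n^{A,B}u_n^{\alpha,\beta,A,B}(s)_q+\gamma_n^{A,B}u_{n-1}^{\alpha,\beta,A,B}(s)_q$ transforms as $N\to\infty$ into the three-term recurrence relation $zP_n^{A,B}(z)=P_{n+1}^{A,B}(z)+\widetilde\beta_n^{A,B}P_n^{A,B}(z)+\widetilde\gamma_n^{A,B}P_{n-1}^{A,B}(z)$; namely, for every fixed $n$ ($n\ge1$ for the second limit),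 $$\lim_{N\to\infty}q^{N+1}\widetilde a\frac{q^{a+1}}{c_1}[\beta_n^{A,B}-c_3]=\widetilde\beta_n^{A,B},\qquad\lim_{N\to\infty}q^{N+1}\widetilde a\frac{q^{a+1}}{c_1}\frac{C_n}{C_{n-1}}\gamma_n^{A,B}=\widetilde\gamma_n^{A,B}.$$
   Context: Notation. $0<q<1$, $q^z=e^{z\log q}$. $(x;q)_k=\prod_{i=0}^{k-1}(1-xq^i)$, $(x;q)_\infty=\prod_{i\ge0}(1-xq^i)$, $(x_1,\dots,x_r;q)_k=\prod_j(x_j;q)_k$; ${}_r\varphi_{r-1}$ is the standard basic hypergeometric series. $\kappa_q=q^{1/2}-q^{-1/2}$; $[s]_q=\dfrac{q^{s/2}-q^{-s/2}}{q^{1/2}-q^{-1/2}}$, $s\in\mathbb C$. Lattice: $\mu(s)=[s]_q[s+1]_q=c_1(q^s+q^{-s-1})+c_3$, $c_1=q^{1/2}\kappa_q^{-2}$, $c_3=-q^{-1/2}(1+q)\kappa_q^{-2}$. **Non-standard $q$-Racah.** Monic polynomials in $\mu(s)$ ($0\le n\le b-a-1$): $$u_n^{\alpha,\beta}(s)_q=q^{-\frac n2(2a+1)}\frac{(q^{a-b+1},q^{\beta+1},q^{a+b+\alpha+1};q)_n}{\kappa_q^{2n}(q^{\alpha+\beta+n+1};q)_n}\;{}_4\varphi_3\!\left(\begin{matrix}q^{-n},q^{\alpha+\beta+n+1},q^{a-s},q^{a+s+1}\\ q^{a-b+1},q^{\beta+1},q^{a+b+\alpha+1}\end{matrix}\Big|\,q,q\right),$$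 $$d_n^2=\frac{(q,q^{\alpha+1},q^{\beta+1},q^{b-a+\alpha+\beta+1},q^{a+b+\alpha+1},q^{a-b+1},q^{\beta-a-b+1};q)_n}{\kappa_q^{4n}(q^{\alpha+\beta+2};q)_{2n}(q^{\alpha+\beta+n+1};q)_n},$$ $$\rho(s)=\frac{\widetilde\Gamma_q(s+a+1)\widetilde\Gamma_q(s-a+\beta+1)\widetilde\Gamma_q(s+\alpha+b+1)\widetilde\Gamma_q(b+\alpha-s)\widetilde\Gamma_q(\alpha+\beta+2)\widetilde\Gamma_q(b-a)\widetilde\Gamma_q(a+b-\beta)}{\widetilde\Gamma_q(s-a+1)\widetilde\Gamma_q(s+b+1)\widetilde\Gamma_q(s+a-\beta+1)\widetilde\Gamma_q(b-s)\widetilde\Gamma_q(\alpha+1)\widetilde\Gamma_q(\beta+1)\widetilde\Gamma_q(b-a+\alpha+\beta+1)\widetilde\Gamma_q(a+b+\alpha+1)},$$ with $\widetilde\Gamma_q(s)=q^{-\frac{(s-1)(s-2)}4}(1-q)^{1-s}\frac{(q;q)_\infty}{(q^s;q)_\infty}$. Recurrence $\mu(s)u_n=u_{n+1}+\beta_nu_n+\gamma_nu_{n-1}$ with $$\beta_n=[a]_q[a+1]_q-\frac{[\alpha+\beta+n+1]_q[a-b+n+1]_q[\beta+n+1]_q[a+b+\alpha+n+1]_q}{[\alpha+\beta+2n+1]_q[\alpha+\beta+2n+2]_q}-\frac{[\alpha+n]_q[b-a+\alpha+\beta+n]_q[-a-b+\beta+n]_q[n]_q}{[\alpha+\beta+2n]_q[\alpha+\beta+2n+1]_q},$$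 $$\gamma_n=\frac{[n]_q[\alpha+\beta+n]_q[\alpha+n]_q[\beta+n]_q[b-a+\alpha+\beta+n]_q[-a-b+\beta+n]_q[a-b+n]_q[a+b+\alpha+n]_q}{[\alpha+\beta+2n-1]_q([\alpha+\beta+2n]_q)^2[\alpha+\beta+2n+1]_q}.$$ **Big $q$-Jacobi.** Monic polynomials $$P_n(z)=P_n(z;\widetilde a,\widetilde b,\widetilde c;q)=(-\widetilde a)^nq^{\frac{n(n+1)}2}\frac{(q\widetilde b,q\widetilde c;q)_n}{(\widetilde a\widetilde bq^{n+1};q)_n}\;{}_3\varphi_2\!\left(\begin{matrix}q^{-n},\widetilde a\widetilde bq^{n+1},q\widetilde cz^{-1}\\ q\widetilde b,q\widetilde c\end{matrix}\Big|\,q,\frac z{\widetilde a}\right),$$ $$\widetilde\rho(z)=\frac{(\widetilde a^{-1}z,\widetilde c^{-1}z;q)_\infty}{(z,\widetilde b\widetilde c^{-1}z;q)_\infty}\cdot\frac{(\widetilde aq,\widetilde bq,\widetilde cq,\widetilde a\widetilde b\widetilde c^{-1}q;q)_\infty}{\widetilde aq(1-q)(q,\widetilde a\widetilde bq^2,\widetilde a^{-1}\widetilde c,\widetilde a\widetilde c^{-1}q;q)_\infty},$$ $$\widetilde d_n^{\,2}=\frac{1-\widetilde a\widetilde bq}{1-\widetilde a\widetilde bq^{2n+1}}\cdot\frac{(q,\widetilde bq,\widetilde aq,\widetilde cq,\widetilde a\widetilde b\widetilde c^{-1}q;q)_n}{(\widetilde a\widetilde bq,\widetilde a\widetilde bq^{n+1},\widetilde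 a\widetilde bq^{n+1};q)_n}(-\widetilde a\widetilde cq^2)^nq^{\binom n2},$$ with recurrence $zP_n=P_{n+1}+\widetilde\beta_nP_n+\widetilde\gamma_nP_{n-1}$, $$\widetilde\beta_n=1-\frac{(1-\widetilde aq^{n+1})(1-\widetilde a\widetilde bq^{n+1})(1-\widetilde cq^{n+1})}{(1-\widetilde a\widetilde bq^{2n+1})(1-\widetilde a\widetilde bq^{2n+2})}+\widetilde a\widetilde cq^{n+1}\frac{(1-q^n)(1-\widetilde a\widetilde b\widetilde c^{-1}q^n)(1-\widetilde bq^n)}{(1-\widetilde a\widetilde bq^{2n})(1-\widetilde a\widetilde bq^{2n+1})},$$ $$\widetilde\gamma_n=-\widetilde a\widetilde cq^{n+1}\frac{(1-q^n)(1-\widetilde aq^n)(1-\widetilde bq^n)(1-\widetilde cq^n)(1-\widetilde a\widetilde bq^n)(1-\widetilde a\widetilde b\widetilde c^{-1}q^n)}{(1-\widetilde a\widetilde bq^{2n-1})(1-\widetilde a\widetilde bq^{2n})^2(1-\widetilde a\widetilde bq^{2n+1})}.$$ **Krall-type modification (same recipe for both families).** Let $(p_n)$ be the monic family with squared norms $h_n$ and recurrence coefficients $b_n,g_n$, and let $t_1,t_2$ be the two mass points: for $q$-Racah, $p_n=u_n^{\alpha,\beta}(\cdot)_q$, $h_n=d_n^2$, $(b_n,g_n)=(\beta_n,\gamma_n)$, $t_1=a$, $t_2=b-1$ (values of the variable $s$); for big $q$-Jacobi, $p_n=P_n$, $h_n=\widetilde d_n^{\,2}$, $(b_n,g_n)=(\widetilde\beta_n,\widetilde\gamma_n)$,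 $t_1=\widetilde cq$, $t_2=\widetilde aq$ (values of $z$). Define the kernels $K_m(x,y)=\sum_{k=0}^m\frac{p_k(x)p_k(y)}{h_k}$ ($K_{-1}=0$) and $$\kappa_m(x,y)=1+AK_m(x,x)+BK_m(y,y)+AB\{K_m(x,x)K_m(y,y)-K_m(x,y)^2\}.$$ The Krall-type polynomials $p_n^{A,B}$ are $$p_n^{A,B}(x)=p_n(x)-A\,p_n^{A,B}(t_1)K_{n-1}(x,t_1)-B\,p_n^{A,B}(t_2)K_{n-1}(x,t_2),$$ $$p_n^{A,B}(t_1)=\frac{(1+BK_{n-1}(t_2,t_2))p_n(t_1)-BK_{n-1}(t_1,t_2)p_n(t_2)}{\kappa_{n-1}(t_1,t_2)},\quad p_n^{A,B}(t_2)=\frac{-AK_{n-1}(t_2,t_1)p_n(t_1)+(1+AK_{n-1}(t_1,t_1))p_n(t_2)}{\kappa_{n-1}(t_1,t_2)}.$$ Their squared norms with respect to the modified functional (original functional $+A\delta_{t_1}+B\delta_{t_2}$) are $$h_n^{A,B}=h_n+\frac{A\,p_n(t_1)^2\{1+BK_{n-1}(t_2,t_2)\}+B\,p_n(t_2)^2\{1+AK_{n-1}(t_1,t_1)\}-2AB\,p_n(t_1)p_n(t_2)K_{n-1}(t_1,t_2)}{\kappa_{n-1}(t_1,t_2)},$$ and the recurrence coefficients are $$b_n^{A,B}=b_n-A\Big(\frac{p_n^{A,B}(t_1)p_{n-1}(t_1)}{h_{n-1}}-\frac{p_{n+1}^{A,B}(t_1)p_n(t_1)}{h_n}\Big)-B\Big(\frac{p_n^{A,B}(t_2)p_{n-1}(t_2)}{h_{n-1}}-\frac{p_{n+1}^{A,B}(t_2)p_n(t_2)}{h_n}\Big),$$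 $$g_n^{A,B}=g_n\frac{1+\Delta_n}{1+\Delta_{n-1}},\qquad \Delta_n=\frac{A\,p_n^{A,B}(t_1)p_n(t_1)+B\,p_n^{A,B}(t_2)p_n(t_2)}{h_n}.$$ In the $q$-Racah case these are denoted $u_n^{\alpha,\beta,A,B}(s)_q$, $(d_n^{A,B})^2$, $\beta_n^{A,B},\gamma_n^{A,B}$; in the big $q$-Jacobi case $P_n^{A,B}(z)$, $(\widetilde d_n^{A,B})^2$, $\widetilde\beta_n^{A,B},\widetilde\gamma_n^{A,B}$. In the claim, $\kappa_m(\widetilde cq,\widetilde aq)$ refers to the big $q$-Jacobi case. Conventions: common factors in the recurrence coefficients are cancelled before evaluation; terms containing $[n]_q$ or $1-q^n$, and terms involving index $-1$, vanish for $n=0$. Since $\widetilde c<0$, $a$ is non-real, and the $q$-Racah relations are understood as algebraic identities in the parameters. *)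

theory Defs
  imports "HOL-Analysis.Analysis"
begin

text \<open>
  Everything is complex valued; the base \<open>q\<close> is a complex argument that is meant to be a
  positive real, so that \<open>q powr z = exp (z * ln q)\<close> with the real logarithm.
\<close>

section \<open>Basic hypergeometric notation\<close>

definition qpoch :: "complex \<Rightarrow> complex \<Rightarrow> nat \<Rightarrow> complex" where
  "qpoch x q k = (\<Prod>i<k. 1 - x * q ^ i)"

definition qpochs :: "complex list \<Rightarrow> complex \<Rightarrow> nat \<Rightarrow> complex" where
  "qpochs xs q k = (\<Prod>x\<leftarrow>xs. qpoch x q k)"

definition qpoch_inf :: "complex \<Rightarrow> complex \<Rightarrow> complex" where
  "qpoch_inf x q = prodinf (\<lambda>i. 1 - x * q ^ i)"

definition qpochs_inf :: "complex list \<Rightarrow> complex \<Rightarrow> complex" where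
  "qpochs_inf xs q = (\<Prod>x\<leftarrow>xs. qpoch_inf x q)"

text \<open>
  The series with \<open>r\<close> upper and \<open>r - 1\<close> lower parameters. It is only used with an upper
  parameter \<open>q\<^sup>-\<^sup>n\<close>, so all terms with index above \<open>n\<close> vanish; this includes terms whose
  denominator vanishes too, because \<open>0 / 0 = 0\<close>.
\<close>
definition basic_hyp :: "complex list \<Rightarrow> complex list \<Rightarrow> complex \<Rightarrow> complex \<Rightarrow> complex" where
  "basic_hyp xs ys q z = (\<Sum>k. qpochs xs q k / (qpoch q q k * qpochs ys q k) * z ^ k)"

definition kappa_q :: "complex \<Rightarrow> complex" where
  "kappa_q q = q powr (1/2) - q powr (-1/2)"

definition qnum :: "complex \<Rightarrow> complex \<Rightarrow> complex" where
  "qnum q s = (q powr (s/2) - q powr (-s/2)) / (q powr (1/2) - q powr (-1/2))"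

definition qGamma_tilde :: "complex \<Rightarrow> complex \<Rightarrow> complex" where
  "qGamma_tilde q s =
     q powr (- ((s - 1) * (s - 2) / 4)) * (1 - q) powr (1 - s) *
     (qpoch_inf q q / qpoch_inf (q powr s) q)"

definition mu :: "complex \<Rightarrow> complex \<Rightarrow> complex" where
  "mu q s = qnum q s * qnum q (s + 1)"

definition c1 :: "complex \<Rightarrow> complex" where
  "c1 q = q powr (1/2) / kappa_q q ^ 2"

definition c3 :: "complex \<Rightarrow> complex" where
  "c3 q = - (q powr (-1/2) * (1 + q) / kappa_q q ^ 2)"

section \<open>Non-standard q-Racah polynomials\<close>

definition qRacah :: "complex \<Rightarrow> complex \<Rightarrow> complex \<Rightarrow> complex \<Rightarrow> complex \<Rightarrow> nat \<Rightarrow> complex \<Rightarrow> complex" where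
  "qRacah q \<alpha> \<beta> a b n s =
     q powr (- (of_nat n / 2) * (2 * a + 1)) *
     (qpochs [q powr (a - b + 1), q powr (\<beta> + 1), q powr (a + b + \<alpha> + 1)] q n /
      (kappa_q q ^ (2 * n) * qpoch (q powr (\<alpha> + \<beta> + of_nat n + 1)) q n)) *
     basic_hyp
       [q powr (- of_nat n), q powr (\<alpha> + \<beta> + of_nat n + 1), q powr (a - s), q powr (a + s + 1)]
       [q powr (a - b + 1), q powr (\<beta> + 1), q powr (a + b + \<alpha> + 1)] q q"

definition qRacah_norm2 :: "complex \<Rightarrow> complex \<Rightarrow> complex \<Rightarrow> complex \<Rightarrow> complex \<Rightarrow> nat \<Rightarrow> complex" where
  "qRacah_norm2 q \<alpha> \<beta> a b n =
     qpochs [q, q powr (\<alpha> + 1), q powr (\<beta> + 1), q powr (b - a + \<alpha> + \<beta> + 1),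
             q powr (a + b + \<alpha> + 1), q powr (a - b + 1), q powr (\<beta> - a - b + 1)] q n /
     (kappa_q q ^ (4 * n) * qpoch (q powr (\<alpha> + \<beta> + 2)) q (2 * n) *
      qpoch (q powr (\<alpha> + \<beta> + of_nat n + 1)) q n)"

definition qRacah_weight :: "complex \<Rightarrow> complex \<Rightarrow> complex \<Rightarrow> complex \<Rightarrow> complex \<Rightarrow> complex \<Rightarrow> complex" where
  "qRacah_weight q \<alpha> \<beta> a b s =
     (let G = qGamma_tilde q in
      (G (s + a + 1) * G (s - a + \<beta> + 1) * G (s + \<alpha> + b + 1) * G (b + \<alpha> - s) *
       G (\<alpha> + \<beta> + 2) * G (b - a) * G (a + b - \<beta>)) /
      (G (s - a + 1) * G (s + b + 1) * G (s + a - \<beta> + 1) * G (b - s) *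
       G (\<alpha> + 1) * G (\<beta> + 1) * G (b - a + \<alpha> + \<beta> + 1) * G (a + b + \<alpha> + 1)))"

text \<open>
  In the recurrence coefficients the factor \<open>[\<alpha> + \<beta> + 1]\<close>, which may be zero, occurs in
  numerator and denominator for \<open>n = 0\<close> (first fraction of \<open>\<beta>\<^sub>n\<close>) and for \<open>n = 1\<close> (\<open>\<gamma>\<^sub>n\<close>).
  It is cancelled there, which is the purpose of the conditionals. The terms
  containing \<open>[n]\<close> are zero for \<open>n = 0\<close> whatever their denominator is.
\<close>
definition qRacah_beta :: "complex \<Rightarrow> complex \<Rightarrow> complex \<Rightarrow> complex \<Rightarrow> complex \<Rightarrow> nat \<Rightarrow> complex" where
  "qRacah_beta q \<alpha> \<beta> a b n =
     (let br = qnum q; k = of_nat n in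
      br a * br (a + 1)
      - (if n = 0 then 1 else br (\<alpha> + \<beta> + k + 1) / br (\<alpha> + \<beta> + 2 * k + 1)) *
        (br (a - b + k + 1) * br (\<beta> + k + 1) * br (a + b + \<alpha> + k + 1) /
         br (\<alpha> + \<beta> + 2 * k + 2))
      - br (\<alpha> + k) * br (b - a + \<alpha> + \<beta> + k) * br (- a - b + \<beta> + k) * br k /
        (br (\<alpha> + \<beta> + 2 * k) * br (\<alpha> + \<beta> + 2 * k + 1)))"

definition qRacah_gamma :: "complex \<Rightarrow> complex \<Rightarrow> complex \<Rightarrow> complex \<Rightarrow> complex \<Rightarrow> nat \<Rightarrow> complex" where
  "qRacah_gamma q \<alpha> \<beta> a b n =
     (let br = qnum q; k = of_nat n in
      (if n = 1 then 1 else br (\<alpha> + \<beta> + k) / br (\<alpha> + \<beta> + 2 * k - 1)) *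
      (br k * br (\<alpha> + k) * br (\<beta> + k) * br (b - a + \<alpha> + \<beta> + k) * br (- a - b + \<beta> + k) *
       br (a - b + k) * br (a + b + \<alpha> + k) /
       (br (\<alpha> + \<beta> + 2 * k) ^ 2 * br (\<alpha> + \<beta> + 2 * k + 1))))"

section \<open>Big q-Jacobi polynomials\<close>

text \<open>
  \<open>ta, tb, tc\<close> stand for the parameters a, b, c with a tilde. For
  \<open>z = 0\<close> the formula below is not meaningful (division by zero).
\<close>
definition bigqJ :: "complex \<Rightarrow> complex \<Rightarrow> complex \<Rightarrow> complex \<Rightarrow> nat \<Rightarrow> complex \<Rightarrow> complex" where
  "bigqJ q ta tb tc n z =
     (- ta) ^ n * q powr (of_nat (n * (n + 1)) / 2) *
     (qpochs [q * tb, q * tc] q n / qpoch (ta * tb * q ^ (n + 1)) q n) *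
     basic_hyp [q powr (- of_nat n), ta * tb * q ^ (n + 1), q * tc / z] [q * tb, q * tc] q (z / ta)"

definition bigqJ_weight :: "complex \<Rightarrow> complex \<Rightarrow> complex \<Rightarrow> complex \<Rightarrow> complex \<Rightarrow> complex" where
  "bigqJ_weight q ta tb tc z =
     qpochs_inf [z / ta, z / tc] q / qpochs_inf [z, tb / tc * z] q *
     (qpochs_inf [ta * q, tb * q, tc * q, ta * tb / tc * q] q /
      (ta * q * (1 - q) * qpochs_inf [q, ta * tb * q\<^sup>2, tc / ta, ta / tc * q] q))"

text \<open>
  The factor \<open>1 - ta * tb * q\<close>, which may be zero, is cancelled: for \<open>n = 0\<close> against
  \<open>1 - ta * tb * q ^ (2 * n + 1)\<close>, for \<open>n > 0\<close> against the first factor of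
  \<open>qpoch (ta * tb * q) q n = (1 - ta * tb * q) * qpoch (ta * tb * q\<^sup>2) q (n - 1)\<close>.
\<close>
definition bigqJ_norm2 :: "complex \<Rightarrow> complex \<Rightarrow> complex \<Rightarrow> complex \<Rightarrow> nat \<Rightarrow> complex" where
  "bigqJ_norm2 q ta tb tc n =
     (if n = 0 then 1
      else 1 / ((1 - ta * tb * q ^ (2 * n + 1)) * qpoch (ta * tb * q\<^sup>2) q (n - 1))) *
     (qpochs [q, tb * q, ta * q, tc * q, ta * tb / tc * q] q n /
      (qpoch (ta * tb * q ^ (n + 1)) q n) ^ 2) *
     (- ta * tc * q\<^sup>2) ^ n * q ^ (n choose 2)"

text \<open>Cancellation as for the q-Racah coefficients.\<close>
definition bigqJ_beta :: "complex \<Rightarrow> complex \<Rightarrow> complex \<Rightarrow> complex \<Rightarrow> nat \<Rightarrow> complex" where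
  "bigqJ_beta q ta tb tc n =
     1 - (if n = 0 then 1 else (1 - ta * tb * q ^ (n + 1)) / (1 - ta * tb * q ^ (2 * n + 1))) *
         ((1 - ta * q ^ (n + 1)) * (1 - tc * q ^ (n + 1)) / (1 - ta * tb * q ^ (2 * n + 2)))
     + ta * tc * q ^ (n + 1) *
         ((1 - q ^ n) * (1 - ta * tb / tc * q ^ n) * (1 - tb * q ^ n) /
          ((1 - ta * tb * q ^ (2 * n)) * (1 - ta * tb * q ^ (2 * n + 1))))"

definition bigqJ_gamma :: "complex \<Rightarrow> complex \<Rightarrow> complex \<Rightarrow> complex \<Rightarrow> nat \<Rightarrow> complex" where
  "bigqJ_gamma q ta tb tc n =
     - ta * tc * q ^ (n + 1) *
     (if n = 1 then 1 else (1 - ta * tb * q ^ n) / (1 - ta * tb * q ^ (2 * n - 1))) *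
     ((1 - q ^ n) * (1 - ta * q ^ n) * (1 - tb * q ^ n) * (1 - tc * q ^ n) *
      (1 - ta * tb / tc * q ^ n) /
      ((1 - ta * tb * q ^ (2 * n)) ^ 2 * (1 - ta * tb * q ^ (2 * n + 1))))"

section \<open>Krall-type modification\<close>

text \<open>
  \<open>p\<close> is the monic family, \<open>h\<close> its squared norms, \<open>b\<close> and \<open>g\<close> its recurrence
  coefficients, \<open>t1\<close> and \<open>t2\<close> the mass points, \<open>A\<close> and \<open>B\<close> the masses. The kernel has an
  integer index so that the index \<open>-1\<close> (empty sum) is available.
\<close>
definition kernel ::
  "(nat \<Rightarrow> complex \<Rightarrow> complex) \<Rightarrow> (nat \<Rightarrow> complex) \<Rightarrow> int \<Rightarrow> complex \<Rightarrow> complex \<Rightarrow> complex" where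
  "kernel p h m x y = (\<Sum>k | int k \<le> m. p k x * p k y / h k)"

definition krall_kappa ::
  "(nat \<Rightarrow> complex \<Rightarrow> complex) \<Rightarrow> (nat \<Rightarrow> complex) \<Rightarrow> complex \<Rightarrow> complex \<Rightarrow>
   int \<Rightarrow> complex \<Rightarrow> complex \<Rightarrow> complex" where
  "krall_kappa p h A B m x y =
     (let K = kernel p h m in
      1 + A * K x x + B * K y y + A * B * (K x x * K y y - (K x y)\<^sup>2))"

definition krall_val1 ::
  "(nat \<Rightarrow> complex \<Rightarrow> complex) \<Rightarrow> (nat \<Rightarrow> complex) \<Rightarrow> complex \<Rightarrow> complex \<Rightarrow>
   complex \<Rightarrow> complex \<Rightarrow> nat \<Rightarrow> complex" where
  "krall_val1 p h t1 t2 A B n =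
     (let K = kernel p h (int n - 1) in
      ((1 + B * K t2 t2) * p n t1 - B * K t1 t2 * p n t2) /
      krall_kappa p h A B (int n - 1) t1 t2)"

definition krall_val2 ::
  "(nat \<Rightarrow> complex \<Rightarrow> complex) \<Rightarrow> (nat \<Rightarrow> complex) \<Rightarrow> complex \<Rightarrow> complex \<Rightarrow>
   complex \<Rightarrow> complex \<Rightarrow> nat \<Rightarrow> complex" where
  "krall_val2 p h t1 t2 A B n =
     (let K = kernel p h (int n - 1) in
      (- A * K t2 t1 * p n t1 + (1 + A * K t1 t1) * p n t2) /
      krall_kappa p h A B (int n - 1) t1 t2)"

definition krall_poly ::
  "(nat \<Rightarrow> complex \<Rightarrow> complex) \<Rightarrow> (nat \<Rightarrow> complex) \<Rightarrow> complex \<Rightarrow> complex \<Rightarrow>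
   complex \<Rightarrow> complex \<Rightarrow> nat \<Rightarrow> complex \<Rightarrow> complex" where
  "krall_poly p h t1 t2 A B n x =
     p n x - A * krall_val1 p h t1 t2 A B n * kernel p h (int n - 1) x t1
           - B * krall_val2 p h t1 t2 A B n * kernel p h (int n - 1) x t2"

definition krall_norm2 ::
  "(nat \<Rightarrow> complex \<Rightarrow> complex) \<Rightarrow> (nat \<Rightarrow> complex) \<Rightarrow> complex \<Rightarrow> complex \<Rightarrow>
   complex \<Rightarrow> complex \<Rightarrow> nat \<Rightarrow> complex" where
  "krall_norm2 p h t1 t2 A B n =
     (let K = kernel p h (int n - 1) in
      h n + (A * (p n t1)\<^sup>2 * (1 + B * K t2 t2) + B * (p n t2)\<^sup>2 * (1 + A * K t1 t1)
             - 2 * A * B * p n t1 * p n t2 * K t1 t2) /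
            krall_kappa p h A B (int n - 1) t1 t2)"

definition krall_beta ::
  "(nat \<Rightarrow> complex \<Rightarrow> complex) \<Rightarrow> (nat \<Rightarrow> complex) \<Rightarrow> (nat \<Rightarrow> complex) \<Rightarrow>
   complex \<Rightarrow> complex \<Rightarrow> complex \<Rightarrow> complex \<Rightarrow> nat \<Rightarrow> complex" where
  "krall_beta p h b t1 t2 A B n =
     (let v1 = krall_val1 p h t1 t2 A B; v2 = krall_val2 p h t1 t2 A B in
      b n
      - A * ((if n = 0 then 0 else v1 n * p (n - 1) t1 / h (n - 1)) - v1 (n + 1) * p n t1 / h n)
      - B * ((if n = 0 then 0 else v2 n * p (n - 1) t2 / h (n - 1)) - v2 (n + 1) * p n t2 / h n))"

definition krall_Delta ::
  "(nat \<Rightarrow> complex \<Rightarrow> complex) \<Rightarrow> (nat \<Rightarrow> complex) \<Rightarrow> complex \<Rightarrow> complex \<Rightarrow>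
   complex \<Rightarrow> complex \<Rightarrow> nat \<Rightarrow> complex" where
  "krall_Delta p h t1 t2 A B n =
     (A * krall_val1 p h t1 t2 A B n * p n t1 + B * krall_val2 p h t1 t2 A B n * p n t2) / h n"

definition krall_gamma ::
  "(nat \<Rightarrow> complex \<Rightarrow> complex) \<Rightarrow> (nat \<Rightarrow> complex) \<Rightarrow> (nat \<Rightarrow> complex) \<Rightarrow>
   complex \<Rightarrow> complex \<Rightarrow> complex \<Rightarrow> complex \<Rightarrow> nat \<Rightarrow> complex" where
  "krall_gamma p h g t1 t2 A B n =
     (if n = 0 then 0
      else g n * ((1 + krall_Delta p h t1 t2 A B n) / (1 + krall_Delta p h t1 t2 A B (n - 1))))"

text \<open>The two instances.\<close>

definition qRacahK ::
  "complex \<Rightarrow> complex \<Rightarrow> complex \<Rightarrow> complex \<Rightarrow> complex \<Rightarrow> complex \<Rightarrow> complex \<Rightarrow> nat \<Rightarrow> complex \<Rightarrow> complex" where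
  "qRacahK q \<alpha> \<beta> a b A B =
     krall_poly (qRacah q \<alpha> \<beta> a b) (qRacah_norm2 q \<alpha> \<beta> a b) a (b - 1) A B"

definition qRacahK_norm2 ::
  "complex \<Rightarrow> complex \<Rightarrow> complex \<Rightarrow> complex \<Rightarrow> complex \<Rightarrow> complex \<Rightarrow> complex \<Rightarrow> nat \<Rightarrow> complex" where
  "qRacahK_norm2 q \<alpha> \<beta> a b A B =
     krall_norm2 (qRacah q \<alpha> \<beta> a b) (qRacah_norm2 q \<alpha> \<beta> a b) a (b - 1) A B"

definition qRacahK_beta ::
  "complex \<Rightarrow> complex \<Rightarrow> complex \<Rightarrow> complex \<Rightarrow> complex \<Rightarrow> complex \<Rightarrow> complex \<Rightarrow> nat \<Rightarrow> complex" where
  "qRacahK_beta q \<alpha> \<beta> a b A B =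
     krall_beta (qRacah q \<alpha> \<beta> a b) (qRacah_norm2 q \<alpha> \<beta> a b) (qRacah_beta q \<alpha> \<beta> a b) a (b - 1) A B"

definition qRacahK_gamma ::
  "complex \<Rightarrow> complex \<Rightarrow> complex \<Rightarrow> complex \<Rightarrow> complex \<Rightarrow> complex \<Rightarrow> complex \<Rightarrow> nat \<Rightarrow> complex" where
  "qRacahK_gamma q \<alpha> \<beta> a b A B =
     krall_gamma (qRacah q \<alpha> \<beta> a b) (qRacah_norm2 q \<alpha> \<beta> a b) (qRacah_gamma q \<alpha> \<beta> a b) a (b - 1) A B"

definition bigqJK_kappa ::
  "complex \<Rightarrow> complex \<Rightarrow> complex \<Rightarrow> complex \<Rightarrow> complex \<Rightarrow> complex \<Rightarrow> int \<Rightarrow> complex" where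
  "bigqJK_kappa q ta tb tc A B m =
     krall_kappa (bigqJ q ta tb tc) (bigqJ_norm2 q ta tb tc) A B m (tc * q) (ta * q)"

definition bigqJK ::
  "complex \<Rightarrow> complex \<Rightarrow> complex \<Rightarrow> complex \<Rightarrow> complex \<Rightarrow> complex \<Rightarrow> nat \<Rightarrow> complex \<Rightarrow> complex" where
  "bigqJK q ta tb tc A B =
     krall_poly (bigqJ q ta tb tc) (bigqJ_norm2 q ta tb tc) (tc * q) (ta * q) A B"

definition bigqJK_norm2 ::
  "complex \<Rightarrow> complex \<Rightarrow> complex \<Rightarrow> complex \<Rightarrow> complex \<Rightarrow> complex \<Rightarrow> nat \<Rightarrow> complex" where
  "bigqJK_norm2 q ta tb tc A B =
     krall_norm2 (bigqJ q ta tb tc) (bigqJ_norm2 q ta tb tc) (tc * q) (ta * q) A B"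

definition bigqJK_beta ::
  "complex \<Rightarrow> complex \<Rightarrow> complex \<Rightarrow> complex \<Rightarrow> complex \<Rightarrow> complex \<Rightarrow> nat \<Rightarrow> complex" where
  "bigqJK_beta q ta tb tc A B =
     krall_beta (bigqJ q ta tb tc) (bigqJ_norm2 q ta tb tc) (bigqJ_beta q ta tb tc)
       (tc * q) (ta * q) A B"

definition bigqJK_gamma ::
  "complex \<Rightarrow> complex \<Rightarrow> complex \<Rightarrow> complex \<Rightarrow> complex \<Rightarrow> complex \<Rightarrow> nat \<Rightarrow> complex" where
  "bigqJK_gamma q ta tb tc A B =
     krall_gamma (bigqJ q ta tb tc) (bigqJ_norm2 q ta tb tc) (bigqJ_gamma q ta tb tc)
       (tc * q) (ta * q) A B"

section \<open>Orthogonality and recurrence relations\<close>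

definition qRacahK_sum ::
  "complex \<Rightarrow> complex \<Rightarrow> complex \<Rightarrow> complex \<Rightarrow> complex \<Rightarrow> complex \<Rightarrow> complex \<Rightarrow> nat \<Rightarrow> nat \<Rightarrow> nat \<Rightarrow> complex" where
  "qRacahK_sum q \<alpha> \<beta> a b A B N n m =
     (\<Sum>s = 0..N. qRacahK q \<alpha> \<beta> a b A B n (of_nat s + a) * qRacahK q \<alpha> \<beta> a b A B m (of_nat s + a) *
        qRacah_weight q \<alpha> \<beta> a b (of_nat s + a) * qnum q (2 * of_nat s + 2 * a + 1))"

definition qRacahK_orthogonality ::
  "complex \<Rightarrow> complex \<Rightarrow> complex \<Rightarrow> complex \<Rightarrow> complex \<Rightarrow> complex \<Rightarrow> complex \<Rightarrow> nat \<Rightarrow> nat \<Rightarrow> nat \<Rightarrow> bool" where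
  "qRacahK_orthogonality q \<alpha> \<beta> a b A B N n m \<longleftrightarrow>
     (let u = qRacahK q \<alpha> \<beta> a b A B in
      qRacahK_sum q \<alpha> \<beta> a b A B N n m + A * u n a * u m a + B * u n (b - 1) * u m (b - 1) =
      (if n = m then qRacahK_norm2 q \<alpha> \<beta> a b A B n else 0))"

text \<open>Summand of the series over the points \<open>x * q ^ (s + 1)\<close>, where \<open>x\<close> is \<open>ta\<close> or \<open>tc\<close>.\<close>
definition bigqJK_summand ::
  "complex \<Rightarrow> complex \<Rightarrow> complex \<Rightarrow> complex \<Rightarrow> complex \<Rightarrow> complex \<Rightarrow> complex \<Rightarrow> nat \<Rightarrow> nat \<Rightarrow> nat \<Rightarrow> complex" where
  "bigqJK_summand q ta tb tc A B x n m s =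
     bigqJK q ta tb tc A B n (x * q ^ (s + 1)) * bigqJK q ta tb tc A B m (x * q ^ (s + 1)) *
     bigqJ_weight q ta tb tc (x * q ^ (s + 1)) * q ^ (s + 1)"

definition bigqJK_sum ::
  "complex \<Rightarrow> complex \<Rightarrow> complex \<Rightarrow> complex \<Rightarrow> complex \<Rightarrow> complex \<Rightarrow> nat \<Rightarrow> nat \<Rightarrow> complex" where
  "bigqJK_sum q ta tb tc A B n m =
     (1 - q) * (- tc) * (\<Sum>s. bigqJK_summand q ta tb tc A B tc n m s) +
     (1 - q) * ta * (\<Sum>s. bigqJK_summand q ta tb tc A B ta n m s)"

definition bigqJK_orthogonality ::
  "complex \<Rightarrow> complex \<Rightarrow> complex \<Rightarrow> complex \<Rightarrow> complex \<Rightarrow> complex \<Rightarrow> nat \<Rightarrow> nat \<Rightarrow> bool" where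
  "bigqJK_orthogonality q ta tb tc A B n m \<longleftrightarrow>
     (let P = bigqJK q ta tb tc A B in
      bigqJK_sum q ta tb tc A B n m + A * P n (tc * q) * P m (tc * q)
        + B * P n (ta * q) * P m (ta * q) =
      (if n = m then bigqJK_norm2 q ta tb tc A B n else 0))"

text \<open>For \<open>n = 0\<close> the last term of the recurrences vanishes, since \<open>krall_gamma\<close> is then zero.\<close>
definition qRacahK_recurrence ::
  "complex \<Rightarrow> complex \<Rightarrow> complex \<Rightarrow> complex \<Rightarrow> complex \<Rightarrow> complex \<Rightarrow> complex \<Rightarrow> nat \<Rightarrow> complex \<Rightarrow> bool" where
  "qRacahK_recurrence q \<alpha> \<beta> a b A B n s \<longleftrightarrow>
     (let u = qRacahK q \<alpha> \<beta> a b A B in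
      mu q s * u n s = u (n + 1) s + qRacahK_beta q \<alpha> \<beta> a b A B n * u n s
                       + qRacahK_gamma q \<alpha> \<beta> a b A B n * u (n - 1) s)"

definition bigqJK_recurrence ::
  "complex \<Rightarrow> complex \<Rightarrow> complex \<Rightarrow> complex \<Rightarrow> complex \<Rightarrow> complex \<Rightarrow> nat \<Rightarrow> complex \<Rightarrow> bool" where
  "bigqJK_recurrence q ta tb tc A B n z \<longleftrightarrow>
     (let P = bigqJK q ta tb tc A B in
      z * P n z = P (n + 1) z + bigqJK_beta q ta tb tc A B n * P n z
                  + bigqJK_gamma q ta tb tc A B n * P (n - 1) z)"

text \<open>The scaling factor; \<open>q powr ((a + b) / 2)\<close> is the chosen square root of \<open>tc / ta\<close>.\<close>
definition scaleC :: "complex \<Rightarrow> complex \<Rightarrow> complex \<Rightarrow> complex \<Rightarrow> nat \<Rightarrow> nat \<Rightarrow> complex" where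
  "scaleC q ta a b N n =
     (q ^ N) powr (of_nat n / 2) * (q * ta) ^ n * (q powr ((a + b) / 2)) ^ n * kappa_q q ^ (2 * n)"

end

theory Submission
  imports Defs
begin

text \<open>
  Put \<open>r = tc / ta\<close>. With \<open>\<epsilon> = q\<^sup>N\<close> and \<open>v = q\<^sup>N (q powr (a - s) + q powr (a + s + 1))\<close> the scaled
  \<open>q\<close>-Racah polynomial is a polynomial in \<open>(\<epsilon>, v)\<close> whose coefficients do not depend on \<open>N\<close>, and its value
  at \<open>\<epsilon> = 0\<close>, \<open>v = z / (q ta)\<close> is the big \<open>q\<close>-Jacobi polynomial at \<open>z\<close>. This gives the limits at
  the grid points, and also the bounds, uniform on the grid, that dominated convergence requires.
  The squared norms and the recurrence coefficients are likewise functions of \<open>\<epsilon>\<close> alone after scaling. The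
  Krall-type quantities are rational functions of the unmodified ones and equivariant under
  rescaling \<open>p\<^sub>n\<close> by \<open>C\<^sub>n\<close>; the scaling factor of the recurrence is exactly \<open>C\<^sub>n\<^sub>+\<^sub>1 / C\<^sub>n\<close>.
\<close>

section \<open>Krall-type modifications\<close>

text \<open>Single factors of the \<open>q\<close>-Racah side diverge with \<open>N\<close>:
  \<open>(q^-N; q)_j\<close> does, and so does \<open>q^a\<close>, because
  \<open>q^(2a+1) = r / q^N\<close>. Only their combination stays bounded, so no limit can be taken
  factor by factor. This forces exact identities at finite \<open>N\<close>, in which powers of
  \<open>q^N\<close> are distributed over the divergent factors; \<open>a\<close> and
  \<open>s\<close> survive only in \<open>v\<close>, a sum of two powers whose product
  \<open>q^(2a+1)\<close> is known. Half-integer powers are exponentials whose exponents are added,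
  so no root has to be chosen besides \<open>q powr ((a + b) / 2)\<close>. The nonvanishing of kappa
  is known for the limit family only. That suffices: a limit of quotients needs a nonzero limit of
  the denominators, and the one other Krall-type denominator, \<open>1 + krall_Delta\<close>, is a
  quotient of two kappas. The finite orthogonality sum keeps non-negligible terms near both ends of
  its range, so one dominating sequence in \<open>s\<close> cannot do; it is split in two. The two
  relations of the limit family are deduced from the finite ones, which are supposed to hold for
  almost all \<open>N\<close>.\<close>

lemma kernel_altdef:
  "kernel p h m x y = (\<Sum>k<nat (m + 1). p k x * p k y / h k)"
proof -
  have "{k. int k \<le> m} = {..<nat (m + 1)}" by auto
  then show ?thesis by (simp add: kernel_def)
qed

text \<open>The squared norm absorbs both factors \<open>c k\<close>, so the kernels, and with them
  kappa, do not see the rescaling.\<close>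

lemma kernel_scaled:
  assumes "\<And>k. c k \<noteq> 0"
  shows "kernel (\<lambda>k x. c k * p k x) (\<lambda>k. (c k)\<^sup>2 * h k) = kernel p h"
  by (intro ext) (simp add: kernel_def power2_eq_square assms)

lemma krall_kappa_scaled:
  assumes "\<And>k. c k \<noteq> 0"
  shows "krall_kappa (\<lambda>k x. c k * p k x) (\<lambda>k. (c k)\<^sup>2 * h k) = krall_kappa p h"
  by (intro ext) (simp add: krall_kappa_def kernel_scaled assms)

lemma krall_val_scaled:
  assumes "\<And>k. c k \<noteq> 0"
  shows "krall_val1 (\<lambda>k x. c k * p k x) (\<lambda>k. (c k)\<^sup>2 * h k) t1 t2 A B n = c n * krall_val1 p h t1 t2 A B n"
    and "krall_val2 (\<lambda>k x. c k * p k x) (\<lambda>k. (c k)\<^sup>2 * h k) t1 t2 A B n = c n * krall_val2 p h t1 t2 A B n"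
  unfolding krall_val1_def krall_val2_def kernel_scaled[OF assms] krall_kappa_scaled[OF assms] Let_def
  by (simp_all only: times_divide_eq_right) (simp_all add: algebra_simps)

lemma krall_poly_scaled:
  assumes "\<And>k. c k \<noteq> 0"
  shows "krall_poly (\<lambda>k x. c k * p k x) (\<lambda>k. (c k)\<^sup>2 * h k) t1 t2 A B n x =
    c n * krall_poly p h t1 t2 A B n x"
  unfolding krall_poly_def kernel_scaled[OF assms] krall_val_scaled[OF assms]
  by (simp add: algebra_simps)

lemma krall_norm2_scaled:
  assumes "\<And>k. c k \<noteq> 0"
  shows "krall_norm2 (\<lambda>k x. c k * p k x) (\<lambda>k. (c k)\<^sup>2 * h k) t1 t2 A B n =
    (c n)\<^sup>2 * krall_norm2 p h t1 t2 A B n"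
proof -
  have *: "c2 * X / k = c2 * (X / k)" for c2 X k :: complex by simp
  show ?thesis
    unfolding krall_norm2_def kernel_scaled[OF assms] krall_kappa_scaled[OF assms] Let_def distrib_left
      *[symmetric]
    by (simp add: algebra_simps power2_eq_square)
qed

lemma krall_Delta_scaled:
  assumes "\<And>k. c k \<noteq> 0"
  shows "krall_Delta (\<lambda>k x. c k * p k x) (\<lambda>k. (c k)\<^sup>2 * h k) = krall_Delta p h"
proof (intro ext)
  fix t1 t2 A B n
  have *: "A * (c n * X) * (c n * X') + B * (c n * Y) * (c n * Y') = (c n)\<^sup>2 * (A * X * X' + B * Y * Y')"
    for X X' Y Y' by (simp add: algebra_simps power2_eq_square)
  show "krall_Delta (\<lambda>k x. c k * p k x) (\<lambda>k. (c k)\<^sup>2 * h k) t1 t2 A B n = krall_Delta p h t1 t2 A B n"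
    unfolding krall_Delta_def krall_val_scaled[OF assms] * using assms by simp
qed

text \<open>In each correction term the Krall value has an index one above that of the polynomial
  and the norm, so the quotient \<open>c (k + 1) / c k\<close> remains. For it to come out as a
  common factor, \<open>c\<close> has to be geometric.\<close>

lemma krall_beta_scaled:
  assumes "\<And>k. c k \<noteq> 0" and "\<And>k. c (Suc k) = \<sigma> * c k"
  shows "krall_beta (\<lambda>k x. c k * p k x) (\<lambda>k. (c k)\<^sup>2 * h k) (\<lambda>k. \<sigma> * b k) t1 t2 A B n =
    \<sigma> * krall_beta p h b t1 t2 A B n"
proof -
  have step: "\<sigma> * c k * X * (c k * Y) / ((c k)\<^sup>2 * h k) = \<sigma> * (X * Y / h k)" for X Y k
    using assms by (simp add: power2_eq_square)
  have n1: "c n * X * (c (n - 1) * Y) / ((c (n - 1))\<^sup>2 * h (n - 1)) = \<sigma> * (X * Y / h (n - 1))"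
    if "n \<noteq> 0" for X Y
    using step[of "n - 1"] assms(2)[of "n - 1"] that by simp
  show ?thesis
    unfolding krall_beta_def krall_val_scaled[OF assms(1)] Let_def
    by (cases "n = 0") (simp_all only: n1 step Suc_eq_plus1[symmetric] assms(2) if_True if_False
         right_diff_distrib refl HOL.simp_thms mult.left_commute[of \<sigma>] mult_zero_right)
qed

lemma krall_gamma_scaled:
  assumes "\<And>k. c k \<noteq> 0"
  shows "krall_gamma (\<lambda>k x. c k * p k x) (\<lambda>k. (c k)\<^sup>2 * h k) (\<lambda>k. \<sigma> * g k) t1 t2 A B n =
    \<sigma> * krall_gamma p h g t1 t2 A B n"
  by (simp add: krall_gamma_def krall_Delta_scaled assms)

text \<open>Moves the constant \<open>c3\<close> into the unmodified coefficients, since it is their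
  shifted version that has a scaling limit.\<close>

lemma krall_beta_shift:
  "krall_beta p h b t1 t2 A B n - d = krall_beta p h (\<lambda>k. b k - d) t1 t2 A B n"
  by (simp add: krall_beta_def Let_def)

text \<open>Kappa is the determinant of the 2 by 2 matrix I + diag(A, B) K, with K the matrix of
  kernel values at the mass points. Raising the index adds a rank one matrix to K, so the
  determinant changes by a term linear in \<open>1 / h n\<close>; its numerator is
  \<open>V\<close>.\<close>

lemma krall_Delta_kappa:
  assumes "h n \<noteq> 0" and k: "krall_kappa p h A B (int n - 1) t1 t2 \<noteq> 0"
  shows "1 + krall_Delta p h t1 t2 A B n =
    krall_kappa p h A B (int n) t1 t2 / krall_kappa p h A B (int n - 1) t1 t2"
proof -
  define K where "K = kernel p h (int n - 1)"
  define \<kappa> where "\<kappa> = krall_kappa p h A B (int n - 1) t1 t2"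
  define V where "V = A * ((1 + B * K t2 t2) * p n t1 - B * K t1 t2 * p n t2) * p n t1 +
    B * (- A * K t1 t2 * p n t1 + (1 + A * K t1 t1) * p n t2) * p n t2"
  have sym: "K t2 t1 = K t1 t2" by (simp add: K_def kernel_def mult.commute)
  have K': "kernel p h (int n) x y = K x y + p n x * p n y / h n" for x y
    by (simp add: kernel_altdef K_def nat_add_distrib)
  have "krall_kappa p h A B (int n) t1 t2 = \<kappa> + V / h n"
    unfolding krall_kappa_def \<kappa>_def Let_def K' K_def[symmetric] V_def divide_inverse
    by (simp add: algebra_simps power2_eq_square)
  moreover have "krall_Delta p h t1 t2 A B n = V / \<kappa> / h n"
    unfolding krall_Delta_def krall_val1_def krall_val2_def Let_def K_def[symmetric] sym
      \<kappa>_def[symmetric] V_def divide_inverse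
    by (simp add: algebra_simps power2_eq_square)
  ultimately show ?thesis
    using assms by (simp add: \<kappa>_def[symmetric] add_divide_distrib mult.commute)
qed

section \<open>Limits and uniform bounds of the Krall-type quantities\<close>

context
  fixes p :: "nat \<Rightarrow> nat \<Rightarrow> complex \<Rightarrow> complex" and h :: "nat \<Rightarrow> nat \<Rightarrow> complex"
    and p' :: "nat \<Rightarrow> complex \<Rightarrow> complex" and h' :: "nat \<Rightarrow> complex"
  assumes h: "\<And>k. (\<lambda>N. h N k) \<longlonglongrightarrow> h' k" and h'0: "\<And>k. h' k \<noteq> 0"
begin

lemma tendsto_kernel:
  assumes "\<And>k. (\<lambda>N. p N k (x N)) \<longlonglongrightarrow> p' k x'" and "\<And>k. (\<lambda>N. p N k (y N)) \<longlonglongrightarrow> p' k y'"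
  shows "(\<lambda>N. kernel (p N) (h N) m (x N) (y N)) \<longlonglongrightarrow> kernel p' h' m x' y'"
  unfolding kernel_altdef by (intro tendsto_intros assms h h'0)

context
  fixes t1 t2 :: "nat \<Rightarrow> complex" and t1' t2' A B :: complex
  assumes t1: "\<And>k. (\<lambda>N. p N k (t1 N)) \<longlonglongrightarrow> p' k t1'"
    and t2: "\<And>k. (\<lambda>N. p N k (t2 N)) \<longlonglongrightarrow> p' k t2'"
    and kappa: "\<And>m::nat. krall_kappa p' h' A B (int m) t1' t2' \<noteq> 0"
begin

lemmas kernel_lims = tendsto_kernel[of t1 t1' t1 t1', OF t1 t1] tendsto_kernel[of t2 t2' t2 t2', OF t2 t2]
  tendsto_kernel[of t1 t1' t2 t2', OF t1 t2] tendsto_kernel[of t2 t2' t1 t1', OF t2 t1]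

lemma krall_kappa_nonzero: "krall_kappa p' h' A B (int n - 1) t1' t2' \<noteq> 0"
proof (cases n)
  case 0
  then show ?thesis by (simp add: krall_kappa_def kernel_altdef)
next
  case (Suc k)
  then show ?thesis using kappa[of k] by simp
qed

lemma tendsto_krall_kappa:
  "(\<lambda>N. krall_kappa (p N) (h N) A B m (t1 N) (t2 N)) \<longlonglongrightarrow> krall_kappa p' h' A B m t1' t2'"
  unfolding krall_kappa_def Let_def by (intro tendsto_intros kernel_lims)

lemma tendsto_krall_val:
  "(\<lambda>N. krall_val1 (p N) (h N) (t1 N) (t2 N) A B n) \<longlonglongrightarrow> krall_val1 p' h' t1' t2' A B n"
  "(\<lambda>N. krall_val2 (p N) (h N) (t1 N) (t2 N) A B n) \<longlonglongrightarrow> krall_val2 p' h' t1' t2' A B n"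
  unfolding krall_val1_def krall_val2_def Let_def
  by (intro tendsto_intros kernel_lims tendsto_krall_kappa krall_kappa_nonzero t1 t2)+

lemma tendsto_krall_poly:
  assumes "\<And>k. (\<lambda>N. p N k (x N)) \<longlonglongrightarrow> p' k x'"
  shows "(\<lambda>N. krall_poly (p N) (h N) (t1 N) (t2 N) A B n (x N)) \<longlonglongrightarrow> krall_poly p' h' t1' t2' A B n x'"
  unfolding krall_poly_def
  by (intro tendsto_intros tendsto_krall_val assms
        tendsto_kernel[of x x' t1 t1', OF assms t1] tendsto_kernel[of x x' t2 t2', OF assms t2])

lemma tendsto_krall_norm2:
  "(\<lambda>N. krall_norm2 (p N) (h N) (t1 N) (t2 N) A B n) \<longlonglongrightarrow> krall_norm2 p' h' t1' t2' A B n"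
  unfolding krall_norm2_def Let_def
  by (intro tendsto_intros kernel_lims tendsto_krall_kappa krall_kappa_nonzero t1 t2 h)

lemma tendsto_krall_beta:
  assumes "(\<lambda>N. b N n) \<longlonglongrightarrow> b' n"
  shows "(\<lambda>N. krall_beta (p N) (h N) (b N) (t1 N) (t2 N) A B n) \<longlonglongrightarrow> krall_beta p' h' b' t1' t2' A B n"
proof (cases "n = 0")
  case True
  show ?thesis unfolding krall_beta_def Let_def True simp_thms if_True
    by (intro tendsto_intros tendsto_krall_val t1 t2 h h'0 assms[unfolded True])
next
  case False
  then show ?thesis unfolding krall_beta_def Let_def
    by (simp only: if_False) (intro tendsto_intros tendsto_krall_val t1 t2 h h'0 assms)
qed

lemma tendsto_krall_Delta:
  "(\<lambda>N. krall_Delta (p N) (h N) (t1 N) (t2 N) A B n) \<longlonglongrightarrow> krall_Delta p' h' t1' t2' A B n"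
  unfolding krall_Delta_def by (intro tendsto_intros tendsto_krall_val t1 t2 h h'0)

lemma tendsto_krall_gamma:
  assumes "n \<noteq> 0 \<Longrightarrow> (\<lambda>N. g N n) \<longlonglongrightarrow> g' n"
  shows "(\<lambda>N. krall_gamma (p N) (h N) (g N) (t1 N) (t2 N) A B n) \<longlonglongrightarrow> krall_gamma p' h' g' t1' t2' A B n"
proof (cases "n = 0")
  case False
  \<comment> \<open>It is the quotient of the kappas with indices \<open>n - 1\<close> and
    \<open>n - 2\<close>; for \<open>n = 1\<close> the latter has index -1 and equals 1.\<close>
  have "1 + krall_Delta p' h' t1' t2' A B (n - 1) \<noteq> 0"
    using krall_kappa_nonzero kappa by (subst krall_Delta_kappa) (auto simp: h'0)
  then show ?thesis
    using False unfolding krall_gamma_def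
    by (simp only: if_False) (intro tendsto_intros tendsto_krall_Delta assms)
qed (simp add: krall_gamma_def)

text \<open>Meant for dominated convergence: pointwise limits give no control over a set
  \<open>X N\<close> that grows with \<open>N\<close>. In the kernels only the first argument ranges
  over \<open>X N\<close>; the second is a mass point, where the quotient of polynomial and norm
  converges and is therefore bounded.\<close>

lemma krall_poly_bounded:
  assumes "\<And>k. \<exists>M. \<forall>\<^sub>F N in sequentially. \<forall>x\<in>X N. norm (p N k x) \<le> M"
  shows "\<exists>M. \<forall>\<^sub>F N in sequentially. \<forall>x\<in>X N.
    norm (krall_poly (p N) (h N) (t1 N) (t2 N) A B n x) \<le> M"
proof -
  have "\<forall>k. \<exists>M. \<forall>\<^sub>F N in sequentially. \<forall>x\<in>X N. norm (p N k x) \<le> M" using assms by blast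
  from choice[OF this] obtain M
    where M: "\<And>k. \<forall>\<^sub>F N in sequentially. \<forall>x\<in>X N. norm (p N k x) \<le> M k" by auto
  have kern: "\<exists>L. \<forall>\<^sub>F N in sequentially. \<forall>x\<in>X N. norm (kernel (p N) (h N) m x (t N)) \<le> L"
    if t: "\<And>k. (\<lambda>N. p N k (t N)) \<longlonglongrightarrow> p' k t'" for t t' m
  proof -
    have "\<exists>L. \<forall>N. norm (p N k (t N) / h N k) \<le> L" for k
      using convergent_imp_Bseq[OF convergentI[OF tendsto_divide[OF t h h'0], of k]]
      unfolding Bseq_def by blast
    then have "\<forall>k. \<exists>L. \<forall>N. norm (p N k (t N) / h N k) \<le> L" by blast
    from choice[OF this] obtain L where L: "\<And>k N. norm (p N k (t N) / h N k) \<le> L k" by auto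
    have "\<forall>\<^sub>F N in sequentially. \<forall>k\<in>{..<nat (m + 1)}. \<forall>x\<in>X N. norm (p N k x) \<le> M k"
      by (intro eventually_ball_finite) (auto simp: M)
    then have "\<forall>\<^sub>F N in sequentially. \<forall>x\<in>X N.
      norm (kernel (p N) (h N) m x (t N)) \<le> (\<Sum>k<nat (m + 1). M k * L k)"
    proof eventually_elim
      case (elim N)
      show ?case
        unfolding kernel_altdef
      proof (intro ballI sum_norm_le)
        fix x k assume *: "x \<in> X N" "k \<in> {..<nat (m + 1)}"
        have "norm (p N k x * (p N k (t N) / h N k)) \<le> M k * L k"
          unfolding norm_mult using elim * order_trans[OF norm_ge_zero[of "p N k x"], of "M k"]
          by (intro mult_mono L norm_ge_zero) auto
        then show "norm (p N k x * p N k (t N) / h N k) \<le> M k * L k" by simp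
      qed
    qed
    then show ?thesis by blast
  qed
  obtain L1 where L1: "\<forall>\<^sub>F N in sequentially. \<forall>x\<in>X N. norm (kernel (p N) (h N) (int n - 1) x (t1 N)) \<le> L1"
    using kern[OF t1] by blast
  obtain L2 where L2: "\<forall>\<^sub>F N in sequentially. \<forall>x\<in>X N. norm (kernel (p N) (h N) (int n - 1) x (t2 N)) \<le> L2"
    using kern[OF t2] by blast
  obtain V1 where V1: "\<And>N. norm (krall_val1 (p N) (h N) (t1 N) (t2 N) A B n) \<le> V1"
    using convergent_imp_Bseq[OF convergentI[OF tendsto_krall_val(1), of n]]
      unfolding Bseq_def by blast
  obtain V2 where V2: "\<And>N. norm (krall_val2 (p N) (h N) (t1 N) (t2 N) A B n) \<le> V2"
    using convergent_imp_Bseq[OF convergentI[OF tendsto_krall_val(2), of n]]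
      unfolding Bseq_def by blast
  have "\<forall>\<^sub>F N in sequentially. \<forall>x\<in>X N.
    norm (krall_poly (p N) (h N) (t1 N) (t2 N) A B n x) \<le> M n + norm A * V1 * L1 + norm B * V2 * L2"
    using L1 L2 M[of n]
  proof eventually_elim
    case (elim N)
    show ?case
    proof
      fix x assume "x \<in> X N"
      have 1: "norm (A * krall_val1 (p N) (h N) (t1 N) (t2 N) A B n * kernel (p N) (h N) (int n - 1) x (t1 N))
        \<le> norm A * V1 * L1"
        unfolding norm_mult using elim(1) \<open>x \<in> X N\<close> V1[of N] order_trans[OF norm_ge_zero V1[of N]]
        by (intro mult_mono mult_nonneg_nonneg norm_ge_zero order_refl) auto
      have 2: "norm (B * krall_val2 (p N) (h N) (t1 N) (t2 N) A B n * kernel (p N) (h N) (int n - 1) x (t2 N))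
        \<le> norm B * V2 * L2"
        unfolding norm_mult using elim(2) \<open>x \<in> X N\<close> V2[of N] order_trans[OF norm_ge_zero V2[of N]]
        by (intro mult_mono mult_nonneg_nonneg norm_ge_zero order_refl) auto
      have 3: "norm (p N n x) \<le> M n" using elim(3) \<open>x \<in> X N\<close> by blast
      show "norm (krall_poly (p N) (h N) (t1 N) (t2 N) A B n x) \<le> M n + norm A * V1 * L1 + norm B * V2 * L2"
        unfolding krall_poly_def
        by (intro order_trans[OF norm_triangle_ineq4] add_mono 1 2 3)
    qed
  qed
  then show ?thesis by blast
qed

end

end

section \<open>Shifted factorials\<close>

lemma qpoch_add: "qpoch x q (m + n) = qpoch x q m * qpoch (x * q ^ m) q n"
  unfolding qpoch_def by (induction n) (simp_all add: power_add mult.assoc)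

lemma qpoch_Suc: "qpoch x q (Suc n) = qpoch x q n * (1 - x * q ^ n)"
  by (simp add: qpoch_def)

lemma qpoch_0 [simp]: "qpoch x q 0 = 1"
  by (simp add: qpoch_def)

lemma qpoch_zero: "qpoch 0 q n = 1"
  by (simp add: qpoch_def)

lemma qpoch_nonzero: "(\<And>i. i < n \<Longrightarrow> x * q ^ i \<noteq> 1) \<Longrightarrow> qpoch x q n \<noteq> 0"
  by (auto simp: qpoch_def)

context
  fixes q :: complex
  assumes q: "norm q < 1"
begin

lemma convergent_prod_qpoch: "convergent_prod (\<lambda>i. 1 - x * q ^ i)"
proof -
  have "summable (\<lambda>i. norm ((1 - x * q ^ i) - 1))"
    using q by (simp add: norm_mult norm_power summable_mult summable_geometric)
  then show ?thesis
    by (intro abs_convergent_prod_imp_convergent_prod summable_imp_abs_convergent_prod)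
qed

lemma qpoch_tendsto: "(\<lambda>n. qpoch x q n) \<longlonglongrightarrow> qpoch_inf x q"
  using convergent_prod_LIMSEQ[OF convergent_prod_qpoch]
  unfolding qpoch_def qpoch_inf_def LIMSEQ_lessThan_iff_atMost .

lemma qpoch_inf_split: "qpoch_inf x q = qpoch x q n * qpoch_inf (x * q ^ n) q"
proof (rule LIMSEQ_unique)
  show "(\<lambda>k. qpoch x q (n + k)) \<longlonglongrightarrow> qpoch_inf x q"
    using LIMSEQ_ignore_initial_segment[OF qpoch_tendsto, of x n] by (simp add: add.commute)
  show "(\<lambda>k. qpoch x q (n + k)) \<longlonglongrightarrow> qpoch x q n * qpoch_inf (x * q ^ n) q"
    unfolding qpoch_add by (intro tendsto_intros qpoch_tendsto)
qed

lemma qpoch_inf_nonzero: "(\<And>i. x * q ^ i \<noteq> 1) \<Longrightarrow> qpoch_inf x q \<noteq> 0"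
  unfolding qpoch_inf_def
  by (intro prodinf_nonzero convergent_prod_qpoch) auto

lemma qpoch_inf_shift_tendsto: "(\<lambda>n. qpoch_inf (x * q ^ n) q) \<longlonglongrightarrow> 1"
proof -
  \<comment> \<open>The tail is written as the full product over a finite one. Finitely many factors
    may vanish and make this 0 / 0, so the product starts beyond them.\<close>
  obtain M where M: "\<And>n. n \<ge> M \<Longrightarrow> 1 - x * q ^ n \<noteq> 0"
    using convergent_prod_imp_ev_nonzero[OF convergent_prod_qpoch, of x]
    by (auto simp: eventually_sequentially)
  define y where "y = x * q ^ M"
  have nz: "y * q ^ i \<noteq> 1" for i
    using M[of "M + i"] by (simp add: y_def power_add mult.assoc)
  have "(\<lambda>n. qpoch_inf y q / qpoch y q n) \<longlonglongrightarrow> qpoch_inf y q / qpoch_inf y q"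
    by (intro tendsto_intros qpoch_tendsto qpoch_inf_nonzero nz)
  also have "(\<lambda>n. qpoch_inf y q / qpoch y q n) = (\<lambda>n. qpoch_inf (x * q ^ (n + M)) q)"
    using qpoch_inf_split[of y] qpoch_nonzero[of _ y q] nz
    by (auto simp: y_def power_add mult_ac field_simps)
  also have "qpoch_inf y q / qpoch_inf y q = 1"
    using qpoch_inf_nonzero[of y] nz by simp
  finally show ?thesis by (rule LIMSEQ_offset)
qed

end

lemma qpoch_inverse_power_eq_0:
  assumes "q \<noteq> 0" "n < k"
  shows "qpoch (inverse (q ^ n)) q k = 0"
  using assms by (auto simp: qpoch_def intro!: bexI[of _ n])

text \<open>One power of \<open>q^N\<close> per factor turns the divergent
  \<open>(q^-N; q)_j\<close> into a polynomial in \<open>q^N\<close>.\<close>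

lemma qpoch_inverse_power:
  assumes "q \<noteq> 0"
  shows "(q ^ N) ^ j * qpoch (inverse (q ^ N)) q j = (\<Prod>i<j. q ^ N - q ^ i)"
proof -
  have "(q ^ N) ^ j * qpoch (inverse (q ^ N)) q j = (\<Prod>i<j. q ^ N * (1 - inverse (q ^ N) * q ^ i))"
    by (simp add: qpoch_def prod.distrib)
  also have "\<dots> = (\<Prod>i<j. q ^ N - q ^ i)"
    using assms by (intro prod.cong) (auto simp: field_simps)
  finally show ?thesis .
qed

lemma basic_hyp_terminating:
  assumes "q \<noteq> 0"
  shows "basic_hyp (inverse (q ^ n) # xs) ys q z =
    (\<Sum>k\<le>n. qpochs (inverse (q ^ n) # xs) q k / (qpoch q q k * qpochs ys q k) * z ^ k)"
  unfolding basic_hyp_def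
  by (rule suminf_finite) (auto simp: qpochs_def qpoch_inverse_power_eq_0 assms)

section \<open>The scaled polynomials\<close>

text \<open>Of the \<open>n\<close> powers of \<open>q^N\<close> available, \<open>j\<close> go to
  the pairs \<open>(1 - q^(a-s+i)) (1 - q^(a+s+1+i))\<close> and produce the first product, since
  \<open>q^N q^(2a+1) = tc / ta\<close>; the other \<open>n - j\<close> clear
  \<open>(q^-N; q)_n / (q^-N; q)_j\<close> and produce the second. No denominator contains
  \<open>\<epsilon>\<close> or \<open>v\<close>.\<close>

definition scaled_poly :: "complex \<Rightarrow> complex \<Rightarrow> complex \<Rightarrow> complex \<Rightarrow> nat \<Rightarrow> complex \<Rightarrow> complex \<Rightarrow> complex" where
  "scaled_poly q ta tb tc n \<epsilon> v =
     (q * ta) ^ n * (qpoch (q * tb) q n * qpoch (q * tc) q n / qpoch (ta * tb * q ^ (n + 1)) q n) *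
     (\<Sum>j\<le>n. qpoch (inverse (q ^ n)) q j * qpoch (ta * tb * q ^ (n + 1)) q j /
         (qpoch q q j * qpoch (q * tb) q j * qpoch (q * tc) q j) * q ^ j *
         (\<Prod>i<j. \<epsilon> - q ^ i * v + q ^ (2 * i) * (tc / ta)) * (\<Prod>i=j..<n. \<epsilon> - q ^ i))"

text \<open>The product over \<open>i < n\<close> is \<open>(q^N)^n (q^-N; q)_n\<close>, and the
  factor with \<open>\<epsilon>\<close> comes from the parameter
  \<open>q^(b-a+\<alpha>+\<beta>+1)\<close>.\<close>

definition scaled_norm2 :: "complex \<Rightarrow> complex \<Rightarrow> complex \<Rightarrow> complex \<Rightarrow> nat \<Rightarrow> complex \<Rightarrow> complex" where
  "scaled_norm2 q ta tb tc n \<epsilon> =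
     (q * ta) ^ (2 * n) * (tc / ta) ^ n * (\<Prod>i<n. \<epsilon> - q ^ i) *
     (qpoch q q n * qpoch (q * ta) q n * qpoch (q * tb) q n * qpoch (q * tc) q n *
      qpoch (ta * tb * q\<^sup>2 * \<epsilon>) q n * qpoch (ta * tb / tc * q) q n) /
     (qpoch (ta * tb * q\<^sup>2) q (2 * n) * qpoch (ta * tb * q ^ (n + 1)) q n)"

lemma scaled_poly_tendsto:
  assumes "(e \<longlongrightarrow> e') F" and "(v \<longlongrightarrow> v') F"
  shows "((\<lambda>N. scaled_poly q ta tb tc n (e N) (v N)) \<longlongrightarrow> scaled_poly q ta tb tc n e' v') F"
  unfolding scaled_poly_def divide_inverse by (intro tendsto_intros assms)

lemma scaled_poly_bounded:
  "\<exists>M. \<forall>\<epsilon> v. norm \<epsilon> \<le> R \<longrightarrow> norm v \<le> R \<longrightarrow> norm (scaled_poly q ta tb tc n \<epsilon> v) \<le> M"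
proof -
  have "continuous_on (cball 0 R \<times> cball 0 R) (\<lambda>(\<epsilon>, v). scaled_poly q ta tb tc n \<epsilon> v)"
    unfolding scaled_poly_def divide_inverse case_prod_beta by (intro continuous_intros)
  then have "bounded ((\<lambda>(\<epsilon>, v). scaled_poly q ta tb tc n \<epsilon> v) ` (cball 0 R \<times> cball 0 R))"
    by (intro compact_imp_bounded compact_continuous_image compact_Times compact_cball)
  then obtain M where "\<forall>x\<in>cball 0 R \<times> cball 0 R. norm (case x of (\<epsilon>, v) \<Rightarrow> scaled_poly q ta tb tc n \<epsilon> v) \<le> M"
    unfolding bounded_iff by blast
  then show ?thesis by (intro exI[of _ M]) auto
qed

section \<open>Admissible parameters, and the limit family as values at
  \<open>\<epsilon> = 0\<close>\<close>

locale qparams =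
  fixes q ta tb tc \<alpha> \<beta> :: real
  assumes q_pos: "0 < q" and q_less_1: "q < 1"
    and qta_pos: "0 < q * ta" and qta_less_1: "q * ta < 1"
    and qtb_pos: "0 < q * tb" and qtb_less_1: "q * tb < 1"
    and tc_neg: "tc < 0"
    and q_powr_alpha: "q powr \<alpha> = ta" and q_powr_beta: "q powr \<beta> = tb"
begin

abbreviation "Q \<equiv> complex_of_real q"
abbreviation "TA \<equiv> complex_of_real ta"
abbreviation "TB \<equiv> complex_of_real tb"
abbreviation "TC \<equiv> complex_of_real tc"
abbreviation "r \<equiv> TC / TA"

lemma ta_pos: "0 < ta" and tb_pos: "0 < tb"
  using qta_pos qtb_pos q_pos by (simp_all add: zero_less_mult_iff)

lemma nonzero [simp]: "Q \<noteq> 0" "TA \<noteq> 0" "TB \<noteq> 0" "TC \<noteq> 0"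
    "q \<noteq> 0" "ta \<noteq> 0" "tb \<noteq> 0" "tc \<noteq> 0"
  using q_pos ta_pos tb_pos tc_neg by auto

lemma norm_Q: "norm Q < 1"
  using q_pos q_less_1 by simp

lemma Q_power_tendsto: "(\<lambda>n. Q ^ n) \<longlonglongrightarrow> 0"
  using norm_Q by (rule LIMSEQ_power_zero)

lemma real_neq_1: "x < 1 \<Longrightarrow> complex_of_real x * Q ^ i \<noteq> 1"
proof -
  assume "x < 1"
  moreover have "x * q ^ i \<noteq> 1"
  proof (cases "x > 0")
    case True
    then have "x * q ^ i \<le> x" using q_pos q_less_1 by (intro mult_right_le_one_le power_le_one) auto
    then show ?thesis using \<open>x < 1\<close> by simp
  next
    case False
    then have "x * q ^ i \<le> 0" using q_pos by (simp add: mult_nonpos_nonneg)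
    then show ?thesis by simp
  qed
  ultimately show ?thesis by (simp flip: of_real_power of_real_mult)
qed

lemma tatb_less_1: "ta * tb * q ^ Suc (Suc k) < 1"
proof -
  have "(q * ta) * (q * tb) * q ^ k \<le> (q * ta) * (q * tb)"
    using qta_pos qtb_pos q_pos q_less_1 by (intro mult_right_le_one_le power_le_one) auto
  also have "\<dots> < 1 * 1"
    using qta_pos qtb_pos qta_less_1 qtb_less_1 by (intro mult_strict_mono) auto
  finally show ?thesis by (simp add: algebra_simps power2_eq_square)
qed

text \<open>Every parameter here is a real number below 1: those containing \<open>r\<close> or
  \<open>TC\<close> to an odd power are negative, the others are bounded through
  \<open>q * ta < 1\<close> and \<open>q * tb < 1\<close>. The exponent of \<open>Q\<close> next to
  \<open>TA * TB\<close> starts at 2 because \<open>TA * TB * Q\<close> may equal 1.\<close>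

lemma neq_1:
  "TA * TB * Q ^ Suc (Suc k) * Q ^ i \<noteq> 1" "TA * TB * Q ^ Suc (Suc k) \<noteq> 1"
  "Q * Q ^ i \<noteq> 1" "Q * TA * Q ^ i \<noteq> 1" "Q * TB * Q ^ i \<noteq> 1"
  "TC * Q ^ i \<noteq> 1" "r * Q ^ i \<noteq> 1" "TB / r * Q ^ i \<noteq> 1" "inverse r * Q ^ i \<noteq> 1" "r / TB * Q ^ i \<noteq> 1"
  "TA * TB / TC * Q ^ i \<noteq> 1"
proof -
  have neg: "complex_of_real x * Q ^ i \<noteq> 1" if "x < 0" for x i
    using that by (intro real_neq_1) simp
  show "r * Q ^ i \<noteq> 1" "TB / r * Q ^ i \<noteq> 1" "inverse r * Q ^ i \<noteq> 1" "r / TB * Q ^ i \<noteq> 1"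
    "TA * TB / TC * Q ^ i \<noteq> 1" "TC * Q ^ i \<noteq> 1"
    using neg[of "tc / ta" i] neg[of "tb / (tc / ta)" i] neg[of "inverse (tc / ta)" i]
      neg[of "tc / ta / tb" i] neg[of "ta * tb / tc" i] neg[of tc i] ta_pos tb_pos tc_neg
      mult_pos_pos[OF ta_pos tb_pos]
    by (simp_all only: divide_neg_pos divide_pos_neg negative_imp_inverse_negative
        of_real_divide of_real_mult of_real_inverse simp_thms not_False_eq_True)
  show "TA * TB * Q ^ Suc (Suc k) * Q ^ i \<noteq> 1" "TA * TB * Q ^ Suc (Suc k) \<noteq> 1"
    using real_neq_1[OF tatb_less_1, of k i] real_neq_1[OF tatb_less_1, of k 0] by simp_all
  show "Q * Q ^ i \<noteq> 1" by (intro real_neq_1 q_less_1)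
  show "Q * TA * Q ^ i \<noteq> 1" "Q * TB * Q ^ i \<noteq> 1"
    using real_neq_1[OF qta_less_1, of i] real_neq_1[OF qtb_less_1, of i] by simp_all
qed

lemma qpoch_nz [simp]:
  "qpoch Q Q j \<noteq> 0" "qpoch (Q * TA) Q j \<noteq> 0" "qpoch (Q * TB) Q j \<noteq> 0" "qpoch (Q * TC) Q j \<noteq> 0"
  "qpoch (TA * TB * Q\<^sup>2) Q j \<noteq> 0" "qpoch (TA * TB * Q / TC) Q j \<noteq> 0"
proof -
  show "qpoch (Q * TC) Q j \<noteq> 0"
    using neq_1(6)[of "Suc i" for i] by (intro qpoch_nonzero) (simp add: mult_ac)
  show "qpoch (TA * TB * Q / TC) Q j \<noteq> 0"
    using neq_1(11)[of "Suc i" for i] by (intro qpoch_nonzero) (simp add: mult_ac)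
  show "qpoch (TA * TB * Q\<^sup>2) Q j \<noteq> 0"
    using neq_1(1)[of 0] by (intro qpoch_nonzero) (simp add: mult_ac power2_eq_square)
qed (intro qpoch_nonzero neq_1)+

text \<open>For \<open>n = 0\<close> the base \<open>TA * TB * Q\<close> may be 1, but then the
  product is empty.\<close>

lemma qpoch_tatb_nz [simp]: "qpoch (TA * TB * Q ^ (n + 1)) Q n \<noteq> 0"
  by (cases n) (simp, simp only: Suc_eq_plus1[symmetric], intro qpoch_nonzero neq_1)

lemma E_of_nat: "Q powr of_nat n = Q ^ n"
  by (rule powr_complexpow) simp

lemma E_power: "(Q powr z) ^ n = Q powr (of_nat n * z)"
  by (simp add: powr_def mult_ac flip: exp_of_nat_mult)

text \<open>Complex powers do not compose in general; here \<open>Q\<close> is a positive real, so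
  \<open>Ln (Q ^ n)\<close> is \<open>of_nat n * Ln Q\<close>.\<close>

lemma power_powr: "(Q ^ n) powr z = Q powr (of_nat n * z)"
proof -
  have "Ln (Q ^ n) = of_nat n * Ln Q"
    using q_pos by (simp add: Ln_of_real ln_realpow flip: of_real_power)
  then show ?thesis by (simp add: powr_def mult_ac)
qed

lemma E_alpha: "Q powr complex_of_real \<alpha> = TA" and E_beta: "Q powr complex_of_real \<beta> = TB"
  using q_pos by (simp_all add: powr_of_real q_powr_alpha q_powr_beta)

lemma kappa_q_nz [simp]: "kappa_q Q \<noteq> 0"
proof -
  have "q powr (1/2) * q powr (1/2) = q" "q powr (1/2) * q powr (-1/2) = 1"
    using q_pos by (simp_all flip: powr_add)
  then have "q powr (1/2) \<noteq> q powr (-1/2)" using q_less_1 by auto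
  moreover have "kappa_q Q = complex_of_real (q powr (1/2) - q powr (-1/2))"
    using q_pos powr_of_real[of q "1/2"] powr_of_real[of q "-1/2"] by (simp add: kappa_q_def)
  ultimately show ?thesis by (simp only: of_real_eq_0_iff)
qed

text \<open>At \<open>\<epsilon> = 0\<close> the pair factor with index \<open>i\<close> becomes
  \<open>- q^i v (1 - (q tc / z) q^i)\<close>, because \<open>r / v = q tc / z\<close>. The signed
  powers \<open>- q^i\<close> of the two products together run over all \<open>i < n\<close>, so
  they leave the sum as a common factor.\<close>

lemma bigqJ_eq_scaled_poly:
  assumes "z \<noteq> 0"
  shows "bigqJ Q TA TB TC n z = scaled_poly Q TA TB TC n 0 (z / (Q * TA))"
proof -
  define v where "v = z / (Q * TA)"
  have vr: "v * (Q * TC / z) = r"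
    using assms by (simp add: v_def)
  have *: "(\<Prod>i<j. 0 - Q ^ i * v + Q ^ (2 * i) * r) * (\<Prod>i=j..<n. 0 - Q ^ i) =
    v ^ j * qpoch (Q * TC / z) Q j * (\<Prod>i<n. - (Q ^ i))" if "j \<le> n" for j
  proof -
    have "(\<Prod>i<j. 0 - Q ^ i * v + Q ^ (2 * i) * r) = (\<Prod>i<j. v * (1 - Q * TC / z * Q ^ i) * - (Q ^ i))"
      unfolding vr[symmetric] by (intro prod.cong refl) (simp add: algebra_simps mult_2_right power_add)
    also have "\<dots> = v ^ j * qpoch (Q * TC / z) Q j * (\<Prod>i<j. - (Q ^ i))"
      unfolding qpoch_def by (simp only: prod.distrib prod_constant card_lessThan)
    finally show ?thesis
      using prod.atLeastLessThan_concat[of 0 j n "\<lambda>i. - (Q ^ i)"] that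
      by (simp add: lessThan_atLeast0 mult.assoc)
  qed
  \<comment> \<open>The exponents add up as
    \<open>n (n - 1) / 2 + n = n (n + 1) / 2\<close>.\<close>
  have "(\<Prod>i<n. - (Q ^ i)) * (Q * TA) ^ n = (- TA) ^ n * Q powr (of_nat (n * (n + 1)) / 2)"
  proof (induction n)
    case (Suc n)
    have "complex_of_nat (Suc n * (Suc n + 1)) / 2 = of_nat (n * (n + 1)) / 2 + of_nat (Suc n)"
      by (simp add: field_simps)
    then have "Q powr (of_nat (Suc n * (Suc n + 1)) / 2) = Q powr (of_nat (n * (n + 1)) / 2) * Q ^ Suc n"
      by (simp only: powr_add E_of_nat)
    then show ?case using Suc by (simp add: algebra_simps)
  qed simp
  note pre = this
  have E_n: "Q powr - of_nat n = inverse (Q ^ n)" by (simp add: powr_minus)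
  have zt: "z / TA = Q * v" by (simp add: v_def)
  show ?thesis
    unfolding bigqJ_def pre[symmetric] E_n basic_hyp_terminating[OF nonzero(1)] scaled_poly_def
      v_def[symmetric] zt sum_distrib_left
  proof (intro sum.cong refl)
    fix j assume "j \<in> {..n}"
    then have "j \<le> n" by simp
    have arith: "W * QT * D * (X / Y * (Q * v) ^ j) = QT * D * (x / y * Q ^ j * P1 * P2)"
      if "P1 * P2 = v ^ j * x' * W" "X = x * x'" "Y = y" for W QT D X Y x x' y P1 P2 :: complex
    proof -
      have "QT * D * (x / y * Q ^ j * P1 * P2) = QT * D * (x / y * Q ^ j * (P1 * P2))" by simp
      also have "\<dots> = W * QT * D * (X / Y * (Q * v) ^ j)"
        unfolding that by (simp add: power_mult_distrib mult_ac)
      finally show ?thesis by (rule sym)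
    qed
    show "(\<Prod>i<n. - (Q ^ i)) * (Q * TA) ^ n *
        (qpochs [Q * TB, Q * TC] Q n / qpoch (TA * TB * Q ^ (n + 1)) Q n) *
        (qpochs [inverse (Q ^ n), TA * TB * Q ^ (n + 1), Q * TC / z] Q j /
          (qpoch Q Q j * qpochs [Q * TB, Q * TC] Q j) * (Q * v) ^ j) =
      (Q * TA) ^ n * (qpoch (Q * TB) Q n * qpoch (Q * TC) Q n / qpoch (TA * TB * Q ^ (n + 1)) Q n) *
        (qpoch (inverse (Q ^ n)) Q j * qpoch (TA * TB * Q ^ (n + 1)) Q j /
          (qpoch Q Q j * qpoch (Q * TB) Q j * qpoch (Q * TC) Q j) * Q ^ j *
          (\<Prod>i<j. 0 - Q ^ i * v + Q ^ (2 * i) * r) * (\<Prod>i=j..<n. 0 - Q ^ i))"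
      unfolding qpochs_def list.map prod_list.Cons prod_list.Nil mult_1_right
      by (rule arith[OF *[OF \<open>j \<le> n\<close>]]) (simp_all only: mult.assoc)
  qed
qed

lemma bigqJ_norm2_eq_scaled_norm2:
  "bigqJ_norm2 Q TA TB TC n = scaled_norm2 Q TA TB TC n 0"
proof -
  have pr: "(\<Prod>i<n. 0 - Q ^ i) = (-1) ^ n * Q ^ (n choose 2)"
    by (induction n) (simp_all add: power_add numeral_2_eq_2 algebra_simps)
  \<comment> \<open>The \<open>2 * n\<close> factors of the denominator are split as
    \<open>n - 1\<close>, then \<open>n\<close>, then the single factor
    \<open>1 - TA * TB * Q ^ (2 * n + 1)\<close>.\<close>
  have "(if n = 0 then 1
      else 1 / ((1 - TA * TB * Q ^ (2 * n + 1)) * qpoch (TA * TB * Q\<^sup>2) Q (n - 1))) =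
    qpoch (TA * TB * Q ^ (n + 1)) Q n / qpoch (TA * TB * Q\<^sup>2) Q (2 * n)"
  proof (cases n)
    case (Suc m)
    have "2 * n = m + Suc n" using Suc by simp
    then have "qpoch (TA * TB * Q\<^sup>2) Q (2 * n) =
      qpoch (TA * TB * Q\<^sup>2) Q m * (qpoch (TA * TB * Q ^ (n + 1)) Q n * (1 - TA * TB * Q ^ (2 * n + 1)))"
      unfolding \<open>2 * n = m + Suc n\<close> qpoch_add[of _ _ m "Suc n"] qpoch_Suc[of _ _ n]
      by (simp add: Suc power2_eq_square power_add mult_ac)
    then show ?thesis using Suc qpoch_tatb_nz[of n] by (simp del: qpoch_tatb_nz)
  qed simp
  note fac = this
  have "(TA * TA * r) = TA * TC" by simp
  then have sc: "(Q * TA) ^ (2 * n) * r ^ n * (-1) ^ n = (- TA * TC * Q\<^sup>2) ^ n"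
    by (simp add: power_mult power2_eq_square mult_ac flip: power_mult_distrib)
  show ?thesis
    unfolding bigqJ_norm2_def fac scaled_norm2_def pr sc[symmetric] qpochs_def
      list.map prod_list.Cons prod_list.Nil mult_1_right mult_zero_right qpoch_zero
    using qpoch_tatb_nz[of n] by (simp add: power2_eq_square mult_ac del: qpoch_tatb_nz)
qed

lemma bigqJ_norm2_nz: "bigqJ_norm2 Q TA TB TC n \<noteq> 0"
proof -
  have "qpoch (TA * TB / TC * Q) Q n \<noteq> 0" using qpoch_nz(6)[of n] by simp
  then show ?thesis
    unfolding bigqJ_norm2_eq_scaled_norm2 scaled_norm2_def mult_zero_right divide_eq_0_iff mult_eq_0_iff
    using qpoch_tatb_nz[of n] by (simp add: qpoch_zero del: qpoch_tatb_nz)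
qed

lemma scaled_norm2_tendsto:
  "(\<lambda>N. scaled_norm2 Q TA TB TC n (Q ^ N)) \<longlonglongrightarrow> bigqJ_norm2 Q TA TB TC n"
  unfolding bigqJ_norm2_eq_scaled_norm2 scaled_norm2_def qpoch_def[of "_ * _ * _ * _"] divide_inverse
  by (intro tendsto_intros Q_power_tendsto)

end

section \<open>Scaled recurrence coefficients and their limits\<close>

definition scaled_beta :: "complex \<Rightarrow> complex \<Rightarrow> complex \<Rightarrow> complex \<Rightarrow> nat \<Rightarrow> complex \<Rightarrow> complex" where
  "scaled_beta q ta tb tc n \<epsilon> =
     q * ta * \<epsilon> + q * tc
     - (if n = 0 then 1 else (1 - ta * tb * q ^ (n + 1)) / (1 - ta * tb * q ^ (2 * n + 1))) *
       (q * ta * (\<epsilon> - q ^ n) * (1 - tb * q ^ (n + 1)) * (1 - tc * q ^ (n + 1)) / (1 - ta * tb * q ^ (2 * n + 2)))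
     - q * tc * ((1 - ta * q ^ n) * (1 - ta * tb * q ^ (n + 1) * \<epsilon>) * (1 - ta * tb / tc * q ^ n) * (1 - q ^ n) /
         ((1 - ta * tb * q ^ (2 * n)) * (1 - ta * tb * q ^ (2 * n + 1))))"

text \<open>The factor \<open>\<epsilon> * q - q ^ n\<close> stems from the bracket of
  \<open>a - b + n\<close>: \<open>q^(a-b+n) = q^n / q^(N+1)\<close>, so clearing it costs one power
  of \<open>q\<close> besides \<open>q^N\<close>.\<close>

definition scaled_gamma :: "complex \<Rightarrow> complex \<Rightarrow> complex \<Rightarrow> complex \<Rightarrow> nat \<Rightarrow> complex \<Rightarrow> complex" where
  "scaled_gamma q ta tb tc n \<epsilon> =
     q * ta * tc * (\<epsilon> * q - q ^ n) *
     (if n = 1 then 1 else (1 - ta * tb * q ^ n) / (1 - ta * tb * q ^ (2 * n - 1))) *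
     ((1 - q ^ n) * (1 - ta * q ^ n) * (1 - tb * q ^ n) * (1 - tc * q ^ n) *
      (1 - ta * tb / tc * q ^ n) * (1 - ta * tb * q ^ (n + 1) * \<epsilon>) /
      ((1 - ta * tb * q ^ (2 * n)) ^ 2 * (1 - ta * tb * q ^ (2 * n + 1))))"

context qparams
begin

lemma scaled_gamma_0:
  "bigqJ_gamma Q TA TB TC n = scaled_gamma Q TA TB TC n 0"
  unfolding bigqJ_gamma_def scaled_gamma_def by simp

lemma scaled_gamma_tendsto:
  "(\<lambda>N. scaled_gamma Q TA TB TC n (Q ^ N)) \<longlonglongrightarrow> bigqJ_gamma Q TA TB TC n"
proof -
  have "(\<lambda>N. c * (Q ^ N * Q - d) * k * (l * (1 - f * Q ^ N) * m)) \<longlonglongrightarrow> c * (0 * Q - d) * k * (l * (1 - f * 0) * m)"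
    for c d k l f m
    by (intro tendsto_intros Q_power_tendsto)
  then show ?thesis unfolding scaled_gamma_0 scaled_gamma_def divide_inverse .
qed

text \<open>The recurrence coefficient of the big \<open>q\<close>-Jacobi polynomials is written as \<open>1 - A\<^sub>n - C\<^sub>n\<close>,
  relative to the point \<open>z = 1\<close>, while the limit of the \<open>q\<close>-Racah coefficient is relative to \<open>z = q * tc\<close>.\<close>
lemma scaled_beta_0: "bigqJ_beta Q TA TB TC n = scaled_beta Q TA TB TC n 0"
proof (cases n)
  \<comment> \<open>Without the cancellation \<open>1 - TA * TB\<close> and
    \<open>1 - TA * TB * Q\<close> would appear as denominators, and both may be zero; hence the
    separate case.\<close>
  case 0
  define D where "D = 1 - TA * TB * Q\<^sup>2"
  have nz: "D \<noteq> 0" using neq_1(2)[of 0] by (simp add: D_def power2_eq_square)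
  have "D - (1 - TA * Q) * (1 - TC * Q) = Q * TC * D + Q * TA * (1 - TB * Q) * (1 - TC * Q)"
    by (simp add: D_def algebra_simps power2_eq_square)
  then have "1 - (1 - TA * Q) * (1 - TC * Q) / D = Q * TC + Q * TA * (1 - TB * Q) * (1 - TC * Q) / D"
    using nz by (metis add_divide_distrib diff_divide_distrib divide_self nonzero_mult_div_cancel_right)
  then show ?thesis
    unfolding bigqJ_beta_def scaled_beta_def 0 by (simp add: D_def power2_eq_square)
next
  case (Suc m)
  define x where "x = Q ^ n"
  define D0 where "D0 = 1 - TA * TB * x\<^sup>2"
  define D1 where "D1 = 1 - TA * TB * Q * x\<^sup>2"
  define D2 where "D2 = 1 - TA * TB * Q\<^sup>2 * x\<^sup>2"
  have nz: "D0 \<noteq> 0" "D1 \<noteq> 0" "D2 \<noteq> 0"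
    using neq_1(2)[of "2 * m"] neq_1(2)[of "2 * m + 1"] neq_1(2)[of "2 * m + 2"]
    by (simp_all add: D0_def D1_def D2_def x_def Suc power_mult_distrib power2_eq_square mult_2_right power_add mult_ac)
  have p: "Q ^ (2 * n) = x\<^sup>2" "Q ^ (2 * n + 1) = Q * x\<^sup>2" "Q ^ (2 * n + 2) = Q\<^sup>2 * x\<^sup>2"
    "Q ^ (n + 1) = Q * x" "Q ^ n = x"
    by (simp_all add: x_def power_add power2_eq_square mult_2)
  \<comment> \<open>In the difference of the two sides the fractions over \<open>D1 * D2\<close>
    combine, and their brackets add up to \<open>D2\<close>. In \<open>C\<close> the same happens
    with \<open>D0\<close>. What remains is a polynomial identity over the single denominator
    \<open>D1\<close>.\<close>
  have A: "(1 - TA * TB * Q * x) * (1 - TC * Q * x) * ((1 - TA * Q * x) + TA * Q * x * (1 - TB * Q * x)) / (D1 * D2)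
    = (1 - TA * TB * Q * x) * (1 - TC * Q * x) / D1"
  proof -
    have "(1 - TA * Q * x) + TA * Q * x * (1 - TB * Q * x) = D2"
      by (simp add: D2_def algebra_simps power2_eq_square)
    then show ?thesis using nz by simp
  qed
  have C: "(1 - x) * (TC - TA * TB * x) * Q * (TA * x * (1 - TB * x) + (1 - TA * x)) / (D0 * D1)
    = (1 - x) * (TC - TA * TB * x) * Q / D1"
  proof -
    have "TA * x * (1 - TB * x) + (1 - TA * x) = D0"
      by (simp add: D0_def algebra_simps power2_eq_square)
    then show ?thesis using nz by simp
  qed
  have "1 - Q * TC = ((1 - TA * TB * Q * x) * (1 - TC * Q * x) - (1 - x) * (TC - TA * TB * x) * Q) / D1"
  proof -
    have "(1 - Q * TC) * D1 = (1 - TA * TB * Q * x) * (1 - TC * Q * x) - (1 - x) * (TC - TA * TB * x) * Q"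
      by (simp add: D1_def algebra_simps power2_eq_square)
    then show ?thesis using nz(2) by (simp add: eq_divide_eq)
  qed
  also have "\<dots> = (1 - TA * TB * Q * x) * (1 - TC * Q * x) / D1 - (1 - x) * (TC - TA * TB * x) * Q / D1"
    by (simp add: diff_divide_distrib)
  finally have main: "1 - Q * TC = (1 - TA * TB * Q * x) * (1 - TC * Q * x) * ((1 - TA * Q * x) + TA * Q * x * (1 - TB * Q * x)) / (D1 * D2)
     - (1 - x) * (TC - TA * TB * x) * Q * (TA * x * (1 - TB * x) + (1 - TA * x)) / (D0 * D1)"
    unfolding A C .
  have tc: "TC * (1 - TA * TB / TC * x) = TC - TA * TB * x" by (simp add: field_simps)
  have Q2: "1 - TA * TB * (Q * x\<^sup>2) = D1" "1 - TA * TB * (Q\<^sup>2 * x\<^sup>2) = D2" "1 - TA * TB * x\<^sup>2 = D0"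
    by (simp_all add: D0_def D1_def D2_def)
  have e1: "u / d * (v * w / e) - u / d * (k * (0 - x) * y * w / e) = u * w * (v + k * x * y) / (d * e)"
    and e2: "g * x * (s * f * y / d) + p * (z * (1 - t * 0) * f * s / d) = f * s * (g * x * y + p * z) / d"
    for u d v w e k x y g s f p z t :: complex
    by (simp_all add: divide_inverse algebra_simps)
  have "bigqJ_beta Q TA TB TC n - scaled_beta Q TA TB TC n 0 = (1 - Q * TC) -
    (1 - TA * TB * Q * x) * (1 - TC * (Q * x)) * ((1 - TA * (Q * x)) + Q * TA * x * (1 - TB * (Q * x))) / (D1 * D2)
     + (1 - TA * TB / TC * x) * (1 - x) * (TA * TC * Q * x * (1 - TB * x) + Q * TC * (1 - TA * x)) / (D0 * D1)"
    unfolding bigqJ_beta_def scaled_beta_def p Q2 e1[symmetric] e2[symmetric, of _ _ _ _ _ _ _ _ "TA * TB * (Q * x)"]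
    using Suc by (simp add: mult_ac)
  also have "(1 - TA * TB / TC * x) * (1 - x) * (TA * TC * Q * x * (1 - TB * x) + Q * TC * (1 - TA * x)) =
    (1 - x) * (TC * (1 - TA * TB / TC * x)) * Q * (TA * x * (1 - TB * x) + (1 - TA * x))"
    by (simp only: mult_ac distrib_left)
  also have "1 - Q * TC - (1 - TA * TB * Q * x) * (1 - TC * (Q * x)) *
      ((1 - TA * (Q * x)) + Q * TA * x * (1 - TB * (Q * x))) / (D1 * D2)
     + (1 - x) * (TC * (1 - TA * TB / TC * x)) * Q * (TA * x * (1 - TB * x) + (1 - TA * x)) / (D0 * D1) = 0"
    unfolding main tc by (simp add: mult_ac)
  finally show ?thesis by simp
qed

lemma scaled_beta_tendsto:
  "(\<lambda>N. scaled_beta Q TA TB TC n (Q ^ N)) \<longlonglongrightarrow> bigqJ_beta Q TA TB TC n"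
proof -
  have "(\<lambda>N. k * Q ^ N + l - u * (k * (Q ^ N - c) * d * e * f) - l * (s * (1 - t * Q ^ N) * v * w * x)) \<longlonglongrightarrow>
    k * 0 + l - u * (k * (0 - c) * d * e * f) - l * (s * (1 - t * 0) * v * w * x)"
    for k l u c d e f s t v w x
    by (intro tendsto_intros Q_power_tendsto)
  then show ?thesis unfolding scaled_beta_0 scaled_beta_def divide_inverse .
qed

end

section \<open>The \<open>q\<close>-Racah side for one fixed \<open>N\<close>\<close>

locale qracah_params = qparams +
  fixes N :: nat and a b :: complex
  assumes b_minus_a: "b - a = of_nat (N + 1)" and powr_a_plus_b: "Q powr (a + b) = r"
begin

abbreviation "E z \<equiv> Q powr z"
abbreviation "C n \<equiv> scaleC Q TA a b N n"
abbreviation "\<sigma> \<equiv> Q ^ (N + 1) * TA * (E (a + 1) / c1 Q)"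

lemma b_eq: "b = a + of_nat N + 1"
  using b_minus_a by (simp add: algebra_simps)

lemma E_add: "E (x + y) = E x * E y" and E_diff: "E (x - y) = E x / E y"
  by (simp_all add: powr_add powr_diff)

lemma E_nz [simp]: "E z \<noteq> 0"
  by (simp add: powr_def)

text \<open>Both conditions on \<open>a\<close> and \<open>b\<close> meet here. For every
  \<open>s\<close> this is the product of \<open>q^(a-s)\<close> and \<open>q^(a+s+1)\<close>, which
  makes their sum a sufficient variable.\<close>

lemma E_2a: "E (2 * a + 1) = r / Q ^ N"
proof -
  have "2 * a + 1 = (a + b) - of_nat N" by (simp add: b_eq)
  then show ?thesis by (simp only: E_diff powr_a_plus_b E_of_nat)
qed

lemma E_params:
  "E (a - b + 1) = inverse (Q ^ N)" "E (complex_of_real \<beta> + 1) = Q * TB"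
  "E (a + b + complex_of_real \<alpha> + 1) = Q * TC"
  "E (complex_of_real \<alpha> + complex_of_real \<beta> + of_nat n + 1) = TA * TB * Q ^ (n + 1)"
  "E (complex_of_real \<alpha> + 1) = Q * TA"
  "E (b - a + complex_of_real \<alpha> + complex_of_real \<beta> + 1) = TA * TB * Q\<^sup>2 * Q ^ N"
  "E (complex_of_real \<beta> - a - b + 1) = TA * TB / TC * Q"
  "E (complex_of_real \<alpha> + complex_of_real \<beta> + 2) = TA * TB * Q\<^sup>2"
proof -
  have "a - b + 1 = - of_nat N" by (simp add: b_eq)
  then show "E (a - b + 1) = inverse (Q ^ N)" by (simp add: powr_minus E_of_nat)
  have *: "complex_of_real \<beta> - a - b + 1 = complex_of_real \<beta> - (a + b) + 1" by simp
  show "E (complex_of_real \<beta> - a - b + 1) = TA * TB / TC * Q"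
    unfolding * using E_add[of "complex_of_real \<beta> - (a + b)" 1] E_diff[of "complex_of_real \<beta>" "a + b"]
    by (simp add: powr_a_plus_b E_beta)
  show "E (complex_of_real \<alpha> + complex_of_real \<beta> + 2) = TA * TB * Q\<^sup>2"
    using E_of_nat[of 2] by (simp add: E_add E_alpha E_beta)
  show "E (a + b + complex_of_real \<alpha> + 1) = Q * TC"
    using E_add[of "a + b" "complex_of_real \<alpha> + 1"] E_add[of "complex_of_real \<alpha>" 1]
    by (simp add: powr_a_plus_b E_alpha add.assoc)
qed (simp_all add: b_minus_a E_add E_alpha E_beta E_of_nat power2_eq_square del: of_nat_add)

text \<open>Merging both half-integer powers into one exponential reduces later identities between
  roots to linear identities between exponents.\<close>

lemma scaleC_eq: "C n = E (of_nat n * (of_nat N + (a + b)) / 2) * (Q * TA) ^ n * kappa_q Q ^ (2 * n)"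
proof -
  have "of_nat N * (of_nat n / 2) + of_nat n * ((a + b) / 2) = of_nat n * (of_nat N + (a + b)) / 2"
    by (simp add: field_simps)
  then have "E (of_nat N * (of_nat n / 2)) * E (of_nat n * ((a + b) / 2)) = E (of_nat n * (of_nat N + (a + b)) / 2)"
    by (simp only: E_add[symmetric])
  then show ?thesis
    unfolding scaleC_def power_powr E_power by (simp add: mult_ac)
qed

lemma sigma_eq: "\<sigma> = E ((of_nat N + (a + b)) / 2) * (Q * TA) * (kappa_q Q)\<^sup>2"
proof -
  have "of_nat N + (a + 1) - 1 / 2 = (of_nat N + (a + b)) / 2"
    by (simp add: b_eq field_simps)
  then have "E ((of_nat N + (a + b)) / 2) = Q ^ N * E (a + 1) / E (1/2)"
    using E_add[of "of_nat N" "a + 1"] E_diff[of "of_nat N + (a + 1)" "1/2"] by (simp only: E_of_nat)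
  then show ?thesis by (simp add: c1_def)
qed

text \<open>The scaling factor of the recurrence equals the ratio of consecutive \<open>C n\<close>
  because \<open>q^(a+1) / c1\<close> contributes \<open>q^(a+1/2)\<close>, and
  \<open>N + a + 1/2\<close> is half of \<open>N + (a + b)\<close>.\<close>

lemma scaleC_Suc: "C (Suc n) = \<sigma> * C n"
proof -
  have "of_nat (Suc n) * (of_nat N + (a + b)) / 2 = (of_nat N + (a + b)) / 2 + of_nat n * (of_nat N + (a + b)) / 2"
    by (simp add: field_simps)
  then show ?thesis
    unfolding sigma_eq scaleC_eq by (simp only: E_add) (simp add: power2_eq_square)
qed

text \<open>The prefactor \<open>q^(-n(2a+1)/2)\<close> and \<open>C n\<close> leave exactly
  \<open>(q^N)^n\<close>, enough to clear every term of the sum. For \<open>n \<le> N\<close> all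
  \<open>(q^-N; q)_j\<close> with \<open>j \<le> n\<close> are nonzero, so the lower parameter does
  no harm.\<close>

lemma scaled_qRacah:
  assumes "n \<le> N"
  shows "C n * qRacah Q \<alpha> \<beta> a b n s =
    scaled_poly Q TA TB TC n (Q ^ N) (Q ^ N * (E (a - s) + E (a + s + 1)))"
proof -
  define X Y where "X = E (a - s)" and "Y = E (a + s + 1)"
  have XY: "Q ^ N * (X * Y) = r"
  proof -
    have "a - s + (a + s + 1) = 2 * a + 1" by simp
    then show ?thesis unfolding X_def Y_def E_add[symmetric] E_2a[symmetric] by (simp add: E_2a)
  qed
  have "of_nat n * (of_nat N + (a + b)) / 2 + (- (of_nat n / 2) * (2 * a + 1)) = of_nat (N * n)"
    by (simp add: b_eq field_simps)
  then have "E (of_nat n * (of_nat N + (a + b)) / 2) * E (- (of_nat n / 2) * (2 * a + 1)) = (Q ^ N) ^ n"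
    by (simp only: E_add[symmetric] E_of_nat power_mult)
  then have pre: "C n * E (- (of_nat n / 2) * (2 * a + 1)) = (Q ^ N) ^ n * (Q * TA) ^ n * kappa_q Q ^ (2 * n)"
    unfolding scaleC_eq by simp
  have En: "E (- of_nat n) = inverse (Q ^ n)" by (simp add: powr_minus E_of_nat)
  have *: "(Q ^ N) ^ n * qpoch (inverse (Q ^ N)) Q n * (qpoch X Q j * qpoch Y Q j / qpoch (inverse (Q ^ N)) Q j) =
      (\<Prod>i<j. Q ^ N - Q ^ i * (Q ^ N * (X + Y)) + Q ^ (2 * i) * r) * (\<Prod>i=j..<n. Q ^ N - Q ^ i)"
    if "j \<le> n" for j
  proof -
    have "Q ^ N * ((1 - X * Q ^ i) * (1 - Y * Q ^ i)) = Q ^ N - Q ^ i * (Q ^ N * (X + Y)) + Q ^ (2 * i) * r" for i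
      unfolding XY[symmetric] by (simp add: algebra_simps mult_2_right power_add)
    note factor = this
    have "(Q ^ N) ^ j * (qpoch X Q j * qpoch Y Q j) = (\<Prod>i<j. Q ^ N * ((1 - X * Q ^ i) * (1 - Y * Q ^ i)))"
      unfolding qpoch_def by (simp add: prod.distrib)
    then have 1: "(Q ^ N) ^ j * (qpoch X Q j * qpoch Y Q j) =
      (\<Prod>i<j. Q ^ N - Q ^ i * (Q ^ N * (X + Y)) + Q ^ (2 * i) * r)"
      unfolding factor .
    have "(\<Prod>i<j. Q ^ N - Q ^ i) \<noteq> 0"
    proof -
      have "Q ^ N - Q ^ i \<noteq> 0" if "i < j" for i
      proof -
        have "q ^ N < q ^ i"
          using that \<open>j \<le> n\<close> assms q_pos q_less_1 by (intro power_strict_decreasing) auto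
        then show ?thesis by (simp flip: of_real_power)
      qed
      then show ?thesis unfolding prod_zero_iff[OF finite_lessThan] by blast
    qed
    then have nz: "qpoch (inverse (Q ^ N)) Q j \<noteq> 0"
      unfolding qpoch_inverse_power[OF nonzero(1), symmetric] by simp
    have "(Q ^ N) ^ n * qpoch (inverse (Q ^ N)) Q n = (\<Prod>i<j. Q ^ N - Q ^ i) * (\<Prod>i=j..<n. Q ^ N - Q ^ i)"
      unfolding qpoch_inverse_power[OF nonzero(1)] lessThan_atLeast0
      using that by (subst prod.atLeastLessThan_concat) auto
    then show ?thesis
      unfolding qpoch_inverse_power[OF nonzero(1), symmetric] 1[symmetric] using nz by simp
  qed
  have arith: "qN * QT * K * (P * qtb * qtc / (K * D)) * (x * ab * X' * Y' / (qq * (P' * qtb' * qtc')) * qj) =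
      QT * (qtb * qtc / D) * (x * ab / (qq * qtb' * qtc') * qj * P1 * P2)"
    if "qN * P * (X' * Y' / P') = P1 * P2" "K \<noteq> 0"
    for qN QT K P qtb qtc D x ab X' Y' qq P' qtb' qtc' qj P1 P2 :: complex
  proof -
    have "QT * (qtb * qtc / D) * (x * ab / (qq * qtb' * qtc') * qj * P1 * P2) =
      QT * (qtb * qtc / D) * (x * ab / (qq * qtb' * qtc') * qj * (qN * P * (X' * Y' / P')))"
      unfolding that by simp
    also have "\<dots> = qN * QT * K * (P * qtb * qtc / (K * D)) * (x * ab * X' * Y' / (qq * (P' * qtb' * qtc')) * qj)"
      using that(2) by (simp add: mult_ac)
    finally show ?thesis by (rule sym)
  qed
  let ?pre = "(Q * TA) ^ n * (qpoch (Q * TB) Q n * qpoch (Q * TC) Q n / qpoch (TA * TB * Q ^ (n + 1)) Q n)"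
  have "C n * qRacah Q \<alpha> \<beta> a b n s =
    (C n * E (- (of_nat n / 2) * (2 * a + 1))) *
     (qpochs [inverse (Q ^ N), Q * TB, Q * TC] Q n / (kappa_q Q ^ (2 * n) * qpoch (TA * TB * Q ^ (n + 1)) Q n)) *
     (\<Sum>j\<le>n. qpochs [inverse (Q ^ n), TA * TB * Q ^ (n + 1), X, Y] Q j /
       (qpoch Q Q j * qpochs [inverse (Q ^ N), Q * TB, Q * TC] Q j) * Q ^ j)"
    unfolding qRacah_def E_params En basic_hyp_terminating[OF nonzero(1)] X_def Y_def by (simp only: mult.assoc)
  also have "\<dots> = (\<Sum>j\<le>n. ?pre * (qpoch (inverse (Q ^ n)) Q j * qpoch (TA * TB * Q ^ (n + 1)) Q j /
         (qpoch Q Q j * qpoch (Q * TB) Q j * qpoch (Q * TC) Q j) * Q ^ j *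
         (\<Prod>i<j. Q ^ N - Q ^ i * (Q ^ N * (X + Y)) + Q ^ (2 * i) * r) * (\<Prod>i=j..<n. Q ^ N - Q ^ i)))"
    unfolding pre sum_distrib_left
  proof (intro sum.cong refl)
    fix j assume "j \<in> {..n}"
    then have "j \<le> n" by simp
    show "(Q ^ N) ^ n * (Q * TA) ^ n * kappa_q Q ^ (2 * n) *
      (qpochs [inverse (Q ^ N), Q * TB, Q * TC] Q n / (kappa_q Q ^ (2 * n) * qpoch (TA * TB * Q ^ (n + 1)) Q n)) *
      (qpochs [inverse (Q ^ n), TA * TB * Q ^ (n + 1), X, Y] Q j /
        (qpoch Q Q j * qpochs [inverse (Q ^ N), Q * TB, Q * TC] Q j) * Q ^ j) =
      ?pre * (qpoch (inverse (Q ^ n)) Q j * qpoch (TA * TB * Q ^ (n + 1)) Q j /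
         (qpoch Q Q j * qpoch (Q * TB) Q j * qpoch (Q * TC) Q j) * Q ^ j *
         (\<Prod>i<j. Q ^ N - Q ^ i * (Q ^ N * (X + Y)) + Q ^ (2 * i) * r) * (\<Prod>i=j..<n. Q ^ N - Q ^ i))"
      using arith[OF *[OF \<open>j \<le> n\<close>], of "kappa_q Q ^ (2 * n)"]
      by (simp only: qpochs_def list.map prod_list.Cons prod_list.Nil mult_1_right mult.assoc power_not_zero
          kappa_q_nz simp_thms)
  qed
  finally show ?thesis
    unfolding scaled_poly_def sum_distrib_left X_def Y_def .
qed

end

context qracah_params
begin

lemma scaled_qRacah_norm2:
  "(C n)\<^sup>2 * qRacah_norm2 Q \<alpha> \<beta> a b n = scaled_norm2 Q TA TB TC n (Q ^ N)"
proof -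
  have "2 * (of_nat n * (of_nat N + (a + b)) / 2) = of_nat (N * n) + of_nat n * (a + b)"
    by (simp add: field_simps)
  then have "(E (of_nat n * (of_nat N + (a + b)) / 2))\<^sup>2 = (Q ^ N) ^ n * r ^ n"
    using E_power[of "of_nat n * (of_nat N + (a + b)) / 2" 2] E_add[of "of_nat (N * n)" "of_nat n * (a + b)"]
      E_power[of "a + b" n]
    by (simp only: of_nat_numeral E_of_nat powr_a_plus_b power_mult)
  then have "(C n)\<^sup>2 = (Q ^ N) ^ n * r ^ n * (Q * TA) ^ (2 * n) * kappa_q Q ^ (4 * n)"
    unfolding scaleC_eq by (simp add: power_mult_distrib power_mult[symmetric] mult_ac)
  then show ?thesis
    unfolding qRacah_norm2_def scaled_norm2_def qpochs_def E_params list.map prod_list.Cons prod_list.Nil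
      mult_1_right qpoch_inverse_power[OF nonzero(1), symmetric]
    by (simp add: mult_ac)
qed

text \<open>Separates a bracket into a half power and a rational function of \<open>q^x\<close>; in
  products of brackets the half powers can then be collected by adding exponents.\<close>

lemma qnum_eq: "qnum Q x = - (E (- x / 2) * (1 - E x) / kappa_q Q)"
proof -
  have "E (x / 2) = E (- x / 2) * E x"
    by (simp flip: E_add)
  then show ?thesis
    by (simp add: qnum_def kappa_q_def algebra_simps diff_divide_distrib)
qed

text \<open>Since \<open>mu - c3 = c1 (q^s + q^(-s-1))\<close>, multiplying by
  \<open>q^(a+1) / c1\<close> yields \<open>q^(a+s+1) + q^(a-s)\<close>. The rescaled lattice is
  thus \<open>q ta v\<close>, whose limit is the variable \<open>z\<close>.\<close>

lemma sigma_mu: "\<sigma> * (mu Q s - c3 Q) = Q * TA * (Q ^ N * (E (a - s) + E (a + s + 1)))"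
proof -
  define k where "k = kappa_q Q"
  have kn: "k \<noteq> 0" by (simp add: k_def)
  have e: "E (s / 2) * E ((s + 1) / 2) = E (1/2) * E s"
    "E (s / 2) * E (- (s + 1) / 2) = E (- 1/2)" "E (- s / 2) * E ((s + 1) / 2) = E (1/2)"
    "E (- s / 2) * E (- (s + 1) / 2) = E (1/2) * E (- s - 1)"
    unfolding E_add[symmetric] by (intro arg_cong[where f = E], simp add: field_simps)+
  have half: "E (1/2) = E (- 1/2) * Q"
    using E_add[of "-1/2" 1] by simp
  have "mu Q s * k\<^sup>2 = (E (s / 2) - E (- s / 2)) * (E ((s + 1) / 2) - E (- (s + 1) / 2))"
    using kn by (simp add: mu_def qnum_def k_def kappa_q_def power2_eq_square)
  also have "\<dots> = E (1/2) * E s + E (1/2) * E (- s - 1) - E (- 1/2) - E (1/2)"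
    unfolding left_diff_distrib right_diff_distrib e by simp
  finally have "mu Q s = (E (1/2) * (E s + E (- s - 1)) - E (-1/2) * (1 + Q)) / k\<^sup>2"
    using kn half by (simp add: field_simps)
  then have "mu Q s - c3 Q = c1 Q * (E s + E (- s - 1))"
    by (simp add: c1_def c3_def k_def diff_divide_distrib)
  moreover have "E (a + 1) * (E s + E (- s - 1)) = E (a - s) + E (a + s + 1)"
    by (simp add: distrib_left add_ac flip: E_add)
  moreover have "c1 Q \<noteq> 0" by (simp add: c1_def)
  ultimately show ?thesis by simp
qed

lemma E_brackets:
  "E (complex_of_real \<alpha> + complex_of_real \<beta> + of_nat n) = TA * TB * Q ^ n"
  "E (complex_of_real \<alpha> + complex_of_real \<beta> + 2 * of_nat n) = TA * TB * Q ^ (2 * n)"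
  "E (complex_of_real \<alpha> + complex_of_real \<beta> + 2 * of_nat n + 1) = TA * TB * Q ^ (2 * n + 1)"
  "E (complex_of_real \<alpha> + complex_of_real \<beta> + 2 * of_nat n + 2) = TA * TB * Q ^ (2 * n + 2)"
  "n > 0 \<Longrightarrow> E (complex_of_real \<alpha> + complex_of_real \<beta> + 2 * of_nat n - 1) = TA * TB * Q ^ (2 * n - 1)"
  "E (complex_of_real \<alpha> + of_nat n) = TA * Q ^ n" "E (complex_of_real \<beta> + of_nat n) = TB * Q ^ n"
  "E (complex_of_real \<beta> + of_nat n + 1) = TB * Q ^ (n + 1)"
  "E (a - b + of_nat n) = Q ^ n / (Q ^ N * Q)" "E (a - b + of_nat n + 1) = Q ^ n / Q ^ N"
  "E (a + b + complex_of_real \<alpha> + of_nat n) = TC * Q ^ n"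
  "E (a + b + complex_of_real \<alpha> + of_nat n + 1) = TC * Q ^ (n + 1)"
  "E (b - a + complex_of_real \<alpha> + complex_of_real \<beta> + of_nat n) = TA * TB * Q ^ (n + 1) * Q ^ N"
  "E (- a - b + complex_of_real \<beta> + of_nat n) = TA * TB / TC * Q ^ n"
proof -
  have two: "E (2 * of_nat n) = Q ^ (2 * n)" using E_of_nat[of "2 * n"] by simp
  show "E (complex_of_real \<alpha> + complex_of_real \<beta> + 2 * of_nat n) = TA * TB * Q ^ (2 * n)"
    "E (complex_of_real \<alpha> + complex_of_real \<beta> + 2 * of_nat n + 1) = TA * TB * Q ^ (2 * n + 1)"
    by (simp_all only: E_add two E_alpha E_beta) simp
  show "E (complex_of_real \<alpha> + complex_of_real \<beta> + 2 * of_nat n + 2) = TA * TB * Q ^ (2 * n + 2)"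
    using E_of_nat[of 2] by (simp only: E_add two E_alpha E_beta of_nat_numeral) (simp add: power2_eq_square)
  show "E (complex_of_real \<alpha> + complex_of_real \<beta> + 2 * of_nat n - 1) = TA * TB * Q ^ (2 * n - 1)" if "n > 0"
  proof -
    have "Q ^ (2 * n - 1) * Q = Q ^ (2 * n)" using that by (simp flip: power_Suc2)
    then show ?thesis by (simp only: E_diff E_add two E_alpha E_beta powr_to_1) (simp add: field_simps)
  qed
  have p: "a + b + complex_of_real \<alpha> + of_nat n = (a + b) + (complex_of_real \<alpha> + of_nat n)"
    "a + b + complex_of_real \<alpha> + of_nat n + 1 = (a + b) + (complex_of_real \<alpha> + of_nat n + 1)"
    "- a - b + complex_of_real \<beta> + of_nat n = complex_of_real \<beta> + of_nat n - (a + b)" by simp_all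
  show "E (a + b + complex_of_real \<alpha> + of_nat n) = TC * Q ^ n"
    "E (a + b + complex_of_real \<alpha> + of_nat n + 1) = TC * Q ^ (n + 1)"
    unfolding p(2) unfolding p(1) E_add[of "a + b"] powr_a_plus_b by (simp_all add: E_add E_alpha E_of_nat)
  show "E (- a - b + complex_of_real \<beta> + of_nat n) = TA * TB / TC * Q ^ n"
    unfolding p(3) E_diff powr_a_plus_b by (simp add: E_add E_beta E_of_nat)
  have d: "a - b + of_nat n = of_nat n - of_nat N - 1" "a - b + of_nat n + 1 = of_nat n - of_nat N"
    by (simp_all add: b_eq)
  show "E (a - b + of_nat n) = Q ^ n / (Q ^ N * Q)" "E (a - b + of_nat n + 1) = Q ^ n / Q ^ N"
    unfolding d by (simp_all add: E_diff E_of_nat)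
  show "E (b - a + complex_of_real \<alpha> + complex_of_real \<beta> + of_nat n) = TA * TB * Q ^ (n + 1) * Q ^ N"
    unfolding b_minus_a E_add E_of_nat E_alpha E_beta by simp
qed (simp_all add: E_add E_alpha E_beta E_of_nat)

lemma scaled_qRacah_beta:
  "\<sigma> * (qRacah_beta Q \<alpha> \<beta> a b n - c3 Q) = scaled_beta Q TA TB TC n (Q ^ N)"
proof -
  define h where "h x = E (- x / 2)" for x
  define k :: complex where "k = of_nat n"
  define al where "al = complex_of_real \<alpha>"
  define be where "be = complex_of_real \<beta>"
  define S where "S = E ((of_nat N + (a + b)) / 2)"
  have h_nz: "h x \<noteq> 0" for x by (simp add: h_def)
  \<comment> \<open>The half powers of the brackets, times the one in \<open>\<sigma>\<close>,
    collapse to integer powers: to \<open>q^N\<close> in this fraction, to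
    \<open>q^(a+b) = r\<close> in the next one.\<close>
  have "S * (h (al + be + k + 1) * h (a - b + k + 1) * h (be + k + 1) * h (a + b + al + k + 1)) =
    Q ^ N * (h (al + be + 2 * k + 1) * h (al + be + 2 * k + 2))"
    unfolding h_def S_def E_of_nat[symmetric] E_add[symmetric]
    by (rule arg_cong[where f = E]) (simp add: b_eq field_simps)
  note h1 = this
  have "S * (h (al + k) * h (b - a + al + be + k) * h (- a - b + be + k) * h k) =
    r * (h (al + be + 2 * k) * h (al + be + 2 * k + 1))"
    unfolding h_def S_def powr_a_plus_b[symmetric] E_add[symmetric]
    by (rule arg_cong[where f = E]) (simp add: b_eq field_simps)
  note h2 = this
  have br: "qnum Q x = - (h x * (1 - E x) / kappa_q Q)" for x by (simp add: qnum_eq h_def)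
  have sg: "\<sigma> = S * (Q * TA) * (kappa_q Q)\<^sup>2" unfolding sigma_eq S_def ..
  \<comment> \<open>For \<open>n = 0\<close> the two arguments coincide, so the quotient of half
    powers is 1 and may leave the conditional.\<close>
  have fac: "(if n = 0 then 1 else qnum Q (al + be + k + 1) / qnum Q (al + be + 2 * k + 1)) =
    h (al + be + k + 1) / h (al + be + 2 * k + 1) *
     (if n = 0 then 1 else (1 - E (al + be + k + 1)) / (1 - E (al + be + 2 * k + 1)))"
    using h_nz by (auto simp: k_def br)
  have arith1: "S * w * K\<^sup>2 * (x1 / y1 * F * (- (x2 * g2 / K) * - (x3 * g3 / K) * - (x4 * g4 / K) / - (y2 * g5 / K))) =
    T * w * F * (g2 * g3 * g4 / g5)"
    if "S * (x1 * x2 * x3 * x4) = T * (y1 * y2)" "y1 \<noteq> 0" "y2 \<noteq> 0" "K \<noteq> 0"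
    for S w K x1 x2 x3 x4 y1 y2 F g2 g3 g4 g5 T :: complex
  proof -
    have "S * w * K\<^sup>2 * (x1 / y1 * F * (- (x2 * g2 / K) * - (x3 * g3 / K) * - (x4 * g4 / K) / - (y2 * g5 / K)))
      = (S * (x1 * x2 * x3 * x4)) / (y1 * y2) * w * F * (g2 * g3 * g4 / g5)"
      using that(4) by (simp add: power2_eq_square mult_ac)
    then show ?thesis using that by simp
  qed
  have arith2: "S * w * K\<^sup>2 * (- (x1 * g1 / K) * - (x2 * g2 / K) * - (x3 * g3 / K) * - (x4 * g4 / K) / (- (y1 * g6 / K) * - (y2 * g5 / K))) =
    T * w * (g1 * g2 * g3 * g4 / (g6 * g5))"
    if "S * (x1 * x2 * x3 * x4) = T * (y1 * y2)" "y1 \<noteq> 0" "y2 \<noteq> 0" "K \<noteq> 0"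
    for S w K x1 x2 x3 x4 y1 y2 g1 g2 g3 g4 g5 g6 T :: complex
  proof -
    have "S * w * K\<^sup>2 * (- (x1 * g1 / K) * - (x2 * g2 / K) * - (x3 * g3 / K) * - (x4 * g4 / K) / (- (y1 * g6 / K) * - (y2 * g5 / K)))
      = (S * (x1 * x2 * x3 * x4)) / (y1 * y2) * w * (g1 * g2 * g3 * g4 / (g6 * g5))"
      using that(4) by (simp add: power2_eq_square mult_ac)
    then show ?thesis using that by simp
  qed
  have "\<sigma> * (qRacah_beta Q \<alpha> \<beta> a b n - c3 Q) = \<sigma> * (mu Q a - c3 Q)
    - \<sigma> * ((if n = 0 then 1 else qnum Q (al + be + k + 1) / qnum Q (al + be + 2 * k + 1)) *
        (qnum Q (a - b + k + 1) * qnum Q (be + k + 1) * qnum Q (a + b + al + k + 1) / qnum Q (al + be + 2 * k + 2)))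
    - \<sigma> * (qnum Q (al + k) * qnum Q (b - a + al + be + k) * qnum Q (- a - b + be + k) * qnum Q k /
        (qnum Q (al + be + 2 * k) * qnum Q (al + be + 2 * k + 1)))"
  proof -
    have "s * (X - Y - Z - d) = s * (X - d) - s * Y - s * Z" for s X Y Z d :: complex
      by (simp add: algebra_simps)
    then show ?thesis unfolding qRacah_beta_def Let_def mu_def al_def be_def k_def .
  qed
  \<comment> \<open>The first term of the coefficient is the lattice at \<open>s = a\<close>, the
    point that tends to \<open>z = q tc\<close>.\<close>
  also have "\<sigma> * (mu Q a - c3 Q) = Q * TA * Q ^ N + Q * TC"
  proof -
    have aa: "a + a + 1 = 2 * a + 1" by simp
    show ?thesis unfolding sigma_mu aa E_2a by (simp add: distrib_left)
  qed
  also have "\<sigma> * ((if n = 0 then 1 else qnum Q (al + be + k + 1) / qnum Q (al + be + 2 * k + 1)) *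
        (qnum Q (a - b + k + 1) * qnum Q (be + k + 1) * qnum Q (a + b + al + k + 1) / qnum Q (al + be + 2 * k + 2))) =
    Q ^ N * (Q * TA) * (if n = 0 then 1 else (1 - E (al + be + k + 1)) / (1 - E (al + be + 2 * k + 1))) *
     ((1 - E (a - b + k + 1)) * (1 - E (be + k + 1)) * (1 - E (a + b + al + k + 1)) / (1 - E (al + be + 2 * k + 2)))"
    unfolding fac unfolding sg br by (rule arith1[OF h1]) (simp_all add: h_nz)
  also have "\<sigma> * (qnum Q (al + k) * qnum Q (b - a + al + be + k) * qnum Q (- a - b + be + k) * qnum Q k /
        (qnum Q (al + be + 2 * k) * qnum Q (al + be + 2 * k + 1))) =
     r * (Q * TA) * ((1 - E (al + k)) * (1 - E (b - a + al + be + k)) * (1 - E (- a - b + be + k)) * (1 - E k) /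
        ((1 - E (al + be + 2 * k)) * (1 - E (al + be + 2 * k + 1))))"
    unfolding sg br by (rule arith2[OF h2]) (simp_all add: h_nz)
  also have "r * (Q * TA) = Q * TC" by simp
  also have "Q ^ N * (Q * TA) * (if n = 0 then 1 else (1 - E (al + be + k + 1)) / (1 - E (al + be + 2 * k + 1))) *
     ((1 - E (a - b + k + 1)) * (1 - E (be + k + 1)) * (1 - E (a + b + al + k + 1)) / (1 - E (al + be + 2 * k + 2))) =
    (if n = 0 then 1 else (1 - E (al + be + k + 1)) / (1 - E (al + be + 2 * k + 1))) *
     (Q * TA * (Q ^ N * (1 - E (a - b + k + 1))) * (1 - E (be + k + 1)) * (1 - E (a + b + al + k + 1)) / (1 - E (al + be + 2 * k + 2)))"
    by (simp only: mult_ac times_divide_eq_left times_divide_eq_right)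
  also have "Q ^ N * (1 - E (a - b + k + 1)) = Q ^ N - Q ^ n"
    unfolding k_def E_brackets by (simp add: right_diff_distrib)
  finally show ?thesis
    unfolding scaled_beta_def k_def al_def be_def E_brackets E_params E_of_nat by (simp only: mult.assoc)
qed

lemma scaled_qRacah_gamma:
  assumes "n > 0"
  shows "\<sigma>\<^sup>2 * qRacah_gamma Q \<alpha> \<beta> a b n = scaled_gamma Q TA TB TC n (Q ^ N)"
proof -
  define h where "h x = E (- x / 2)" for x
  define k :: complex where "k = of_nat n"
  define al where "al = complex_of_real \<alpha>"
  define be where "be = complex_of_real \<beta>"
  define S where "S = E ((of_nat N + (a + b)) / 2)"
  have h_nz: "h x \<noteq> 0" for x by (simp add: h_def)
  have S2: "S\<^sup>2 = Q ^ N * r"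
    unfolding power2_eq_square S_def E_of_nat[symmetric] powr_a_plus_b[symmetric] E_add[symmetric]
    by (rule arg_cong[where f = E]) (simp add: field_simps)
  \<comment> \<open>Here the half powers of the brackets cancel completely; only the square of
    \<open>S\<close> is left.\<close>
  have "h (al + be + k) * (h k * h (al + k) * h (be + k) * h (b - a + al + be + k) * h (- a - b + be + k) *
      h (a - b + k) * h (a + b + al + k)) =
    h (al + be + 2 * k - 1) * (h (al + be + 2 * k) * h (al + be + 2 * k) * h (al + be + 2 * k + 1))"
    unfolding h_def E_add[symmetric]
    by (rule arg_cong[where f = E]) (simp add: field_simps)
  note h1 = this
  have br: "qnum Q x = - (h x * (1 - E x) / kappa_q Q)" for x by (simp add: qnum_eq h_def)
  have sg: "\<sigma> = S * (Q * TA) * (kappa_q Q)\<^sup>2" unfolding sigma_eq S_def ..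
  have fac: "(if n = 1 then 1 else qnum Q (al + be + k) / qnum Q (al + be + 2 * k - 1)) =
    h (al + be + k) / h (al + be + 2 * k - 1) *
     (if n = 1 then 1 else (1 - E (al + be + k)) / (1 - E (al + be + 2 * k - 1)))"
    using h_nz by (auto simp: k_def br add_ac)
  have arith: "(S * w * K\<^sup>2)\<^sup>2 * (x0 / y0 * F * (- (x1 * g1 / K) * - (x2 * g2 / K) * - (x3 * g3 / K) * - (x4 * g4 / K) *
      - (x5 * g5 / K) * - (x6 * g6 / K) * - (x7 * g7 / K) / ((- (y1 * f1 / K))\<^sup>2 * - (y2 * f2 / K)))) =
    S\<^sup>2 * w\<^sup>2 * F * (g1 * g2 * g3 * g4 * g5 * g6 * g7 / (f1\<^sup>2 * f2))"
    if "x0 * (x1 * x2 * x3 * x4 * x5 * x6 * x7) = y0 * (y1 * y1 * y2)" "y0 \<noteq> 0" "y1 \<noteq> 0" "y2 \<noteq> 0" "K \<noteq> 0"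
    for S w K x0 x1 x2 x3 x4 x5 x6 x7 y0 y1 y2 F g1 g2 g3 g4 g5 g6 g7 f1 f2 :: complex
  proof -
    have "(S * w * K\<^sup>2)\<^sup>2 * (x0 / y0 * F * (- (x1 * g1 / K) * - (x2 * g2 / K) * - (x3 * g3 / K) * - (x4 * g4 / K) *
      - (x5 * g5 / K) * - (x6 * g6 / K) * - (x7 * g7 / K) / ((- (y1 * f1 / K))\<^sup>2 * - (y2 * f2 / K))))
      = (x0 * (x1 * x2 * x3 * x4 * x5 * x6 * x7)) / (y0 * (y1 * y1 * y2)) *
       (S\<^sup>2 * w\<^sup>2 * F * (g1 * g2 * g3 * g4 * g5 * g6 * g7 / (f1\<^sup>2 * f2)))"
      using that(5) by (simp add: power2_eq_square mult_ac)
    then show ?thesis using that by simp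
  qed
  have "\<sigma>\<^sup>2 * qRacah_gamma Q \<alpha> \<beta> a b n =
    S\<^sup>2 * (Q * TA)\<^sup>2 * (if n = 1 then 1 else (1 - E (al + be + k)) / (1 - E (al + be + 2 * k - 1))) *
     ((1 - E k) * (1 - E (al + k)) * (1 - E (be + k)) * (1 - E (b - a + al + be + k)) * (1 - E (- a - b + be + k)) *
      (1 - E (a - b + k)) * (1 - E (a + b + al + k)) / ((1 - E (al + be + 2 * k))\<^sup>2 * (1 - E (al + be + 2 * k + 1))))"
    unfolding qRacah_gamma_def Let_def al_def[symmetric] be_def[symmetric] k_def[symmetric]
    unfolding fac unfolding sg br
    by (rule arith[OF h1]) (simp_all add: h_nz)
  also have "\<dots> = Q * TA * TC * (Q * (Q ^ N * (1 - E (a - b + k)))) * (if n = 1 then 1 else (1 - E (al + be + k)) / (1 - E (al + be + 2 * k - 1))) *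
     ((1 - E k) * (1 - E (al + k)) * (1 - E (be + k)) * (1 - E (a + b + al + k)) * (1 - E (- a - b + be + k)) *
      (1 - E (b - a + al + be + k)) / ((1 - E (al + be + 2 * k))\<^sup>2 * (1 - E (al + be + 2 * k + 1))))"
    unfolding S2 by (simp add: power2_eq_square)
  also have "Q * (Q ^ N * (1 - E (a - b + k))) = Q ^ N * Q - Q ^ n"
    unfolding k_def E_brackets by (simp add: right_diff_distrib)
  finally show ?thesis
    unfolding scaled_gamma_def k_def al_def be_def E_brackets(1-4,6-) E_brackets(5)[OF assms] E_of_nat .
qed

end

section \<open>The weight\<close>

text \<open>Reads the product backwards and takes \<open>- x / q^(i+1)\<close> out of each factor,
  which trades divergent factors for those of a convergent product.\<close>

lemma qpoch_reverse:
  assumes "q \<noteq> 0" "x \<noteq> 0"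
  shows "qpoch (x / q ^ k) q k = (\<Prod>i<k. - x / q ^ Suc i) * qpoch (q / x) q k"
proof (induction k)
  case (Suc k)
  have "qpoch (x / q ^ Suc k) q (Suc k) = (1 - x / q ^ Suc k) * qpoch (x / q ^ k) q k"
    using qpoch_add[of "x / q ^ Suc k" q 1 k] assms by (simp add: qpoch_Suc)
  also have "1 - x / q ^ Suc k = - x / q ^ Suc k * (1 - q / x * q ^ k)"
    using assms by (simp add: field_simps)
  finally show ?case using Suc by (simp add: qpoch_Suc)
qed simp

context qparams
begin

text \<open>The weight is separated by what a factor depends on: the distance \<open>s\<close> to
  the left end, the distance \<open>N - s\<close> to the right end, or \<open>N\<close> alone. Each
  of the three sequences converges, so near one end the factor of the other end may be replaced by
  its limit.\<close>

definition weight_left :: "nat \<Rightarrow> complex" where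
  "weight_left s = qpoch_inf (Q * Q ^ s) Q * qpoch_inf (r * Q * Q ^ s) Q /
     (qpoch_inf (Q * TB * Q ^ s) Q * qpoch_inf (Q * TC * Q ^ s) Q)"

definition weight_right :: "nat \<Rightarrow> complex" where
  "weight_right k = qpoch (Q * TB / r) Q k / qpoch (Q / r) Q k *
     (qpoch_inf (Q * Q ^ k) Q / qpoch_inf (Q * TA * Q ^ k) Q)"

definition weight_const :: "nat \<Rightarrow> complex" where
  "weight_const N = qpoch_inf (Q * TA) Q * qpoch_inf (Q * TB) Q * qpoch_inf (Q * TC) Q /
     (qpoch_inf r Q * qpoch_inf Q Q * qpoch_inf (TA * TB * Q\<^sup>2) Q) *
     (qpoch_inf (TA * TB * Q\<^sup>2 * Q ^ N) Q / qpoch_inf (Q * Q ^ N) Q)"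

lemma one_minus_Q: "1 - Q \<noteq> 0"
  using q_less_1 by (metis less_irrefl of_real_eq_1_iff right_minus_eq)

lemma qpoch_inf_nz [simp]:
  "qpoch_inf Q Q \<noteq> 0" "qpoch_inf (Q * TA) Q \<noteq> 0" "qpoch_inf (Q * TB) Q \<noteq> 0" "qpoch_inf (Q * TC) Q \<noteq> 0"
  "qpoch_inf (TA * TB * Q\<^sup>2) Q \<noteq> 0" "qpoch_inf r Q \<noteq> 0" "qpoch_inf (r / TB) Q \<noteq> 0" "qpoch_inf (Q / r) Q \<noteq> 0"
proof -
  show "qpoch_inf (Q * TC) Q \<noteq> 0"
    using neq_1(6)[of "Suc i" for i] by (intro qpoch_inf_nonzero norm_Q) (simp add: mult_ac)
  show "qpoch_inf (Q / r) Q \<noteq> 0"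
    using neq_1(9)[of "Suc i" for i] by (intro qpoch_inf_nonzero norm_Q) (simp add: mult_ac)
  show "qpoch_inf (TA * TB * Q\<^sup>2) Q \<noteq> 0"
    using neq_1(1)[of 0] by (intro qpoch_inf_nonzero norm_Q) (simp add: mult_ac power2_eq_square)
qed (intro qpoch_inf_nonzero norm_Q neq_1)+

lemma weight_left_tendsto: "weight_left \<longlonglongrightarrow> 1"
proof -
  have "weight_left \<longlonglongrightarrow> 1 * 1 / (1 * 1)"
    unfolding weight_left_def by (intro tendsto_intros qpoch_inf_shift_tendsto norm_Q) simp_all
  then show ?thesis by simp
qed

lemma weight_right_tendsto: "weight_right \<longlonglongrightarrow> qpoch_inf (Q * TB / r) Q / qpoch_inf (Q / r) Q"
proof -
  have "weight_right \<longlonglongrightarrow> qpoch_inf (Q * TB / r) Q / qpoch_inf (Q / r) Q * (1 / 1)"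
    unfolding weight_right_def
    by (intro tendsto_intros qpoch_tendsto qpoch_inf_shift_tendsto norm_Q qpoch_inf_nz(8)) simp_all
  then show ?thesis by simp
qed

lemma weight_const_tendsto: "weight_const \<longlonglongrightarrow>
  qpoch_inf (Q * TA) Q * qpoch_inf (Q * TB) Q * qpoch_inf (Q * TC) Q /
     (qpoch_inf r Q * qpoch_inf Q Q * qpoch_inf (TA * TB * Q\<^sup>2) Q)" (is "_ \<longlonglongrightarrow> ?c")
proof -
  have "weight_const \<longlonglongrightarrow> ?c * (1 / 1)"
    unfolding weight_const_def
    by (intro tendsto_mult[OF tendsto_const] tendsto_divide qpoch_inf_shift_tendsto norm_Q) simp_all
  then show ?thesis by simp
qed

text \<open>At fixed \<open>s\<close> the factor \<open>q^(N-s) - r q^s\<close> tends to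
  \<open>- r q^s\<close> and \<open>weight_right (N - s)\<close> to its limit; the right-hand side
  is the resulting limit weight. Near the right end the roles are exchanged, and the limit of
  \<open>weight_left\<close> is 1.\<close>

lemma bigqJ_weight_left:
  "(1 - Q) * (- TC) * (bigqJ_weight Q TA TB TC (TC * Q ^ (s + 1)) * Q ^ (s + 1)) =
    - r * Q ^ s * weight_left s * (lim weight_right * lim weight_const)"
proof -
  have arith: "w * (- t) * (u1 * u2 / (v1 * v2) * (a1 * (a2 * (a3 * a4)) / (y * x * w * (b1 * (b2 * (b3 * b4))))) * (y * z)) =
      - (t / x) * z * (u2 * u1 / (v2 * v1)) * (a4 / b4 * (a1 * a2 * a3 / (b3 * b1 * b2)))"
    if "w \<noteq> 0" "y \<noteq> 0" for w t u1 u2 v1 v2 a1 a2 a3 a4 b1 b2 b3 b4 x y z :: complex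
  proof -
    have "w * (- t) * (u / v * (a / (y * x * w * b)) * (y * z)) = - (t / x) * z * (u / v) * (a / b)" for u v a b
      using that by (simp add: mult_ac)
    moreover have "a1 * (a2 * (a3 * a4)) / (b1 * (b2 * (b3 * b4))) = a4 / b4 * (a1 * a2 * a3 / (b3 * b1 * b2))"
      by (simp add: mult_ac)
    ultimately show ?thesis by (simp only: mult.assoc mult.commute[of u1 u2] mult.commute[of v1 v2])
  qed
  have args: "TA * TB / TC * Q = Q * TB / r" "TA / TC * Q = Q / r" "TC * Q ^ (s + 1) / TA = r * Q * Q ^ s"
    "TC * Q ^ (s + 1) / TC = Q * Q ^ s" "TB / TC * (TC * Q ^ (s + 1)) = Q * TB * Q ^ s"
    "TC * Q ^ (s + 1) = Q * TC * Q ^ s" "TA * Q = Q * TA" "TB * Q = Q * TB" "TC * Q = Q * TC" "Q ^ (s + 1) = Q * Q ^ s"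
    by simp_all
  show ?thesis
    unfolding limI[OF weight_right_tendsto] limI[OF weight_const_tendsto] bigqJ_weight_def weight_left_def
      qpochs_inf_def list.map prod_list.Cons prod_list.Nil mult_1_right args(1-5)
    unfolding args(6-9)
    unfolding args(10)
    by (rule arith[OF one_minus_Q nonzero(1)])
qed

lemma bigqJ_weight_right:
  "(1 - Q) * TA * (bigqJ_weight Q TA TB TC (TA * Q ^ (s + 1)) * Q ^ (s + 1)) =
    Q ^ s * weight_right s * lim weight_const"
proof -
  have arith: "w * x * (u1 * u2 / (v1 * e4) * (a1 * (a2 * (a3 * (c4 * e4))) / (y * x * w * (b1 * (b2 * (b3 * (d4 * u2)))))) * (y * z)) =
      z * (c4 / d4 * (u1 / v1)) * (a1 * a2 * a3 / (b3 * b1 * b2))"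
    if "w \<noteq> 0" "y \<noteq> 0" "x \<noteq> 0" "e4 \<noteq> 0" "u2 \<noteq> 0"
    for w u1 u2 v1 a1 a2 a3 b1 b2 b3 c4 e4 d4 x y z :: complex
  proof -
    have "w * x * (u1 * u2 / (v1 * e4) * (a / (y * x * w * b)) * (y * z)) = z * (u1 / v1) * (u2 / e4) * (a / b)" for a b
      using that by (simp add: mult_ac)
    moreover have "a1 * (a2 * (a3 * (c4 * e4))) / (b1 * (b2 * (b3 * (d4 * u2)))) =
      c4 / d4 * (a1 * a2 * a3 / (b3 * b1 * b2)) * (e4 / u2)"
      by (simp add: mult_ac)
    ultimately show ?thesis using that by (simp add: mult_ac)
  qed
  have args: "TA * TB / TC * Q = Q * TB / r" "TA / TC * Q = Q / r" "TA * Q ^ (s + 1) / TC = Q / r * Q ^ s"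
    "TA * Q ^ (s + 1) / TA = Q * Q ^ s" "TB / TC * (TA * Q ^ (s + 1)) = Q * TB / r * Q ^ s"
    "TA * Q ^ (s + 1) = Q * TA * Q ^ s" "TA * Q = Q * TA" "TB * Q = Q * TB" "TC * Q = Q * TC" "Q ^ (s + 1) = Q * Q ^ s"
    by simp_all
  \<comment> \<open>The constants of the big \<open>q\<close>-Jacobi weight contain these full
    products, while its variable part contains their tails. Splitting off \<open>s\<close> factors
    lets the tails cancel and leaves the finite quotient in \<open>weight_right\<close>.\<close>
  have split: "qpoch_inf (Q * TB / r) Q = qpoch (Q * TB / r) Q s * qpoch_inf (Q * TB / r * Q ^ s) Q"
    "qpoch_inf (Q / r) Q = qpoch (Q / r) Q s * qpoch_inf (Q / r * Q ^ s) Q"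
    by (rule qpoch_inf_split[OF norm_Q])+
  have nz: "qpoch_inf (Q * TB / r * Q ^ s) Q \<noteq> 0" "qpoch_inf (Q / r * Q ^ s) Q \<noteq> 0"
    using neq_1(8)[of "Suc s + i" for i] neq_1(9)[of "Suc s + i" for i]
    by (intro qpoch_inf_nonzero norm_Q; simp add: power_add mult_ac)+
  show ?thesis
    unfolding limI[OF weight_const_tendsto] bigqJ_weight_def weight_right_def
      qpochs_inf_def list.map prod_list.Cons prod_list.Nil mult_1_right args(1-5) split
    unfolding args(6-9)
    unfolding args(10)
    by (rule arith[OF one_minus_Q nonzero(1) nonzero(2) nz])
qed

end

context qracah_params
begin

text \<open>The exponent is what the quadratic exponents of the Gamma functions leave over. Together
  with the half power of the bracket it becomes an integer power, and the bracket's own two terms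
  give \<open>q^(N-s)\<close> and \<open>r q^s\<close>.\<close>

lemma prefactor_weight:
  assumes "s \<le> N"
  shows "E (complex_of_real \<beta> * (of_nat N - of_nat s) + (of_nat N + 1) / 2 + (a + b) / 2 - 1) * (1 - Q) *
    qnum Q (2 * of_nat s + 2 * a + 1) = TB ^ (N - s) * (Q ^ (N - s) - r * Q ^ s)"
proof -
  define D where "D = E (- 1 / 2)"
  have Dk: "kappa_q Q = D * (Q - 1)"
    using E_add[of "-1/2" 1] by (simp add: D_def kappa_q_def algebra_simps)
  have "D \<noteq> 0" by (simp add: D_def)
  have "E (2 * of_nat s + 2 * a + 1) = E (of_nat (2 * s)) * E (2 * a + 1)"
    unfolding E_add[symmetric] by (simp add: add_ac)
  then have e: "E (2 * of_nat s + 2 * a + 1) = Q ^ (2 * s) * (r / Q ^ N)"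
    unfolding E_of_nat E_2a .
  have "E (complex_of_real \<beta> * (of_nat N - of_nat s) + (of_nat N + 1) / 2 + (a + b) / 2 - 1) *
      E (- (2 * of_nat s + 2 * a + 1) / 2) = E (of_nat (N - s) * complex_of_real \<beta>) * E (of_nat (N - s)) * D"
    unfolding D_def E_add[symmetric]
    by (rule arg_cong[where f = E]) (simp add: b_eq of_nat_diff[OF assms] field_simps)
  also have "\<dots> = TB ^ (N - s) * Q ^ (N - s) * D"
    by (simp only: E_power[symmetric] E_beta E_of_nat)
  finally have "E (complex_of_real \<beta> * (of_nat N - of_nat s) + (of_nat N + 1) / 2 + (a + b) / 2 - 1) * (1 - Q) *
    qnum Q (2 * of_nat s + 2 * a + 1) = - (TB ^ (N - s) * Q ^ (N - s) * D) * (1 - Q) * (1 - Q ^ (2 * s) * (r / Q ^ N)) / (D * (Q - 1))"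
    unfolding qnum_eq e Dk by (simp add: mult_ac)
  also have "\<dots> = TB ^ (N - s) * (Q ^ (N - s) * (1 - Q ^ (2 * s) * (r / Q ^ N)))"
    using \<open>D \<noteq> 0\<close> one_minus_Q by (simp add: field_simps)
  also have "Q ^ (N - s) * (1 - Q ^ (2 * s) * (r / Q ^ N)) = Q ^ (N - s) - r * Q ^ s"
  proof -
    have "Q ^ N = Q ^ (N - s) * Q ^ s" using assms by (simp flip: power_add)
    then show ?thesis by (simp add: right_diff_distrib mult_2 power_add)
  qed
  finally show ?thesis .
qed

lemma weight_eq:
  assumes "s \<le> N"
  shows "qRacah_weight Q \<alpha> \<beta> a b (of_nat s + a) * qnum Q (2 * of_nat s + 2 * a + 1) =
    (Q ^ (N - s) - r * Q ^ s) * weight_left s * weight_right (N - s) * weight_const N"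
proof -
  define k where "k = N - s"
  define e where "e x = E (- ((x - 1) * (x - 2) / 4))" for x
  define f where "f x = (1 - Q) powr (1 - x)" for x
  define p where "p x = qpoch_inf (E x) Q" for x
  define c where "c = qpoch_inf Q Q"
  have c: "c \<noteq> 0" by (simp add: c_def)
  have G: "qGamma_tilde Q x = e x * f x * (c / p x)" for x
    by (simp add: qGamma_tilde_def e_def f_def c_def p_def)
  define x1 x2 x3 x4 x5 x6 x7 where x:
    "x1 = of_nat s + a + a + 1" "x2 = of_nat s + a - a + complex_of_real \<beta> + 1"
    "x3 = of_nat s + a + complex_of_real \<alpha> + b + 1" "x4 = b + complex_of_real \<alpha> - (of_nat s + a)"
    "x5 = complex_of_real \<alpha> + complex_of_real \<beta> + 2" "x6 = b - a" "x7 = a + b - complex_of_real \<beta>"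
  define y1 y2 y3 y4 y5 y6 y7 y8 where y:
    "y1 = of_nat s + a - a + 1" "y2 = of_nat s + a + b + 1" "y3 = of_nat s + a + a - complex_of_real \<beta> + 1"
    "y4 = b - (of_nat s + a)" "y5 = complex_of_real \<alpha> + 1" "y6 = complex_of_real \<beta> + 1"
    "y7 = b - a + complex_of_real \<alpha> + complex_of_real \<beta> + 1" "y8 = a + b + complex_of_real \<alpha> + 1"
  define M where "M = E (complex_of_real \<beta> * (of_nat N - of_nat s) + (of_nat N + 1) / 2 + (a + b) / 2 - 1)"
  \<comment> \<open>The squares of \<open>s\<close> and of the parameters cancel between numerator
    and denominator, leaving the exponent of \<open>M\<close>.\<close>
  have e_eq: "e x1 * e x2 * e x3 * e x4 * e x5 * e x6 * e x7 =
    M * (e y1 * e y2 * e y3 * e y4 * e y5 * e y6 * e y7 * e y8)"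
    unfolding e_def M_def E_add[symmetric]
    by (rule arg_cong[where f = E]) (simp add: x y b_eq field_simps)
  have f_eq: "f x1 * f x2 * f x3 * f x4 * f x5 * f x6 * f x7 =
    (1 - Q) * (f y1 * f y2 * f y3 * f y4 * f y5 * f y6 * f y7 * f y8)"
  proof -
    have p1: "(1 - Q) * (1 - Q) powr z = (1 - Q) powr (1 + z)" for z by (simp add: powr_add)
    show ?thesis
      unfolding f_def powr_add[symmetric] p1
      by (rule arg_cong[where f = "\<lambda>z. (1 - Q) powr z"]) (simp add: x y b_eq field_simps)
  qed
  have nz: "e z \<noteq> 0" "f z \<noteq> 0" for z
    using q_less_1 by (auto simp: e_def f_def powr_def)
  have arith: "(e1 * f1 * (c / p1) * (e2 * f2 * (c / p2)) * (e3 * f3 * (c / p3)) * (e4 * f4 * (c / p4)) *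
      (e5 * f5 * (c / p5)) * (e6 * f6 * (c / p6)) * (e7 * f7 * (c / p7))) /
     (d1 * g1 * (c / o1) * (d2 * g2 * (c / o2)) * (d3 * g3 * (c / o3)) * (d4 * g4 * (c / o4)) *
      (d5 * g5 * (c / o5)) * (d6 * g6 * (c / o6)) * (d7 * g7 * (c / o7)) * (d8 * g8 * (c / o8))) =
     M * (1 - Q) * ((o1 * o2 * o3 * o4 * o5 * o6 * o7 * o8) / (c * (p1 * p2 * p3 * p4 * p5 * p6 * p7)))"
    if "e1 * e2 * e3 * e4 * e5 * e6 * e7 = M * (d1 * d2 * d3 * d4 * d5 * d6 * d7 * d8)"
      "f1 * f2 * f3 * f4 * f5 * f6 * f7 = (1 - Q) * (g1 * g2 * g3 * g4 * g5 * g6 * g7 * g8)"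
      "d1 * d2 * d3 * d4 * d5 * d6 * d7 * d8 \<noteq> 0" "g1 * g2 * g3 * g4 * g5 * g6 * g7 * g8 \<noteq> 0"
    for e1 e2 e3 e4 e5 e6 e7 f1 f2 f3 f4 f5 f6 f7 p1 p2 p3 p4 p5 p6 p7
      d1 d2 d3 d4 d5 d6 d7 d8 g1 g2 g3 g4 g5 g6 g7 g8 o1 o2 o3 o4 o5 o6 o7 o8 :: complex
  proof -
    have "(e1 * f1 * (c / p1) * (e2 * f2 * (c / p2)) * (e3 * f3 * (c / p3)) * (e4 * f4 * (c / p4)) *
        (e5 * f5 * (c / p5)) * (e6 * f6 * (c / p6)) * (e7 * f7 * (c / p7))) =
      (e1 * e2 * e3 * e4 * e5 * e6 * e7) * (f1 * f2 * f3 * f4 * f5 * f6 * f7) * (c ^ 7 / (p1 * p2 * p3 * p4 * p5 * p6 * p7))"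
      by (simp add: mult_ac eval_nat_numeral)
    moreover have "(d1 * g1 * (c / o1) * (d2 * g2 * (c / o2)) * (d3 * g3 * (c / o3)) * (d4 * g4 * (c / o4)) *
        (d5 * g5 * (c / o5)) * (d6 * g6 * (c / o6)) * (d7 * g7 * (c / o7)) * (d8 * g8 * (c / o8))) =
      (d1 * d2 * d3 * d4 * d5 * d6 * d7 * d8) * (g1 * g2 * g3 * g4 * g5 * g6 * g7 * g8) *
        (c ^ 8 / (o1 * o2 * o3 * o4 * o5 * o6 * o7 * o8))"
      by (simp add: mult_ac eval_nat_numeral)
    moreover have "M * d * (w * g) * (c ^ 7 / p) / (d * g * (c ^ 8 / u)) = M * w * (u / (c * p))"
      if "d \<noteq> 0" "g \<noteq> 0" for w d g p u
    proof -
      have "c ^ 8 = c ^ 7 * c" by (simp flip: power_Suc2)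
      then show ?thesis using that c by (simp add: mult_ac)
    qed
    ultimately show ?thesis unfolding that(1,2) using that(3,4) by presburger
  qed
  have W: "qRacah_weight Q \<alpha> \<beta> a b (of_nat s + a) = M * (1 - Q) *
    ((p y1 * p y2 * p y3 * p y4 * p y5 * p y6 * p y7 * p y8) / (c * (p x1 * p x2 * p x3 * p x4 * p x5 * p x6 * p x7)))"
    unfolding qRacah_weight_def Let_def y[symmetric]
    unfolding x[symmetric] G
    by (rule arith[OF e_eq f_eq]) (simp_all add: nz)
  have Ns: "Q ^ N = Q ^ k * Q ^ s" using assms by (simp add: k_def flip: power_add)
  have px: "p x1 = qpoch_inf (r / Q ^ k) Q" "p x2 = qpoch_inf (Q * TB * Q ^ s) Q" "p x3 = qpoch_inf (Q * TC * Q ^ s) Q"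
    "p x4 = qpoch_inf (Q * TA * Q ^ k) Q" "p x5 = qpoch_inf (TA * TB * Q\<^sup>2) Q" "p x6 = qpoch_inf (Q * Q ^ N) Q"
    "p x7 = qpoch_inf (r / TB) Q"
    and py: "p y1 = qpoch_inf (Q * Q ^ s) Q" "p y2 = qpoch_inf (r * Q * Q ^ s) Q"
    "p y3 = qpoch_inf (r / TB / Q ^ k) Q" "p y4 = qpoch_inf (Q * Q ^ k) Q" "p y5 = qpoch_inf (Q * TA) Q"
    "p y6 = qpoch_inf (Q * TB) Q" "p y7 = qpoch_inf (TA * TB * Q\<^sup>2 * Q ^ N) Q" "p y8 = qpoch_inf (Q * TC) Q"
  proof -
    have 1: "x1 = of_nat s + (2 * a + 1)" "x2 = complex_of_real \<beta> + (of_nat s + 1)"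
      "x3 = (a + b) + (of_nat s + complex_of_real \<alpha> + 1)" "x4 = of_nat k + complex_of_real \<alpha> + 1"
      "x6 = of_nat (Suc N)" "x7 = (a + b) - complex_of_real \<beta>" "y1 = of_nat (Suc s)"
      "y2 = (a + b) + of_nat (Suc s)" "y3 = of_nat s + (2 * a + 1) - complex_of_real \<beta>" "y4 = of_nat (Suc k)"
      using assms by (simp_all add: x y b_eq k_def of_nat_diff)
    show "p x1 = qpoch_inf (r / Q ^ k) Q" "p y3 = qpoch_inf (r / TB / Q ^ k) Q"
      unfolding p_def 1 E_diff E_add[of "of_nat s" "2 * a + 1"] E_2a E_of_nat E_beta Ns by (simp_all add: mult_ac)
    show "p x3 = qpoch_inf (Q * TC * Q ^ s) Q" "p x7 = qpoch_inf (r / TB) Q" "p y2 = qpoch_inf (r * Q * Q ^ s) Q"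
      unfolding p_def 1 E_diff E_add[of "a + b"] powr_a_plus_b
      by (simp_all add: E_add E_of_nat E_alpha E_beta mult_ac del: of_nat_Suc)
    show "p x2 = qpoch_inf (Q * TB * Q ^ s) Q" "p x4 = qpoch_inf (Q * TA * Q ^ k) Q" "p x6 = qpoch_inf (Q * Q ^ N) Q"
      "p y1 = qpoch_inf (Q * Q ^ s) Q" "p y4 = qpoch_inf (Q * Q ^ k) Q"
      unfolding p_def 1 by (simp_all add: E_add E_of_nat E_alpha E_beta mult_ac del: of_nat_Suc)
  qed (simp_all add: p_def x y E_params)
  \<comment> \<open>Both products with \<open>q^-k\<close> are reversed; the powers pulled out
    differ by \<open>TB ^ k\<close>, exactly the factor supplied by
    \<open>prefactor_weight\<close>.\<close>
  have R: "TB ^ k * (qpoch_inf (r / TB / Q ^ k) Q / (qpoch_inf (r / Q ^ k) Q * qpoch_inf (r / TB) Q)) =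
    qpoch (Q * TB / r) Q k / qpoch (Q / r) Q k / qpoch_inf r Q"
  proof -
    have "(\<Prod>i<k. - r / Q ^ Suc i) = TB ^ k * (\<Prod>i<k. - (r / TB) / Q ^ Suc i)"
      by (induction k) simp_all
    moreover have "(\<Prod>i<k. - (r / TB) / Q ^ Suc i) \<noteq> 0" by simp
    moreover have "Q / (r / TB) = Q * TB / r" by simp
    ultimately show ?thesis
      unfolding qpoch_inf_split[OF norm_Q, of "r / TB / Q ^ k" k] qpoch_inf_split[OF norm_Q, of "r / Q ^ k" k]
      using qpoch_reverse[of Q "r / TB" k] qpoch_reverse[of Q r k] qpoch_inf_nz(7) by (simp add: mult_ac)
  qed
  have "qRacah_weight Q \<alpha> \<beta> a b (of_nat s + a) * qnum Q (2 * of_nat s + 2 * a + 1) =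
    (M * (1 - Q) * qnum Q (2 * of_nat s + 2 * a + 1)) *
    ((p y1 * p y2 * p y3 * p y4 * p y5 * p y6 * p y7 * p y8) / (c * (p x1 * p x2 * p x3 * p x4 * p x5 * p x6 * p x7)))"
    unfolding W by (simp only: mult_ac)
  also have "\<dots> = (Q ^ k - r * Q ^ s) * (TB ^ k * (p y3 / (p x1 * p x7))) *
    ((p y1 * p y2 * p y4 * p y5 * p y6 * p y7 * p y8) / (c * (p x2 * p x3 * p x4 * p x5 * p x6)))"
    unfolding M_def prefactor_weight[OF assms] k_def by (simp add: mult_ac)
  also have "\<dots> = (Q ^ k - r * Q ^ s) * weight_left s * weight_right k * weight_const N"
    unfolding px py R weight_left_def weight_right_def weight_const_def c_def by (simp add: mult_ac)
  finally show ?thesis by (simp add: k_def)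
qed

end

section \<open>The limit\<close>

lemma tannery_sum:
  fixes f :: "nat \<Rightarrow> nat \<Rightarrow> complex"
  assumes lim: "\<And>s. (\<lambda>N. f N s) \<longlonglongrightarrow> g s"
    and bound: "\<forall>\<^sub>F N in sequentially. \<forall>s\<le>N. norm (f N s) \<le> K s"
    and K: "summable K" "\<And>s. 0 \<le> K s"
  shows "summable g" and "(\<lambda>N. \<Sum>s\<le>N. f N s) \<longlonglongrightarrow> suminf g"
proof -
  \<comment> \<open>Extension by zero beyond \<open>N\<close> turns the growing sums into series
    over a fixed index set, as dominated convergence needs.\<close>
  define F where "F s N = (if s \<le> N then f N s else 0)" for s N
  have "eventually (\<lambda>(s, N). norm (F s N) \<le> K s) (at_top \<times>\<^sub>F sequentially)"
  proof (rule eventually_mono[OF eventually_prodI[OF eventually_True bound]])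
    show "case x of (s, N) \<Rightarrow> norm (F s N) \<le> K s"
      if "True \<and> (\<forall>s\<le>snd x. norm (f (snd x) s) \<le> K s)" for x
      using that K(2) by (cases x) (auto simp: F_def)
  qed
  moreover have "(\<lambda>N. F s N) \<longlonglongrightarrow> g s" for s
    by (rule Lim_transform_eventually[OF lim[of s]])
      (auto simp: F_def eventually_sequentially intro: exI[of _ s])
  ultimately have *: "summable (\<lambda>s. norm (g s))" "(\<lambda>N. \<Sum>s. F s N) \<longlonglongrightarrow> suminf g"
    using tannerys_theorem[of F g sequentially K] K(1) by auto
  show "summable g" using *(1) by (rule summable_norm_cancel)
  have "(\<Sum>s. F s N) = (\<Sum>s\<le>N. f N s)" for N
    using suminf_finite[of "{..N}" "\<lambda>s. F s N"] by (auto simp: F_def)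
  then show "(\<lambda>N. \<Sum>s\<le>N. f N s) \<longlonglongrightarrow> suminf g" using *(2) by simp
qed

lemma convergent_bounded:
  fixes f :: "nat \<Rightarrow> complex"
  assumes "f \<longlonglongrightarrow> l"
  obtains M where "\<And>n. norm (f n) \<le> M"
  using convergent_imp_Bseq[OF convergentI[OF assms]] unfolding Bseq_def by blast

lemma norm_mult_le:
  fixes x y :: "'a :: real_normed_div_algebra"
  assumes "norm x \<le> c" "norm y \<le> d"
  shows "norm (x * y) \<le> c * d"
  unfolding norm_mult
  by (rule mult_mono[OF assms order_trans[OF norm_ge_zero assms(1)] norm_ge_zero])

section \<open>The lattice in the variable \<open>v\<close>\<close>

context qracah_params
begin

lemma grid_left: "Q ^ N * (E (a - (of_nat s + a)) + E (a + (of_nat s + a) + 1)) = Q ^ N * inverse (Q ^ s) + r * Q ^ s"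
proof -
  have "a + (of_nat s + a) + 1 = of_nat s + (2 * a + 1)" "a - (of_nat s + a) = - of_nat s" by simp_all
  then have "E (a + (of_nat s + a) + 1) = Q ^ s * (r / Q ^ N)" "E (a - (of_nat s + a)) = inverse (Q ^ s)"
    using E_add[of "of_nat s" "2 * a + 1"] by (simp_all only: E_2a E_of_nat powr_minus)
  then show ?thesis by (simp add: distrib_left)
qed

lemma grid_right:
  "Q ^ N * (E (a - (of_nat N - of_nat s + a)) + E (a + (of_nat N - of_nat s + a) + 1)) = Q ^ s + r * Q ^ N * inverse (Q ^ s)"
proof -
  have "a + (of_nat N - of_nat s + a) + 1 = of_nat N + (2 * a + 1) - of_nat s"
    "a - (of_nat N - of_nat s + a) = of_nat s - of_nat N" by simp_all
  then have "E (a + (of_nat N - of_nat s + a) + 1) = Q ^ N * (r / Q ^ N) / Q ^ s"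
    "E (a - (of_nat N - of_nat s + a)) = Q ^ s / Q ^ N"
    using E_add[of "of_nat N" "2 * a + 1"] by (simp_all only: E_diff E_2a E_of_nat)
  then show ?thesis by (simp only:) (simp add: field_simps)
qed

text \<open>Reaches every nonzero \<open>z\<close>, not just the limits of grid points: with
  \<open>s = a - w\<close> the second power already contributes \<open>z / (q ta)\<close>, and the
  first dies with \<open>q^N\<close>. Needed for the recurrence.\<close>

lemma grid_general:
  assumes "z \<noteq> 0" "E w = Q * TC / z"
  shows "Q ^ N * (E (a - (a - w)) + E (a + (a - w) + 1)) = Q ^ N * (Q * TC / z) + z / (Q * TA)"
proof -
  have "a + (a - w) + 1 = (2 * a + 1) - w" by simp
  then have "E (a + (a - w) + 1) = r / Q ^ N / (Q * TC / z)"
    by (simp only: E_diff E_2a assms)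
  then show ?thesis using assms by (simp add: distrib_left)
qed

text \<open>On the whole grid \<open>q^N / q^s\<close> is a nonnegative power of \<open>q\<close>,
  which gives a radius independent of \<open>N\<close>.\<close>

lemma norm_grid:
  assumes "s \<le> N"
  shows "norm (Q ^ N * (E (a - (of_nat s + a)) + E (a + (of_nat s + a) + 1))) \<le> 1 + norm r"
proof -
  have "Q ^ N * inverse (Q ^ s) = Q ^ (N - s)"
    using assms by (simp add: power_diff divide_inverse)
  moreover have "norm (Q ^ (N - s) + r * Q ^ s) \<le> 1 + norm r"
  proof -
    have Q1: "norm (Q ^ i) \<le> 1" for i
      using norm_Q unfolding norm_power by (intro power_le_one) auto
    have "norm (r * Q ^ s) \<le> norm r"
      unfolding norm_mult using Q1 by (intro mult_left_le) auto
    then show ?thesis using Q1[of "N - s"] by (intro order_trans[OF norm_triangle_ineq] add_mono)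
  qed
  ultimately show ?thesis unfolding grid_left by simp
qed

end

section \<open>Passage to the limit\<close>

locale krall_limit = qparams +
  fixes A B :: complex and a b :: "nat \<Rightarrow> complex"
  assumes kappa: "\<And>m::nat. bigqJK_kappa Q TA TB TC A B (int m) \<noteq> 0"
    and diff: "\<And>N. N \<ge> 1 \<Longrightarrow> b N - a N = of_nat (N + 1)"
    and powr_sum: "\<And>N. N \<ge> 1 \<Longrightarrow> Q powr (a N + b N) = r"
begin

abbreviation "CC N n \<equiv> scaleC Q TA (a N) (b N) N n"
abbreviation "uK N n \<equiv> qRacahK Q \<alpha> \<beta> (a N) (b N) A B n"
abbreviation "PK n \<equiv> bigqJK Q TA TB TC A B n"
abbreviation "p N k x \<equiv> CC N k * qRacah Q \<alpha> \<beta> (a N) (b N) k x"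
abbreviation "h N k \<equiv> (CC N k)\<^sup>2 * qRacah_norm2 Q \<alpha> \<beta> (a N) (b N) k"
abbreviation "v N s \<equiv> Q ^ N * (Q powr (a N - s) + Q powr (a N + s + 1))"
abbreviation "sc N \<equiv> Q ^ (N + 1) * TA * (Q powr (a N + 1) / c1 Q)"

lemma params: "N \<ge> 1 \<Longrightarrow> qracah_params q ta tb tc \<alpha> \<beta> N (a N) (b N)"
  using qparams_axioms diff powr_sum
  by (simp add: qracah_params_def qracah_params_axioms_def)

text \<open>Nothing is assumed about \<open>a 0\<close> and \<open>b 0\<close>, and the identity for
  degree \<open>n\<close> holds from \<open>N = n\<close> on; so identities at finite
  \<open>N\<close> are used for large \<open>N\<close> only.\<close>

lemma eventually_params:
  assumes "\<And>N. N \<ge> n \<Longrightarrow> qracah_params q ta tb tc \<alpha> \<beta> N (a N) (b N) \<Longrightarrow> X N"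
  shows "eventually X sequentially"
  using assms params unfolding eventually_sequentially by (intro exI[of _ "max n 1"]) auto

lemma CC_nz: "CC N n \<noteq> 0"
  by (simp add: scaleC_def powr_def)

lemma h_tendsto: "(\<lambda>N. h N k) \<longlonglongrightarrow> bigqJ_norm2 Q TA TB TC k"
proof (rule Lim_transform_eventually[OF scaled_norm2_tendsto])
  show "\<forall>\<^sub>F N in sequentially. scaled_norm2 Q TA TB TC k (Q ^ N) = h N k"
    by (rule eventually_params[of 0]) (simp only: qracah_params.scaled_qRacah_norm2)
qed

lemma p_tendsto:
  assumes "(\<lambda>N. v N (s N)) \<longlonglongrightarrow> z / (Q * TA)" "z \<noteq> 0"
  shows "(\<lambda>N. p N k (s N)) \<longlonglongrightarrow> bigqJ Q TA TB TC k z"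
  unfolding bigqJ_eq_scaled_poly[OF assms(2)]
proof (rule Lim_transform_eventually[OF scaled_poly_tendsto[OF Q_power_tendsto assms(1)]])
  show "\<forall>\<^sub>F N in sequentially. scaled_poly Q TA TB TC k (Q ^ N) (v N (s N)) = p N k (s N)"
    by (rule eventually_params[of k]) (simp only: qracah_params.scaled_qRacah)
qed

lemma v_left: "(\<lambda>N. v N (of_nat s + a N)) \<longlonglongrightarrow> TC * Q ^ (s + 1) / (Q * TA)"
proof (rule Lim_transform_eventually)
  have "(\<lambda>N. Q ^ N * inverse (Q ^ s) + r * Q ^ s) \<longlonglongrightarrow> 0 * inverse (Q ^ s) + r * Q ^ s"
    by (intro tendsto_add tendsto_mult Q_power_tendsto tendsto_const)
  then show "(\<lambda>N. Q ^ N * inverse (Q ^ s) + r * Q ^ s) \<longlonglongrightarrow> TC * Q ^ (s + 1) / (Q * TA)"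
    by (simp add: mult.commute)
  show "\<forall>\<^sub>F N in sequentially. Q ^ N * inverse (Q ^ s) + r * Q ^ s = v N (of_nat s + a N)"
    by (rule eventually_params[of 0]) (simp only: qracah_params.grid_left)
qed

lemma v_right: "(\<lambda>N. v N (of_nat N - of_nat s + a N)) \<longlonglongrightarrow> TA * Q ^ (s + 1) / (Q * TA)"
proof (rule Lim_transform_eventually)
  have "(\<lambda>N. Q ^ s + r * Q ^ N * inverse (Q ^ s)) \<longlonglongrightarrow> Q ^ s + r * 0 * inverse (Q ^ s)"
    by (intro tendsto_add tendsto_mult Q_power_tendsto tendsto_const)
  then show "(\<lambda>N. Q ^ s + r * Q ^ N * inverse (Q ^ s)) \<longlonglongrightarrow> TA * Q ^ (s + 1) / (Q * TA)"
    by simp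
  show "\<forall>\<^sub>F N in sequentially. Q ^ s + r * Q ^ N * inverse (Q ^ s) = v N (of_nat N - of_nat s + a N)"
    by (rule eventually_params[of 0]) (simp only: qracah_params.grid_right)
qed

lemma p_t1: "(\<lambda>N. p N k (a N)) \<longlonglongrightarrow> bigqJ Q TA TB TC k (TC * Q)"
  using p_tendsto[OF v_left[of 0]] by simp

lemma b_eventually: "\<forall>\<^sub>F N in sequentially. b N - 1 = of_nat N - of_nat 0 + a N"
proof (rule eventually_params[of 0])
  fix N assume "qracah_params q ta tb tc \<alpha> \<beta> N (a N) (b N)"
  from qracah_params.b_eq[OF this] show "b N - 1 = of_nat N - of_nat 0 + a N" by simp
qed

lemma p_t2: "(\<lambda>N. p N k (b N - 1)) \<longlonglongrightarrow> bigqJ Q TA TB TC k (TA * Q)"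
proof (rule Lim_transform_eventually)
  show "(\<lambda>N. p N k (of_nat N - of_nat 0 + a N)) \<longlonglongrightarrow> bigqJ Q TA TB TC k (TA * Q)"
    using p_tendsto[OF v_right[of 0]] by simp
  show "\<forall>\<^sub>F N in sequentially. p N k (of_nat N - of_nat 0 + a N) = p N k (b N - 1)"
    using b_eventually by eventually_elim (simp only:)
qed

lemmas kappa' = kappa[unfolded bigqJK_kappa_def]

lemma uK_scaled: "CC N n * uK N n x = krall_poly (p N) (h N) (a N) (b N - 1) A B n x"
  unfolding qRacahK_def by (rule krall_poly_scaled[OF CC_nz, symmetric])

lemma uK_tendsto:
  assumes "(\<lambda>N. v N (s N)) \<longlonglongrightarrow> z / (Q * TA)" "z \<noteq> 0"
  shows "(\<lambda>N. CC N n * uK N n (s N)) \<longlonglongrightarrow> PK n z"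
  unfolding uK_scaled bigqJK_def
  by (rule tendsto_krall_poly[where p' = "bigqJ Q TA TB TC" and h' = "bigqJ_norm2 Q TA TB TC",
        OF h_tendsto bigqJ_norm2_nz p_t1 p_t2 kappa' p_tendsto[OF assms]])

lemma uK_left: "(\<lambda>N. CC N n * uK N n (of_nat s + a N)) \<longlonglongrightarrow> PK n (TC * Q ^ (s + 1))"
  by (rule uK_tendsto[OF v_left]) simp

lemma uK_right: "(\<lambda>N. CC N n * uK N n (of_nat N - of_nat s + a N)) \<longlonglongrightarrow> PK n (TA * Q ^ (s + 1))"
  by (rule uK_tendsto[OF v_right]) simp

lemma uK_t1: "(\<lambda>N. CC N n * uK N n (a N)) \<longlonglongrightarrow> PK n (TC * Q)"
  using uK_left[of n 0] by simp

lemma uK_t2: "(\<lambda>N. CC N n * uK N n (b N - 1)) \<longlonglongrightarrow> PK n (TA * Q)"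
proof (rule Lim_transform_eventually)
  show "(\<lambda>N. CC N n * uK N n (of_nat N - of_nat 0 + a N)) \<longlonglongrightarrow> PK n (TA * Q)"
    using uK_right[of n 0] by simp
  show "\<forall>\<^sub>F N in sequentially. CC N n * uK N n (of_nat N - of_nat 0 + a N) = CC N n * uK N n (b N - 1)"
    using b_eventually by eventually_elim (simp only:)
qed

lemma norm2_tendsto: "(\<lambda>N. (CC N n)\<^sup>2 * qRacahK_norm2 Q \<alpha> \<beta> (a N) (b N) A B n) \<longlonglongrightarrow> bigqJK_norm2 Q TA TB TC A B n"
proof -
  have "(CC N n)\<^sup>2 * qRacahK_norm2 Q \<alpha> \<beta> (a N) (b N) A B n = krall_norm2 (p N) (h N) (a N) (b N - 1) A B n" for N
    unfolding qRacahK_norm2_def by (rule krall_norm2_scaled[OF CC_nz, symmetric])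
  note * = this
  show ?thesis
    unfolding * bigqJK_norm2_def
    by (rule tendsto_krall_norm2[where p' = "bigqJ Q TA TB TC" and h' = "bigqJ_norm2 Q TA TB TC",
          OF h_tendsto bigqJ_norm2_nz p_t1 p_t2 kappa'])
qed

lemma beta_tendsto: "(\<lambda>N. sc N * (qRacahK_beta Q \<alpha> \<beta> (a N) (b N) A B n - c3 Q)) \<longlonglongrightarrow> bigqJK_beta Q TA TB TC A B n"
proof (rule Lim_transform_eventually)
  show "(\<lambda>N. krall_beta (p N) (h N) (\<lambda>k. sc N * (qRacah_beta Q \<alpha> \<beta> (a N) (b N) k - c3 Q)) (a N) (b N - 1) A B n)
    \<longlonglongrightarrow> bigqJK_beta Q TA TB TC A B n"
    unfolding bigqJK_beta_def
  proof (rule tendsto_krall_beta[where p' = "bigqJ Q TA TB TC" and h' = "bigqJ_norm2 Q TA TB TC",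
        OF h_tendsto bigqJ_norm2_nz p_t1 p_t2 kappa'])
    show "(\<lambda>N. sc N * (qRacah_beta Q \<alpha> \<beta> (a N) (b N) n - c3 Q)) \<longlonglongrightarrow> bigqJ_beta Q TA TB TC n"
    proof (rule Lim_transform_eventually[OF scaled_beta_tendsto])
      show "\<forall>\<^sub>F N in sequentially. scaled_beta Q TA TB TC n (Q ^ N) = sc N * (qRacah_beta Q \<alpha> \<beta> (a N) (b N) n - c3 Q)"
        by (rule eventually_params[of 0]) (simp only: qracah_params.scaled_qRacah_beta)
    qed
  qed
  show "\<forall>\<^sub>F N in sequentially.
    krall_beta (p N) (h N) (\<lambda>k. sc N * (qRacah_beta Q \<alpha> \<beta> (a N) (b N) k - c3 Q)) (a N) (b N - 1) A B n =
    sc N * (qRacahK_beta Q \<alpha> \<beta> (a N) (b N) A B n - c3 Q)"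
    unfolding qRacahK_beta_def krall_beta_shift
    by (rule eventually_params[of 0], rule krall_beta_scaled[OF CC_nz], rule qracah_params.scaleC_Suc)
qed

lemma gamma_tendsto: "(\<lambda>N. (sc N)\<^sup>2 * qRacahK_gamma Q \<alpha> \<beta> (a N) (b N) A B n) \<longlonglongrightarrow> bigqJK_gamma Q TA TB TC A B n"
proof -
  have "(sc N)\<^sup>2 * qRacahK_gamma Q \<alpha> \<beta> (a N) (b N) A B n =
    krall_gamma (p N) (h N) (\<lambda>k. (sc N)\<^sup>2 * qRacah_gamma Q \<alpha> \<beta> (a N) (b N) k) (a N) (b N - 1) A B n" for N
    unfolding qRacahK_gamma_def by (rule krall_gamma_scaled[OF CC_nz, symmetric])
  note * = this
  show ?thesis
    unfolding * bigqJK_gamma_def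
  proof (rule tendsto_krall_gamma[where p' = "bigqJ Q TA TB TC" and h' = "bigqJ_norm2 Q TA TB TC",
        OF h_tendsto bigqJ_norm2_nz p_t1 p_t2 kappa'])
    assume "n \<noteq> 0"
    show "(\<lambda>N. (sc N)\<^sup>2 * qRacah_gamma Q \<alpha> \<beta> (a N) (b N) n) \<longlonglongrightarrow> bigqJ_gamma Q TA TB TC n"
    proof (rule Lim_transform_eventually[OF scaled_gamma_tendsto])
      show "\<forall>\<^sub>F N in sequentially. scaled_gamma Q TA TB TC n (Q ^ N) = (sc N)\<^sup>2 * qRacah_gamma Q \<alpha> \<beta> (a N) (b N) n"
        using \<open>n \<noteq> 0\<close> by (intro eventually_params[of 0] qracah_params.scaled_qRacah_gamma[symmetric]) auto
    qed
  qed
qed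

lemma CC_Suc: "\<forall>\<^sub>F N in sequentially. CC N (Suc n) = sc N * CC N n"
  by (rule eventually_params[of 0]) (rule qracah_params.scaleC_Suc)

lemma gamma_tendsto':
  assumes "n \<ge> 1"
  shows "(\<lambda>N. sc N * (CC N n / CC N (n - 1)) * qRacahK_gamma Q \<alpha> \<beta> (a N) (b N) A B n) \<longlonglongrightarrow> bigqJK_gamma Q TA TB TC A B n"
proof (rule Lim_transform_eventually[OF gamma_tendsto])
  show "\<forall>\<^sub>F N in sequentially. (sc N)\<^sup>2 * qRacahK_gamma Q \<alpha> \<beta> (a N) (b N) A B n =
    sc N * (CC N n / CC N (n - 1)) * qRacahK_gamma Q \<alpha> \<beta> (a N) (b N) A B n"
    using CC_Suc[of "n - 1"]
  proof eventually_elim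
    case (elim N)
    then have "CC N n / CC N (n - 1) = sc N" using assms CC_nz[of N "n - 1"] by simp
    then show ?case by (simp only: power2_eq_square)
  qed
qed

text \<open>Subtracting \<open>c3\<close> from both \<open>mu\<close> and the coefficient keeps the
  recurrence valid. Multiplied by \<open>C_(n+1) = \<sigma> C_n\<close>, every term then converges;
  the last one turns into \<open>\<sigma>^2\<close> times its coefficient times a scaled polynomial
  of degree \<open>n - 1\<close>.\<close>

lemma recurrence_limit:
  assumes "\<forall>\<^sub>F N in sequentially. \<forall>s. qRacahK_recurrence Q \<alpha> \<beta> (a N) (b N) A B n s" and "z \<noteq> 0"
  shows "bigqJK_recurrence Q TA TB TC A B n z"
proof -
  \<comment> \<open>A logarithm of \<open>q tc / z\<close> to the base \<open>q\<close>, so that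
    \<open>s = a - w\<close> satisfies \<open>q^(a-s) = q tc / z\<close>.\<close>
  define w where "w = Ln (Q * TC / z) / Ln Q"
  have "Ln Q \<noteq> 0" using q_pos q_less_1 by (simp add: Ln_of_real)
  then have w: "Q powr w = Q * TC / z" using \<open>z \<noteq> 0\<close> by (simp add: w_def powr_def)
  have v: "(\<lambda>N. v N (a N - w)) \<longlonglongrightarrow> z / (Q * TA)"
  proof (rule Lim_transform_eventually)
    have "(\<lambda>N. Q ^ N * (Q * TC / z) + z / (Q * TA)) \<longlonglongrightarrow> 0 * (Q * TC / z) + z / (Q * TA)"
      by (intro tendsto_add tendsto_mult Q_power_tendsto tendsto_const)
    then show "(\<lambda>N. Q ^ N * (Q * TC / z) + z / (Q * TA)) \<longlonglongrightarrow> z / (Q * TA)" by simp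
    show "\<forall>\<^sub>F N in sequentially. Q ^ N * (Q * TC / z) + z / (Q * TA) = v N (a N - w)"
      by (rule eventually_params[of 0]) (simp only: qracah_params.grid_general[OF _ \<open>z \<noteq> 0\<close> w])
  qed
  note u = uK_tendsto[OF v \<open>z \<noteq> 0\<close>]
  have mu: "(\<lambda>N. sc N * (mu Q (a N - w) - c3 Q)) \<longlonglongrightarrow> z"
  proof (rule Lim_transform_eventually)
    show "(\<lambda>N. Q * TA * v N (a N - w)) \<longlonglongrightarrow> z"
      using tendsto_mult[OF tendsto_const v, of "Q * TA"] by simp
    show "\<forall>\<^sub>F N in sequentially. Q * TA * v N (a N - w) = sc N * (mu Q (a N - w) - c3 Q)"
      by (rule eventually_params[of 0]) (simp only: qracah_params.sigma_mu)
  qed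
  have lhs: "(\<lambda>N. sc N * (mu Q (a N - w) - c3 Q) * (CC N n * uK N n (a N - w))) \<longlonglongrightarrow> z * PK n z"
    by (intro tendsto_mult mu u)
  have rhs: "(\<lambda>N. CC N (n + 1) * uK N (n + 1) (a N - w) +
      sc N * (qRacahK_beta Q \<alpha> \<beta> (a N) (b N) A B n - c3 Q) * (CC N n * uK N n (a N - w)) +
      (sc N)\<^sup>2 * qRacahK_gamma Q \<alpha> \<beta> (a N) (b N) A B n * (CC N (n - 1) * uK N (n - 1) (a N - w)))
    \<longlonglongrightarrow> PK (n + 1) z + bigqJK_beta Q TA TB TC A B n * PK n z + bigqJK_gamma Q TA TB TC A B n * PK (n - 1) z"
    by (intro tendsto_intros u beta_tendsto gamma_tendsto)
  have eq: "\<forall>\<^sub>F N in sequentially. sc N * (mu Q (a N - w) - c3 Q) * (CC N n * uK N n (a N - w)) =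
      CC N (n + 1) * uK N (n + 1) (a N - w) +
      sc N * (qRacahK_beta Q \<alpha> \<beta> (a N) (b N) A B n - c3 Q) * (CC N n * uK N n (a N - w)) +
      (sc N)\<^sup>2 * qRacahK_gamma Q \<alpha> \<beta> (a N) (b N) A B n * (CC N (n - 1) * uK N (n - 1) (a N - w))"
    using assms(1) CC_Suc[of n] CC_Suc[of "n - 1"]
  proof eventually_elim
    case (elim N)
    have rec: "mu Q (a N - w) * uK N n (a N - w) = uK N (n + 1) (a N - w) +
      qRacahK_beta Q \<alpha> \<beta> (a N) (b N) A B n * uK N n (a N - w) +
      qRacahK_gamma Q \<alpha> \<beta> (a N) (b N) A B n * uK N (n - 1) (a N - w)"
      using elim(1) by (simp add: qRacahK_recurrence_def Let_def)
    \<comment> \<open>For \<open>n = 0\<close> the truncated index \<open>n - 1\<close> is 0 and the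
      ratio of the \<open>C\<close> is not \<open>\<sigma>\<close>, but then the coefficient
      vanishes.\<close>
    have gam: "(sc N)\<^sup>2 * qRacahK_gamma Q \<alpha> \<beta> (a N) (b N) A B n * CC N (n - 1) =
      sc N * CC N n * qRacahK_gamma Q \<alpha> \<beta> (a N) (b N) A B n"
    proof (cases n)
      case 0
      then show ?thesis by (simp add: qRacahK_gamma_def krall_gamma_def)
    next
      case (Suc m)
      have "CC N n = sc N * CC N (n - 1)" using elim(3) unfolding Suc by (simp only: diff_Suc_1)
      then show ?thesis by (simp only: power2_eq_square mult_ac)
    qed
    have *: "\<sigma> * (m - c) * (C * u0) = \<sigma> * C * u1 + \<sigma> * (be - c) * (C * u0) + G * (C' * u2)"
      if "m * u0 = u1 + be * u0 + ga * u2" "G * C' = \<sigma> * C * ga"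
      for \<sigma> m c C u0 u1 be ga G C' u2 :: complex
    proof -
      have "\<sigma> * (m - c) * (C * u0) = \<sigma> * C * (m * u0) - \<sigma> * C * c * u0" by (simp add: algebra_simps)
      also have "\<dots> = \<sigma> * C * u1 + \<sigma> * (be - c) * (C * u0) + \<sigma> * C * ga * u2"
        unfolding that(1) by (simp add: algebra_simps)
      also have "\<sigma> * C * ga = G * C'" using that(2) by simp
      finally show ?thesis by (simp only: mult.assoc)
    qed
    have "CC N (n + 1) = sc N * CC N n" using elim(2) by (simp only: Suc_eq_plus1)
    then show ?case
      by (simp only:) (rule *[OF rec gam])
  qed
  have "z * PK n z = PK (n + 1) z + bigqJK_beta Q TA TB TC A B n * PK n z + bigqJK_gamma Q TA TB TC A B n * PK (n - 1) z"
    by (rule LIMSEQ_unique[OF Lim_transform_eventually[OF lhs eq] rhs])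
  then show ?thesis by (simp add: bigqJK_recurrence_def Let_def)
qed

lemma uK_bounded: "\<exists>M. \<forall>\<^sub>F N in sequentially. \<forall>s\<le>N. norm (CC N n * uK N n (of_nat s + a N)) \<le> M"
proof -
  define X where "X N = (\<lambda>s. of_nat s + a N) ` {..N}" for N
  have "\<exists>M. \<forall>\<^sub>F N in sequentially. \<forall>x\<in>X N. norm (krall_poly (p N) (h N) (a N) (b N - 1) A B n x) \<le> M"
  proof (rule krall_poly_bounded[where p' = "bigqJ Q TA TB TC" and h' = "bigqJ_norm2 Q TA TB TC",
      OF h_tendsto bigqJ_norm2_nz p_t1 p_t2 kappa'])
    fix k
    from scaled_poly_bounded[of "1 + norm r" Q TA TB TC k]
    obtain M where M: "\<And>\<epsilon> v. norm \<epsilon> \<le> 1 + norm r \<Longrightarrow> norm v \<le> 1 + norm r \<Longrightarrow> norm (scaled_poly Q TA TB TC k \<epsilon> v) \<le> M"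
      by auto
    have Q1: "norm (Q ^ N) \<le> 1 + norm r" for N
    proof -
      have "norm (Q ^ N) \<le> 1" using norm_Q unfolding norm_power by (intro power_le_one) auto
      then show ?thesis using norm_ge_zero[of r] by linarith
    qed
    have "\<forall>\<^sub>F N in sequentially. \<forall>x\<in>X N. norm (p N k x) \<le> M"
    proof (rule eventually_params[of k])
      fix N assume N: "k \<le> N" and par: "qracah_params q ta tb tc \<alpha> \<beta> N (a N) (b N)"
      have "\<forall>s\<in>{..N}. norm (p N k (of_nat s + a N)) \<le> M"
        unfolding qracah_params.scaled_qRacah[OF par N]
        by (intro ballI M Q1 qracah_params.norm_grid[OF par]) simp
      then show "\<forall>x\<in>X N. norm (p N k x) \<le> M" by (simp only: X_def ball_simps)
    qed
    then show "\<exists>M. \<forall>\<^sub>F N in sequentially. \<forall>x\<in>X N. norm (p N k x) \<le> M" by (rule exI)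
  qed
  then obtain M where "\<forall>\<^sub>F N in sequentially. \<forall>x\<in>X N. norm (krall_poly (p N) (h N) (a N) (b N - 1) A B n x) \<le> M"
    by (rule exE)
  then have "\<forall>\<^sub>F N in sequentially. \<forall>s\<le>N. norm (CC N n * uK N n (of_nat s + a N)) \<le> M"
    unfolding uK_scaled
  proof eventually_elim
    case (elim N)
    show ?case by (intro allI impI bspec[OF elim]) (auto simp: X_def)
  qed
  then show ?thesis by (rule exI)
qed

lemma weight_right_shift: "(\<lambda>N. weight_right (N - s)) \<longlonglongrightarrow> lim weight_right"
  by (rule LIMSEQ_offset[of _ s]) (use weight_right_tendsto limI[OF weight_right_tendsto] in simp)

lemma weight_left_shift: "(\<lambda>N. weight_left (N - s)) \<longlonglongrightarrow> 1"
  by (rule LIMSEQ_offset[of _ s]) (use weight_left_tendsto in simp)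

lemma weight_const_lim: "weight_const \<longlonglongrightarrow> lim weight_const"
  using weight_const_tendsto limI[OF weight_const_tendsto] by simp

text \<open>Writing the weight as \<open>(q\<^sup>N\<^sup>-\<^sup>s - r q\<^sup>s)\<close> times convergent factors separates the two halves of the
  sum: the part with \<open>q\<^sup>s\<close> is dominated by a geometric series, and so is the part with
  \<open>q\<^sup>N\<^sup>-\<^sup>s\<close> after reversing the order of summation.\<close>
lemma sum_limit:
  shows "summable (bigqJK_summand Q TA TB TC A B TC n m)"
    and "summable (bigqJK_summand Q TA TB TC A B TA n m)"
    and "(\<lambda>N. CC N n * CC N m * qRacahK_sum Q \<alpha> \<beta> (a N) (b N) A B N n m) \<longlonglongrightarrow> bigqJK_sum Q TA TB TC A B n m"
proof -
  define U where "U N s = CC N n * uK N n (of_nat s + a N) * (CC N m * uK N m (of_nat s + a N))" for N s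
  \<comment> \<open>The index of \<open>f1\<close> is the distance to the left end, that of
    \<open>f2\<close> the distance to the right end; only so do the terms converge at a fixed
    index.\<close>
  define f1 where "f1 N s = - r * Q ^ s * weight_left s * (weight_right (N - s) * weight_const N) * U N s" for N s
  define f2 where "f2 N s = Q ^ s * weight_right s * (weight_left (N - s) * weight_const N) * U N (N - s)" for N s
  define g1 where "g1 s = (1 - Q) * (- TC) * bigqJK_summand Q TA TB TC A B TC n m s" for s
  define g2 where "g2 s = (1 - Q) * TA * bigqJK_summand Q TA TB TC A B TA n m s" for s
  obtain Mn where Mn: "\<forall>\<^sub>F N in sequentially. \<forall>s\<le>N. norm (CC N n * uK N n (of_nat s + a N)) \<le> Mn"
    using uK_bounded by blast
  obtain Mm where Mm: "\<forall>\<^sub>F N in sequentially. \<forall>s\<le>N. norm (CC N m * uK N m (of_nat s + a N)) \<le> Mm"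
    using uK_bounded by blast
  have U: "\<forall>\<^sub>F N in sequentially. \<forall>s\<le>N. norm (U N s) \<le> \<bar>Mn\<bar> * \<bar>Mm\<bar>"
    using Mn Mm
  proof eventually_elim
    case (elim N)
    show ?case
      unfolding U_def
      by (intro allI impI norm_mult_le order_trans[OF elim(1)[rule_format] abs_ge_self]
          order_trans[OF elim(2)[rule_format] abs_ge_self])
  qed
  obtain L1 where L1: "\<And>s. norm (weight_left s) \<le> L1" using convergent_bounded[OF weight_left_tendsto] by blast
  obtain L2 where L2: "\<And>s. norm (weight_right s) \<le> L2" using convergent_bounded[OF weight_right_tendsto] by blast
  obtain L3 where L3: "\<And>s. norm (weight_const s) \<le> L3" using convergent_bounded[OF weight_const_tendsto] by blast
  have L0: "0 \<le> L1" "0 \<le> L2" "0 \<le> L3" using order_trans[OF norm_ge_zero L1[of 0]] order_trans[OF norm_ge_zero L2[of 0]] order_trans[OF norm_ge_zero L3[of 0]]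
    by simp_all
  have "summable (\<lambda>s. norm Q ^ s)" using norm_Q by (intro summable_geometric) simp
  then have K: "summable (\<lambda>s. x * norm Q ^ s * L1 * (L2 * L3) * (\<bar>Mn\<bar> * \<bar>Mm\<bar>))" for x
    by (intro summable_mult summable_mult2)
  have lim1: "(\<lambda>N. f1 N s) \<longlonglongrightarrow> g1 s" for s
  proof -
    have "(\<lambda>N. f1 N s) \<longlonglongrightarrow> - r * Q ^ s * weight_left s * (lim weight_right * lim weight_const) *
      (PK n (TC * Q ^ (s + 1)) * PK m (TC * Q ^ (s + 1)))"
      unfolding f1_def U_def
      by (intro tendsto_mult tendsto_const weight_right_shift weight_const_lim uK_left)
    moreover have "- r * Q ^ s * weight_left s * (lim weight_right * lim weight_const) *
      (PK n (TC * Q ^ (s + 1)) * PK m (TC * Q ^ (s + 1))) = g1 s"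
      unfolding bigqJ_weight_left[symmetric] g1_def bigqJK_summand_def by (simp only: mult_ac)
    ultimately show ?thesis by (simp only:)
  qed
  have bound1: "\<forall>\<^sub>F N in sequentially. \<forall>s\<le>N. norm (f1 N s) \<le> norm r * norm Q ^ s * L1 * (L2 * L3) * (\<bar>Mn\<bar> * \<bar>Mm\<bar>)"
    using U
  proof eventually_elim
    case (elim N)
    have "norm (- r * Q ^ s) \<le> norm r * norm Q ^ s" for s by (simp only: norm_mult norm_power norm_minus_cancel order_refl)
    then show ?case
      unfolding f1_def by (intro allI impI norm_mult_le[OF norm_mult_le[OF norm_mult_le[OF _ L1] norm_mult_le[OF L2 L3]]] elim[rule_format])
  qed
  have lim2: "(\<lambda>N. f2 N s) \<longlonglongrightarrow> g2 s" for s
  proof (rule Lim_transform_eventually)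
    show "(\<lambda>N. Q ^ s * weight_right s * (weight_left (N - s) * weight_const N) *
        (CC N n * uK N n (of_nat N - of_nat s + a N) * (CC N m * uK N m (of_nat N - of_nat s + a N)))) \<longlonglongrightarrow> g2 s"
    proof -
      have "(\<lambda>N. Q ^ s * weight_right s * (weight_left (N - s) * weight_const N) *
          (CC N n * uK N n (of_nat N - of_nat s + a N) * (CC N m * uK N m (of_nat N - of_nat s + a N))))
        \<longlonglongrightarrow> Q ^ s * weight_right s * (1 * lim weight_const) *
           (PK n (TA * Q ^ (s + 1)) * PK m (TA * Q ^ (s + 1)))"
        by (intro tendsto_mult tendsto_const weight_left_shift weight_const_lim uK_right)
      moreover have "Q ^ s * weight_right s * (1 * lim weight_const) *
           (PK n (TA * Q ^ (s + 1)) * PK m (TA * Q ^ (s + 1))) = g2 s"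
        unfolding mult_1_left bigqJ_weight_right[symmetric] g2_def bigqJK_summand_def by (simp only: mult_ac)
      ultimately show ?thesis by (simp only:)
    qed
    show "\<forall>\<^sub>F N in sequentially. Q ^ s * weight_right s * (weight_left (N - s) * weight_const N) *
        (CC N n * uK N n (of_nat N - of_nat s + a N) * (CC N m * uK N m (of_nat N - of_nat s + a N))) = f2 N s"
      using eventually_ge_at_top[of s] by eventually_elim (simp add: f2_def U_def of_nat_diff)
  qed
  have bound2: "\<forall>\<^sub>F N in sequentially. \<forall>s\<le>N. norm (f2 N s) \<le> 1 * norm Q ^ s * L1 * (L2 * L3) * (\<bar>Mn\<bar> * \<bar>Mm\<bar>)"
    using U
  proof eventually_elim
    case (elim N)
    have "norm (Q ^ s) \<le> norm Q ^ s" for s by (simp only: norm_power order_refl)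
    then have "norm (f2 N s) \<le> norm Q ^ s * L2 * (L1 * L3) * (\<bar>Mn\<bar> * \<bar>Mm\<bar>)" for s
      unfolding f2_def
      by (intro norm_mult_le[OF norm_mult_le[OF norm_mult_le[OF _ L2] norm_mult_le[OF L1 L3]]] elim[rule_format, OF diff_le_self])
    then show ?case by (simp add: mult_ac)
  qed
  have K0: "0 \<le> norm r * norm Q ^ s * L1 * (L2 * L3) * (\<bar>Mn\<bar> * \<bar>Mm\<bar>)"
    "0 \<le> 1 * norm Q ^ s * L1 * (L2 * L3) * (\<bar>Mn\<bar> * \<bar>Mm\<bar>)" for s
    using L0 by simp_all
  note T1 = tannery_sum[OF lim1 bound1 K K0(1)] and T2 = tannery_sum[OF lim2 bound2 K K0(2)]
  have c: "(1 - Q) * (- TC) \<noteq> 0" "(1 - Q) * TA \<noteq> 0" using one_minus_Q by simp_all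
  show s1: "summable (bigqJK_summand Q TA TB TC A B TC n m)"
    using T1(1) c(1) unfolding g1_def by (rule summable_mult_D)
  show s2: "summable (bigqJK_summand Q TA TB TC A B TA n m)"
    using T2(1) c(2) unfolding g2_def by (rule summable_mult_D)
  have "bigqJK_sum Q TA TB TC A B n m = suminf g1 + suminf g2"
    unfolding bigqJK_sum_def g1_def g2_def suminf_mult[OF s1] suminf_mult[OF s2] ..
  then have "(\<lambda>N. (\<Sum>s\<le>N. f1 N s) + (\<Sum>s\<le>N. f2 N s)) \<longlonglongrightarrow> bigqJK_sum Q TA TB TC A B n m"
    by (simp only:) (intro tendsto_add T1 T2)
  then show "(\<lambda>N. CC N n * CC N m * qRacahK_sum Q \<alpha> \<beta> (a N) (b N) A B N n m) \<longlonglongrightarrow> bigqJK_sum Q TA TB TC A B n m"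
  proof (rule Lim_transform_eventually)
    show "\<forall>\<^sub>F N in sequentially. (\<Sum>s\<le>N. f1 N s) + (\<Sum>s\<le>N. f2 N s) =
      CC N n * CC N m * qRacahK_sum Q \<alpha> \<beta> (a N) (b N) A B N n m"
    proof (rule eventually_params[of 0])
      fix N assume par: "qracah_params q ta tb tc \<alpha> \<beta> N (a N) (b N)"
      have "(\<Sum>s\<le>N. f2 N s) = (\<Sum>s\<le>N. f2 N (N - s))"
        by (rule sum.reindex_bij_witness[of _ "\<lambda>s. N - s" "\<lambda>s. N - s"]) auto
      then have "(\<Sum>s\<le>N. f1 N s) + (\<Sum>s\<le>N. f2 N s) = (\<Sum>s\<le>N. f1 N s + f2 N (N - s))"
        by (simp only: sum.distrib)
      also have "\<dots> = (\<Sum>s = 0..N. CC N n * CC N m * (uK N n (of_nat s + a N) * uK N m (of_nat s + a N) *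
        qRacah_weight Q \<alpha> \<beta> (a N) (b N) (of_nat s + a N) * qnum Q (2 * of_nat s + 2 * a N + 1)))"
      proof (rule sum.cong)
        fix s assume "s \<in> {0..N}"
        then have "s \<le> N" by simp
        have "CC N n * CC N m * (uK N n (of_nat s + a N) * uK N m (of_nat s + a N) *
            qRacah_weight Q \<alpha> \<beta> (a N) (b N) (of_nat s + a N) * qnum Q (2 * of_nat s + 2 * a N + 1)) =
          U N s * (qRacah_weight Q \<alpha> \<beta> (a N) (b N) (of_nat s + a N) * qnum Q (2 * of_nat s + 2 * a N + 1))"
          unfolding U_def by (simp only: mult_ac)
        also have "\<dots> = U N s * ((Q ^ (N - s) - r * Q ^ s) * weight_left s * weight_right (N - s) * weight_const N)"
          by (simp only: qracah_params.weight_eq[OF par \<open>s \<le> N\<close>])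
        also have "\<dots> = f1 N s + f2 N (N - s)"
          using \<open>s \<le> N\<close> by (simp add: f1_def f2_def left_diff_distrib right_diff_distrib mult_ac)
        finally show "f1 N s + f2 N (N - s) = CC N n * CC N m * (uK N n (of_nat s + a N) * uK N m (of_nat s + a N) *
            qRacah_weight Q \<alpha> \<beta> (a N) (b N) (of_nat s + a N) * qnum Q (2 * of_nat s + 2 * a N + 1))" ..
      qed auto
      also have "\<dots> = CC N n * CC N m * qRacahK_sum Q \<alpha> \<beta> (a N) (b N) A B N n m"
        unfolding qRacahK_sum_def sum_distrib_left ..
      finally show "(\<Sum>s\<le>N. f1 N s) + (\<Sum>s\<le>N. f2 N s) = CC N n * CC N m * qRacahK_sum Q \<alpha> \<beta> (a N) (b N) A B N n m" .
    qed
  qed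
qed

lemma mass_limits:
  "(\<lambda>N. CC N n * CC N m * (A * uK N n (a N) * uK N m (a N))) \<longlonglongrightarrow> A * PK n (TC * Q) * PK m (TC * Q)"
  "(\<lambda>N. CC N n * CC N m * (B * uK N n (b N - 1) * uK N m (b N - 1))) \<longlonglongrightarrow> B * PK n (TA * Q) * PK m (TA * Q)"
proof -
  have *: "x * y * (c * s * t) = c * (x * s) * (y * t)" for x y c s t :: complex by (simp only: mult_ac)
  show "(\<lambda>N. CC N n * CC N m * (A * uK N n (a N) * uK N m (a N))) \<longlonglongrightarrow> A * PK n (TC * Q) * PK m (TC * Q)"
    by (subst *) (intro tendsto_mult tendsto_const uK_t1)
  show "(\<lambda>N. CC N n * CC N m * (B * uK N n (b N - 1) * uK N m (b N - 1))) \<longlonglongrightarrow> B * PK n (TA * Q) * PK m (TA * Q)"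
    by (subst *) (intro tendsto_mult tendsto_const uK_t2)
qed

text \<open>Uniqueness of limits after multiplication by \<open>C_n C_m\<close>. Off the diagonal
  the right-hand side is 0 for almost all \<open>N\<close>, so the norm enters with the factor
  \<open>C_n^2\<close> alone.\<close>

lemma orthogonality_limit:
  assumes "\<forall>\<^sub>F N in sequentially. qRacahK_orthogonality Q \<alpha> \<beta> (a N) (b N) A B N n m"
  shows "bigqJK_orthogonality Q TA TB TC A B n m"
proof -
  let ?L = "\<lambda>N. CC N n * CC N m * qRacahK_sum Q \<alpha> \<beta> (a N) (b N) A B N n m +
      CC N n * CC N m * (A * uK N n (a N) * uK N m (a N)) +
      CC N n * CC N m * (B * uK N n (b N - 1) * uK N m (b N - 1))"
  let ?R = "\<lambda>N. if n = m then (CC N n)\<^sup>2 * qRacahK_norm2 Q \<alpha> \<beta> (a N) (b N) A B n else 0"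
  have lhs: "?L \<longlonglongrightarrow> bigqJK_sum Q TA TB TC A B n m + A * PK n (TC * Q) * PK m (TC * Q) + B * PK n (TA * Q) * PK m (TA * Q)"
    by (intro tendsto_add sum_limit mass_limits)
  have rhs: "?R \<longlonglongrightarrow> (if n = m then bigqJK_norm2 Q TA TB TC A B n else 0)"
    using norm2_tendsto by simp
  have eq: "\<forall>\<^sub>F N in sequentially. ?L N = ?R N"
    using assms
  proof eventually_elim
    case (elim N)
    then show ?case
      unfolding qRacahK_orthogonality_def Let_def distrib_left[symmetric] by (simp add: power2_eq_square)
  qed
  have "bigqJK_sum Q TA TB TC A B n m + A * PK n (TC * Q) * PK m (TC * Q) + B * PK n (TA * Q) * PK m (TA * Q) =
    (if n = m then bigqJK_norm2 Q TA TB TC A B n else 0)"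
    by (rule LIMSEQ_unique[OF Lim_transform_eventually[OF lhs eq] rhs])
  then show ?thesis by (simp add: bigqJK_orthogonality_def Let_def)
qed

end

theorem mainTheorem7:
  fixes q ta tb tc A B \<alpha> \<beta> :: real and a b :: "nat \<Rightarrow> complex"
  assumes "0 < q" and "q < 1"
    and "0 < q * ta" and "q * ta < 1"
    and "0 < q * tb" and "q * tb < 1"
    and "tc < 0"
    and "\<And>m::nat. bigqJK_kappa q ta tb tc A B (int m) \<noteq> 0"
    and "q powr \<alpha> = ta" and "q powr \<beta> = tb"
    and "\<And>N. N \<ge> 1 \<Longrightarrow> b N - a N = of_nat (N + 1)"
    and "\<And>N. N \<ge> 1 \<Longrightarrow> complex_of_real q powr (a N + b N) = complex_of_real (tc / ta)"
  shows
    "(let C = (\<lambda>N. scaleC q ta (a N) (b N) N);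
          u = (\<lambda>N. qRacahK q \<alpha> \<beta> (a N) (b N) A B);
          P = bigqJK q ta tb tc A B;
          scale = (\<lambda>N. complex_of_real q ^ (N + 1) * complex_of_real ta *
                       (complex_of_real q powr (a N + 1) / c1 q))
      in
       \<comment> \<open>(1)\<close>
       (\<forall>n s::nat.
          (\<lambda>N. C N n * u N n (of_nat s + a N)) \<longlonglongrightarrow> P n (tc * q ^ (s + 1)) \<and>
          (\<lambda>N. C N n * u N n (of_nat N - of_nat s + a N)) \<longlonglongrightarrow> P n (ta * q ^ (s + 1))) \<and>
       \<comment> \<open>(2)\<close>
       (\<forall>n m::nat.
          summable (bigqJK_summand q ta tb tc A B tc n m) \<and>
          summable (bigqJK_summand q ta tb tc A B ta n m) \<and>
          (\<lambda>N. C N n * C N m * qRacahK_sum q \<alpha> \<beta> (a N) (b N) A B N n m)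
             \<longlonglongrightarrow> bigqJK_sum q ta tb tc A B n m \<and>
          (\<lambda>N. C N n * C N m * (A * u N n (a N) * u N m (a N)))
             \<longlonglongrightarrow> A * P n (tc * q) * P m (tc * q) \<and>
          (\<lambda>N. C N n * C N m * (B * u N n (b N - 1) * u N m (b N - 1)))
             \<longlonglongrightarrow> B * P n (ta * q) * P m (ta * q) \<and>
          ((\<forall>\<^sub>F N in sequentially. qRacahK_orthogonality q \<alpha> \<beta> (a N) (b N) A B N n m)
             \<longrightarrow> bigqJK_orthogonality q ta tb tc A B n m)) \<and>
       (\<forall>n::nat.
          (\<lambda>N. C N n ^ 2 * qRacahK_norm2 q \<alpha> \<beta> (a N) (b N) A B n)
             \<longlonglongrightarrow> bigqJK_norm2 q ta tb tc A B n) \<and>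
       \<comment> \<open>(3)\<close>
       (\<forall>n::nat.
          (\<lambda>N. scale N * (qRacahK_beta q \<alpha> \<beta> (a N) (b N) A B n - c3 q))
             \<longlonglongrightarrow> bigqJK_beta q ta tb tc A B n \<and>
          (n \<ge> 1 \<longrightarrow>
             (\<lambda>N. scale N * (C N n / C N (n - 1)) * qRacahK_gamma q \<alpha> \<beta> (a N) (b N) A B n)
               \<longlonglongrightarrow> bigqJK_gamma q ta tb tc A B n) \<and>
          ((\<forall>\<^sub>F N in sequentially. \<forall>s. qRacahK_recurrence q \<alpha> \<beta> (a N) (b N) A B n s)
             \<longrightarrow> (\<forall>z. z \<noteq> 0 \<longrightarrow> bigqJK_recurrence q ta tb tc A B n z))))"
proof -
  have powr_sum: "\<And>N. N \<ge> 1 \<Longrightarrow> complex_of_real q powr (a N + b N) = complex_of_real tc / complex_of_real ta"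
    using assms(12) by (simp only: of_real_divide)
  interpret krall_limit q ta tb tc \<alpha> \<beta> "complex_of_real A" "complex_of_real B" a b
    by unfold_locales (fact assms powr_sum)+
  show ?thesis
    unfolding Let_def of_real_mult of_real_power
    by (intro conjI allI impI uK_left uK_right sum_limit mass_limits orthogonality_limit norm2_tendsto
        beta_tendsto gamma_tendsto' recurrence_limit)
qed

end
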